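(* Let $m,n\ge 1$ be integers, let $0<p_1,\dots,p_m<\infty$ and $p=(1/p_1+\cdots+1/p_m)^{-1}$, and let $1<r<\infty$ and $s>0$ be fixed. Suppose that there exists a constant $C$ such that $$\|T_\sigma\|_{L^{p_1}(\mathbb R^n)\times\cdots\times L^{p_m}(\mathbb R^n)\to L^p(\mathbb R^n)}\le C\sup_{j\in\mathbb Z}\|\sigma(2^j\cdot)\,\widehat\Psi\,\|_{L^r_s(\mathbb R^{mn})}$$ for all bounded functions $\sigma$ on $\mathbb R^{mn}$ for which the right-hand side is finite. Then for every subset $I$ of $\{1,2,\dots,m\}$ (including $I=\emptyset$, in which case the sum below is zero), $$\frac1p-\frac12\le\frac sn+\sum_{i\in I}\Big(\frac1{p_i}-\frac12\Big).$$
   Context: The Fourier transform is $\widehat f(\xi)=\int_{\mathbb R^n} f(x)e^{-2\pi i x\cdot\xi}\,dx$. For a bounded (complex-valued, measurable) function $\sigma$ on $\mathbb R^{mn}=\mathbb R^n\times\cdots\times\mathbb R^n$, the $m$-linear multiplier operator $T_\sigma$ is defined on $m$-tuples of Schwartz functions on $\mathbb R^n$ by $$T_\sigma(f_1,\dots,f_m)(x)=\int_{\mathbb R^{mn}}\sigma(\xi_1,\dots,\xi_m)\widehat f_1(\xi_1)\cdots\widehat f_m(\xi_m)e^{2\pi i x\cdot(\xi_1+\cdots+\xi_m)}\,d\xi_1\cdots d\xi_m,$$ and $\|T_\sigma\|_{L^{p_1}\times\cdots\times L^{p_m}\to L^p}$ is the smallest constant $K\in[0,\infty]$ such that $\|T_\sigma(f_1,\dots,f_m)\|_{L^p}\le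 K\prod_{i=1}^m\|f_i\|_{L^{p_i}}$ for all Schwartz functions $f_1,\dots,f_m$ (for exponents less than $1$, $\|\cdot\|_{L^q}$ is the usual quasi-norm). The function $\widehat\Psi\in\mathcal C_0^\infty(\mathbb R^{mn})$ is fixed, nonnegative, supported in the annulus $\{\vec\xi\in\mathbb R^{mn}:1/2\le|\vec\xi|\le 2\}$, and satisfies $\sum_{j\in\mathbb Z}\widehat\Psi(2^{-j}\vec\xi)=1$ for all $\vec\xi\ne 0$. For $1<r<\infty$ and $s>0$, $L^r_s(\mathbb R^d)$ is the Sobolev space of all $h$ with $(I-\Delta)^{s/2}h\in L^r(\mathbb R^d)$, where $\Delta$ is the Laplacian, with norm $\|h\|_{L^r_s(\mathbb R^d)}=\|(I-\Delta)^{s/2}h\|_{L^r(\mathbb R^d)}$. *)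

theory Defs
  imports "HOL-Analysis.Analysis"
begin

text \<open>
  The space of $m$-tuples of vectors of $n$-dimensional space is rendered as
  \<^typ>\<open>real^'n^'m\<close>; its norm, inner product and Lebesgue measure are the
  Euclidean ones in $mn$ dimensions.
\<close>

fun iter_partial ::
  "'a::euclidean_space list \<Rightarrow> ('a \<Rightarrow> 'b::real_normed_vector) \<Rightarrow> 'a \<Rightarrow> 'b" where
  "iter_partial [] f = f"
| "iter_partial (v # vs) f = (\<lambda>x. frechet_derivative (iter_partial vs f) (at x) v)"

text \<open>
  Differentiability of every iterated partial derivative makes all of them continuous, so
  this is the usual class of infinitely differentiable functions.
\<close>

definition smooth :: "('a::euclidean_space \<Rightarrow> 'b::real_normed_vector) \<Rightarrow> bool" where
  "smooth f \<longleftrightarrow> (\<forall>vs. set vs \<subseteq> Basis \<longrightarrow> (\<forall>x. iter_partial vs f differentiable (at x)))"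

definition schwartz :: "('a::euclidean_space \<Rightarrow> complex) \<Rightarrow> bool" where
  "schwartz f \<longleftrightarrow> smooth f \<and>
     (\<forall>vs k. set vs \<subseteq> Basis \<longrightarrow>
        bounded (range (\<lambda>x. (1 + norm x) ^ k *\<^sub>R iter_partial vs f x)))"

definition fourier :: "('a::euclidean_space \<Rightarrow> complex) \<Rightarrow> 'a \<Rightarrow> complex" where
  "fourier f \<xi> = (LINT x|lebesgue. f x * cis (- 2 * pi * (x \<bullet> \<xi>)))"

text \<open>The (quasi-)norm of $L^q$, with value \<^term>\<open>\<infinity>\<close> outside that space.\<close>

definition Lp_norm :: "real \<Rightarrow> ('a::euclidean_space \<Rightarrow> complex) \<Rightarrow> ennreal" where
  "Lp_norm q f =
     (let J = (\<integral>\<^sup>+x. ennreal (norm (f x) powr q) \<partial>lebesgue)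
      in if J = \<infinity> then \<infinity> else ennreal (enn2real J powr (1 / q)))"

definition multilinear_mult ::
  "(real^'n^'m \<Rightarrow> complex) \<Rightarrow> ('m \<Rightarrow> real^'n \<Rightarrow> complex) \<Rightarrow> real^'n \<Rightarrow> complex" where
  "multilinear_mult \<sigma> f x =
     (LINT \<xi>|lebesgue. \<sigma> \<xi> * (\<Prod>i\<in>UNIV. fourier (f i) (\<xi> $ i)) *
        cis (2 * pi * (x \<bullet> (\<Sum>i\<in>UNIV. \<xi> $ i))))"

text \<open>The infimum is attained, hence it is the smallest admissible constant.\<close>

definition mult_opnorm :: "('m \<Rightarrow> real) \<Rightarrow> real \<Rightarrow> (real^'n^'m \<Rightarrow> complex) \<Rightarrow> ennreal" where
  "mult_opnorm ps p \<sigma> =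
     Inf {K. \<forall>f. (\<forall>i. schwartz (f i)) \<longrightarrow>
            Lp_norm p (multilinear_mult \<sigma> f) \<le> K * (\<Prod>i\<in>UNIV. Lp_norm (ps i) (f i))}"

text \<open>
  The operator $(I-\Delta)^{s/2}$ on Schwartz functions. With the normalisation of
  \<^const>\<open>fourier\<close>, the symbol of $I-\Delta$ is $1+4\pi^2|\xi|^2$.
\<close>

definition bessel_op :: "real \<Rightarrow> ('a::euclidean_space \<Rightarrow> complex) \<Rightarrow> 'a \<Rightarrow> complex" where
  "bessel_op s \<phi> x =
     (LINT \<xi>|lebesgue. of_real ((1 + 4 * pi\<^sup>2 * (norm \<xi>)\<^sup>2) powr (s / 2)) * fourier \<phi> \<xi> *
        cis (2 * pi * (x \<bullet> \<xi>)))"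

text \<open>Functions that act on Schwartz functions by integration, i.e. define tempered
  distributions.\<close>

definition tempered_fun :: "('a::euclidean_space \<Rightarrow> complex) \<Rightarrow> bool" where
  "tempered_fun h \<longleftrightarrow> h \<in> borel_measurable lebesgue \<and>
     (\<forall>\<phi>. schwartz \<phi> \<longrightarrow> integrable lebesgue (\<lambda>x. h x * \<phi> x))"

text \<open>
  $(I-\Delta)^{s/2}h=g$ in the sense of tempered distributions: the symbol is even, so the
  operator is its own transpose for the bilinear pairing.
\<close>

definition bessel_op_dist ::
  "real \<Rightarrow> ('a::euclidean_space \<Rightarrow> complex) \<Rightarrow> ('a \<Rightarrow> complex) \<Rightarrow> bool" where
  "bessel_op_dist s h g \<longleftrightarrow> tempered_fun h \<and> tempered_fun g \<and>
     (\<forall>\<phi>. schwartz \<phi> \<longrightarrow>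
        (LINT x|lebesgue. g x * \<phi> x) = (LINT x|lebesgue. h x * bessel_op s \<phi> x))"

text \<open>
  The norm of $L^r_s$, with value \<^term>\<open>\<infinity>\<close> outside that space. The function $g$ is determined
  almost everywhere by $h$, so the infimum is over at most one value. For $s>0$ and $1<r<\infty$
  every element of $L^r_s$ is a function, so restricting to functions loses nothing.
\<close>

definition sobolev_norm :: "real \<Rightarrow> real \<Rightarrow> ('a::euclidean_space \<Rightarrow> complex) \<Rightarrow> ennreal" where
  "sobolev_norm r s h = Inf {Lp_norm r g | g. bessel_op_dist s h g}"

definition dyadic_partition :: "('a::euclidean_space \<Rightarrow> real) \<Rightarrow> bool" where
  "dyadic_partition \<Psi> \<longleftrightarrow> smooth \<Psi> \<and> (\<forall>\<xi>. 0 \<le> \<Psi> \<xi>) \<and>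
     closure {\<xi>. \<Psi> \<xi> \<noteq> 0} \<subseteq> {\<xi>. 1/2 \<le> norm \<xi> \<and> norm \<xi> \<le> 2} \<and>
     (\<forall>\<xi>. \<xi> \<noteq> 0 \<longrightarrow> ((\<lambda>j::int. \<Psi> ((2 powi (- j)) *\<^sub>R \<xi>)) has_sum 1) UNIV)"

definition sup_sobolev ::
  "real \<Rightarrow> real \<Rightarrow> ('a::euclidean_space \<Rightarrow> real) \<Rightarrow> ('a \<Rightarrow> complex) \<Rightarrow> ennreal" where
  "sup_sobolev r s \<Psi> \<sigma> =
     (SUP j::int. sobolev_norm r s (\<lambda>\<xi>. \<sigma> ((2 powi j) *\<^sub>R \<xi>) * of_real (\<Psi> \<xi>)))"

end

theory Submission
  imports Defs "HOL-Probability.Probability" "HOL-Real_Asymp.Real_Asymp"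
begin

text \<open>
  Fix a set \<open>I\<close> of indices and write \<open>S \<xi> = \<xi>\<^sub>1 + \<dots> + \<xi>\<^sub>m\<close>. The inequality for \<open>I\<close> is the comparison,
  as \<open>N \<rightarrow> \<infinity>\<close>, of two powers of \<open>N\<close> attached to the Gaussian chirps
  \<open>\<sigma>\<^sub>N(\<xi>) = exp(-\<pi>(|\<xi>|\<^sup>2 + |S \<xi>|\<^sup>2)) exp(-i\<pi>N(\<Sum>\<^sub>i\<^sub>\<in>\<^sub>I |\<xi>\<^sub>i|\<^sup>2 + |S \<xi>|\<^sup>2))\<close>.

  Upper bound. On the annulus carrying \<open>\<Psi>\<close>, each derivative of \<open>\<sigma>\<^sub>N(2\<^sup>j \<xi>) \<Psi>(\<xi>)\<close> costs at most a factor of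
  order \<open>N\<close>, uniformly in \<open>j\<close>: the phase contributes \<open>4\<^sup>j N\<close>, and the real Gaussian absorbs every power
  of \<open>4\<^sup>j\<close>. Hence the right-hand side of the hypothesis is at most a constant times \<open>N\<^sup>s\<close>
  (\<open>sup_sobolev_chirp\<close>). For \<open>s\<close> not an even integer this needs an interpolation between two integer
  powers of \<open>1 - \<Delta>\<close>. With \<open>s/2 = k + \<theta>\<close>, the number \<open>\<lambda>\<^sup>\<theta>\<close> is \<open>\<lambda>\<close> times a superposition of \<open>exp(-\<tau>\<lambda>)\<close>
  over small \<open>\<tau>\<close>, plus a superposition over large \<open>\<tau>\<close> (\<open>fractional_power_identity\<close>). Applied to
  \<open>\<lambda> = 1 + 4\<pi>\<^sup>2|\<xi>|\<^sup>2\<close>, the functions \<open>exp(-\<tau>\<lambda>)\<close> are the symbols of damped heat operators, which do not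
  increase the sup norm or the \<open>L\<^sup>1\<close> norm. So \<open>(1 - \<Delta>)\<^bsup>s/2\<^esup> h\<close> is controlled in both of these norms by
  \<open>(1 - \<Delta>)\<^sup>k h\<close> and \<open>(1 - \<Delta>)\<^bsup>k+1\<^esup> h\<close>, and the \<open>L\<^sup>r\<close> norm lies between them (\<open>bessel_op_interpolation\<close>).

  Lower bound. For \<open>i \<notin> I\<close> let \<open>f\<^sub>i\<close> be the standard Gaussian. For \<open>i \<in> I\<close> let \<open>f\<^sub>i\<close> be the Gaussian whose
  Fourier transform is a multiple of \<open>exp(-\<pi>(1 - iN)|\<xi>|\<^sup>2)\<close>; it has height \<open>1\<close> and width \<open>N\<close>, and its
  Fourier transform has height \<open>N\<^bsup>n/2\<^esup>\<close>. The phases in \<open>\<xi>\<^sub>i\<close> cancel, and what remains of \<open>\<sigma>\<^sub>N\<close> is the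
  chirp in \<open>S \<xi>\<close>, which spreads the output over a ball of radius \<open>N\<close> with the factor \<open>N\<^bsup>-n/2\<^esup>\<close>.
  Everything is an explicit Gaussian (\<open>multilinear_mult_chirp\<close>), and
  \<open>\<parallel>T(f)\<parallel>\<^sub>p / \<Prod> \<parallel>f\<^sub>i\<parallel>\<close> is of order \<open>N\<^sup>E\<close> with \<open>E = n/p - n/2 + \<Sum>\<^sub>i\<^sub>\<in>\<^sub>I (n/2 - n/p\<^sub>i)\<close>.
  Therefore \<open>E \<le> s\<close>, which is the claim multiplied by \<open>n\<close>.
\<close>

section \<open>Smooth and Schwartz functions\<close>

definition dir_deriv :: "'a::euclidean_space \<Rightarrow> ('a \<Rightarrow> 'b::real_normed_vector) \<Rightarrow> 'a \<Rightarrow> 'b" where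
  "dir_deriv b f = (\<lambda>x. frechet_derivative f (at x) b)"

lemma iter_partial_Cons_dir_deriv: "iter_partial (v # vs) f = dir_deriv v (iter_partial vs f)"
  by (simp add: dir_deriv_def)

lemma iter_partial_snoc: "iter_partial (vs @ [b]) f = iter_partial vs (dir_deriv b f)"
  by (induction vs) (simp_all add: dir_deriv_def)

lemma dir_deriv_eqI: "(f has_derivative f') (at x) \<Longrightarrow> dir_deriv b f x = f' b"
  unfolding dir_deriv_def using frechet_derivative_at by fastforce

lemma has_derivative_dir_deriv:
  "f differentiable (at x) \<Longrightarrow> (f has_derivative (\<lambda>b. dir_deriv b f x)) (at x)"
  unfolding dir_deriv_def by (simp add: frechet_derivative_works)

lemma dir_deriv_add:
  assumes "f differentiable (at x)" "g differentiable (at x)"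
  shows "dir_deriv b (\<lambda>x. f x + g x) x = dir_deriv b f x + dir_deriv b g x"
  by (rule dir_deriv_eqI) (intro has_derivative_add has_derivative_dir_deriv assms)

lemma dir_deriv_mult:
  fixes f g :: "'a::euclidean_space \<Rightarrow> 'b::real_normed_algebra"
  assumes "f differentiable (at x)" "g differentiable (at x)"
  shows "dir_deriv b (\<lambda>x. f x * g x) x = f x * dir_deriv b g x + dir_deriv b f x * g x"
  by (rule dir_deriv_eqI) (intro has_derivative_mult has_derivative_dir_deriv assms)

lemma dir_deriv_const: "dir_deriv b (\<lambda>x. c) x = 0"
  by (rule dir_deriv_eqI) (rule has_derivative_const)

lemma dir_deriv_bounded_linear:
  assumes "bounded_linear L" shows "dir_deriv b L x = L b"
  by (rule dir_deriv_eqI) (rule bounded_linear_imp_has_derivative[OF assms])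

text \<open>
  Smoothness quantifies over all iterated partial derivatives. It is easier to exhibit a class of
  differentiable functions that is stable under each coordinate derivative; products, sums and
  Gaussians are all handled by choosing such a class.
\<close>
lemma smooth_coinduct:
  assumes "X f"
    and "\<And>f x. X f \<Longrightarrow> f differentiable (at x)"
    and "\<And>f b. X f \<Longrightarrow> b \<in> Basis \<Longrightarrow> X (dir_deriv b f)"
  shows "smooth f"
proof -
  have "X (iter_partial vs f)" if "set vs \<subseteq> Basis" for vs
    using that
  proof (induction vs)
    case Nil
    show ?case using assms(1) by simp
  next
    case (Cons v vs)
    then show ?case unfolding iter_partial_Cons_dir_deriv using assms(3) by simp
  qed
  then show ?thesis unfolding smooth_def using assms(2) by blast
qed

lemma smooth_differentiable: "smooth f \<Longrightarrow> f differentiable (at x)"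
  unfolding smooth_def by (metis empty_subsetI iter_partial.simps(1) list.set(1))

lemma smooth_dir_deriv: "smooth f \<Longrightarrow> b \<in> Basis \<Longrightarrow> smooth (dir_deriv b f)"
  unfolding smooth_def iter_partial_snoc[symmetric] by simp

lemma smooth_const: "smooth (\<lambda>x. c)"
proof (rule smooth_coinduct[where X = "\<lambda>f. \<exists>c. f = (\<lambda>x. c)"])
  fix f :: "'a \<Rightarrow> 'b" and b :: 'a
  assume "\<exists>c. f = (\<lambda>x. c)"
  then show "\<exists>c. dir_deriv b f = (\<lambda>x. c)" using dir_deriv_const by blast
qed auto

lemma smooth_linear:
  assumes "bounded_linear L" shows "smooth L"
proof (rule smooth_coinduct[where X = "\<lambda>f. f = L \<or> (\<exists>c. f = (\<lambda>x. c))"])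
  fix f :: "'a \<Rightarrow> 'b" and b :: 'a
  assume "f = L \<or> (\<exists>c. f = (\<lambda>x. c))"
  then have "dir_deriv b f = (\<lambda>x. L b) \<or> dir_deriv b f = (\<lambda>x. 0)"
    using dir_deriv_bounded_linear[OF assms] dir_deriv_const by blast
  then show "dir_deriv b f = L \<or> (\<exists>c. dir_deriv b f = (\<lambda>x. c))" by blast
next
  fix f :: "'a \<Rightarrow> 'b" and x
  assume "f = L \<or> (\<exists>c. f = (\<lambda>x. c))"
  then show "f differentiable (at x)"
    using assms bounded_linear_imp_differentiable by auto
qed auto

text \<open>The smallest class that contains the products of smooth functions and is closed under the
  Leibniz rule.\<close>
inductive sum_of_products :: "('a::euclidean_space \<Rightarrow> 'b::real_normed_algebra) \<Rightarrow> bool" where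
  prod: "smooth f \<Longrightarrow> smooth g \<Longrightarrow> sum_of_products (\<lambda>x. f x * g x)"
| sum: "sum_of_products f \<Longrightarrow> sum_of_products g \<Longrightarrow> sum_of_products (\<lambda>x. f x + g x)"

lemma sum_of_products_differentiable: "sum_of_products f \<Longrightarrow> f differentiable (at x)"
  by (induction rule: sum_of_products.induct)
     (auto intro: differentiable_mult differentiable_add smooth_differentiable)

lemma sum_of_products_dir_deriv:
  assumes "sum_of_products f" "b \<in> Basis" shows "sum_of_products (dir_deriv b f)"
  using assms(1)
proof (induction rule: sum_of_products.induct)
  case (prod f g)
  then have "dir_deriv b (\<lambda>x. f x * g x) = (\<lambda>x. f x * dir_deriv b g x + dir_deriv b f x * g x)"
    by (auto simp: fun_eq_iff intro!: dir_deriv_mult smooth_differentiable)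
  then show ?case
    using prod assms(2) by (auto intro!: sum_of_products.intros smooth_dir_deriv)
next
  case (sum f g)
  then have "dir_deriv b (\<lambda>x. f x + g x) = (\<lambda>x. dir_deriv b f x + dir_deriv b g x)"
    by (auto simp: fun_eq_iff intro!: dir_deriv_add sum_of_products_differentiable)
  then show ?case using sum by (auto intro: sum_of_products.intros)
qed

lemma sum_of_products_smooth: "sum_of_products f \<Longrightarrow> smooth f"
  by (rule smooth_coinduct[where X = sum_of_products])
     (auto intro: sum_of_products_differentiable sum_of_products_dir_deriv)

lemma smooth_mult:
  fixes f g :: "'a::euclidean_space \<Rightarrow> 'b::real_normed_algebra"
  shows "smooth f \<Longrightarrow> smooth g \<Longrightarrow> smooth (\<lambda>x. f x * g x)"
  by (rule sum_of_products_smooth[OF sum_of_products.prod])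

lemma smooth_add:
  fixes f g :: "'a::euclidean_space \<Rightarrow> 'b::real_normed_algebra_1"
  assumes "smooth f" "smooth g" shows "smooth (\<lambda>x. f x + g x)"
  using sum_of_products_smooth[OF sum_of_products.sum[OF
      sum_of_products.prod[OF assms(1) smooth_const[of 1]]
      sum_of_products.prod[OF assms(2) smooth_const[of 1]]]] by simp

lemma smooth_sum:
  fixes f :: "'i \<Rightarrow> 'a::euclidean_space \<Rightarrow> 'b::real_normed_algebra_1"
  assumes "\<And>i. i \<in> A \<Longrightarrow> smooth (f i)" shows "smooth (\<lambda>x. \<Sum>i\<in>A. f i x)"
  using assms
  by (induction A rule: infinite_finite_induct) (auto intro: smooth_add smooth_const)

lemma smooth_of_real:
  fixes f :: "'a::euclidean_space \<Rightarrow> real"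
  assumes "smooth f" shows "smooth (\<lambda>x. of_real (f x) :: complex)"
proof (rule smooth_coinduct[where X = "\<lambda>h. \<exists>f. smooth f \<and> h = (\<lambda>x. of_real (f x) :: complex)"])
  fix h :: "'a \<Rightarrow> complex" and b :: 'a
  assume "\<exists>f. smooth f \<and> h = (\<lambda>x. of_real (f x))" and b: "b \<in> Basis"
  then obtain f where f: "smooth f" "h = (\<lambda>x. of_real (f x))" by auto
  have "dir_deriv b h = (\<lambda>x. of_real (dir_deriv b f x))"
    unfolding f(2) fun_eq_iff
    by (auto intro!: dir_deriv_eqI[where f'="\<lambda>b. of_real (dir_deriv b f _)"] has_derivative_of_real
          has_derivative_dir_deriv smooth_differentiable f)
  then show "\<exists>f. smooth f \<and> dir_deriv b h = (\<lambda>x. of_real (f x))"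
    using smooth_dir_deriv[OF f(1) b] by auto
next
  fix h :: "'a \<Rightarrow> complex" and x
  assume "\<exists>f. smooth f \<and> h = (\<lambda>x. of_real (f x))"
  then obtain f where f: "smooth f" "h = (\<lambda>x. of_real (f x))" by auto
  from has_derivative_of_real[OF has_derivative_dir_deriv[OF smooth_differentiable[OF f(1)]]]
  show "h differentiable (at x)"
    unfolding f(2) differentiable_def by blast
qed (use assms in auto)

lemma smooth_inner_left: "smooth (\<lambda>x. complex_of_real (x \<bullet> v))"
  by (intro smooth_of_real smooth_linear bounded_linear_inner_left)

text \<open>The decay condition of the Schwartz class for a single function, without its derivatives.\<close>
definition rapid :: "('a::euclidean_space \<Rightarrow> complex) \<Rightarrow> bool" where
  "rapid f \<longleftrightarrow> (\<forall>k. \<exists>C. \<forall>x. (1 + norm x) ^ k * norm (f x) \<le> C)"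

lemma rapidD: "rapid f \<Longrightarrow> \<exists>C. \<forall>x. (1 + norm x) ^ k * norm (f x) \<le> C"
  unfolding rapid_def by blast

lemma rapid_iff_bounded:
  "rapid f \<longleftrightarrow> (\<forall>k. bounded (range (\<lambda>x. (1 + norm x) ^ k *\<^sub>R f x)))"
  unfolding rapid_def bounded_iff by (auto simp: abs_of_nonneg)

lemma schwartz_iff: "schwartz f \<longleftrightarrow> smooth f \<and> (\<forall>vs. set vs \<subseteq> Basis \<longrightarrow> rapid (iter_partial vs f))"
  unfolding schwartz_def rapid_iff_bounded by blast

lemma schwartz_rapid: "schwartz f \<Longrightarrow> rapid f"
  unfolding schwartz_iff by (metis empty_subsetI iter_partial.simps(1) list.set(1))

lemma schwartz_smooth: "schwartz f \<Longrightarrow> smooth f"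
  unfolding schwartz_iff by blast

lemma schwartz_dir_deriv: "schwartz f \<Longrightarrow> b \<in> Basis \<Longrightarrow> schwartz (dir_deriv b f)"
  unfolding schwartz_iff using smooth_dir_deriv by (fastforce simp: iter_partial_snoc[symmetric])

text \<open>The analogue of \<open>smooth_coinduct\<close>: every member of the class must also decay rapidly.\<close>
lemma schwartz_coinduct:
  assumes "X f"
    and d: "\<And>f x. X f \<Longrightarrow> f differentiable (at x)"
    and p: "\<And>f b. X f \<Longrightarrow> b \<in> Basis \<Longrightarrow> X (dir_deriv b f)"
    and r: "\<And>f. X f \<Longrightarrow> rapid f"
  shows "schwartz f"
proof -
  have "X (iter_partial vs f)" if "set vs \<subseteq> Basis" for vs
    using that
  proof (induction vs)
    case Nil
    show ?case using assms(1) by simp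
  next
    case (Cons v vs)
    then show ?case unfolding iter_partial_Cons_dir_deriv using p by simp
  qed
  then show ?thesis
    unfolding schwartz_iff using r smooth_coinduct[of X f] assms(1) d p by auto
qed

lemma rapid_mult_bounded_poly:
  assumes "rapid f" and h: "\<And>x. norm (h x) \<le> A * (1 + norm x) ^ l"
  shows "rapid (\<lambda>x. h x * f x)"
  unfolding rapid_def
proof
  fix k
  obtain C where C: "\<And>x. (1 + norm x) ^ (k + l) * norm (f x) \<le> C"
    using rapidD[OF assms(1)] by blast
  have "(1 + norm x) ^ k * norm (h x * f x) \<le> \<bar>A\<bar> * C" for x
  proof -
    have "norm (h x) \<le> \<bar>A\<bar> * (1 + norm x) ^ l"
      using h[of x] by (rule order_trans) (auto intro: mult_right_mono)
    then have "(1 + norm x) ^ k * norm (h x * f x)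
        \<le> (1 + norm x) ^ k * ((\<bar>A\<bar> * (1 + norm x) ^ l) * norm (f x))"
      by (auto simp: norm_mult intro!: mult_left_mono mult_right_mono)
    also have "\<dots> = \<bar>A\<bar> * ((1 + norm x) ^ (k + l) * norm (f x))"
      by (simp add: power_add)
    also have "\<dots> \<le> \<bar>A\<bar> * C" using C by (intro mult_left_mono) auto
    finally show ?thesis .
  qed
  then show "\<exists>C. \<forall>x. (1 + norm x) ^ k * norm (h x * f x) \<le> C" by blast
qed

lemma rapid_add:
  assumes "rapid f" "rapid g" shows "rapid (\<lambda>x. f x + g x)"
  unfolding rapid_def
proof
  fix k
  obtain C D where "\<And>x. (1 + norm x) ^ k * norm (f x) \<le> C" "\<And>x. (1 + norm x) ^ k * norm (g x) \<le> D"
    using rapidD[OF assms(1)] rapidD[OF assms(2)] by metis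
  moreover have "(1 + norm x) ^ k * norm (f x + g x)
       \<le> (1 + norm x) ^ k * norm (f x) + (1 + norm x) ^ k * norm (g x)" for x
    unfolding distrib_left[symmetric] by (intro mult_left_mono norm_triangle_ineq) auto
  ultimately have "\<forall>x. (1 + norm x) ^ k * norm (f x + g x) \<le> C + D"
    by (meson add_mono order_trans)
  then show "\<exists>C. \<forall>x. (1 + norm x) ^ k * norm (f x + g x) \<le> C" by blast
qed

lemma schwartz_add:
  assumes "schwartz f" "schwartz g" shows "schwartz (\<lambda>x. f x + g x)"
proof (rule schwartz_coinduct[where X = "\<lambda>h. \<exists>f g. schwartz f \<and> schwartz g \<and> h = (\<lambda>x. f x + g x)"])
  fix h :: "'a \<Rightarrow> complex" and b :: 'a
  assume "\<exists>f g. schwartz f \<and> schwartz g \<and> h = (\<lambda>x. f x + g x)" and b: "b \<in> Basis"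
  then obtain f g where *: "schwartz f" "schwartz g" "h = (\<lambda>x. f x + g x)" by auto
  then have "dir_deriv b h = (\<lambda>x. dir_deriv b f x + dir_deriv b g x)"
    unfolding *(3) by (auto simp: fun_eq_iff intro!: dir_deriv_add smooth_differentiable schwartz_smooth)
  then show "\<exists>f g. schwartz f \<and> schwartz g \<and> dir_deriv b h = (\<lambda>x. f x + g x)"
    using * b schwartz_dir_deriv by blast
next
  fix h :: "'a \<Rightarrow> complex" and x
  assume "\<exists>f g. schwartz f \<and> schwartz g \<and> h = (\<lambda>x. f x + g x)"
  then show "h differentiable (at x)"
    by (auto intro!: differentiable_add intro: smooth_differentiable schwartz_smooth)
qed (use assms in \<open>auto intro!: rapid_add intro: schwartz_rapid\<close>)

lemma schwartz_cmult:
  assumes "schwartz f" shows "schwartz (\<lambda>x. c * f x)"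
proof (rule schwartz_coinduct[where X = "\<lambda>h. \<exists>f. schwartz f \<and> h = (\<lambda>x. c * f x)"])
  fix h :: "'a \<Rightarrow> complex" and b :: 'a
  assume "\<exists>f. schwartz f \<and> h = (\<lambda>x. c * f x)" and b: "b \<in> Basis"
  then obtain f where *: "schwartz f" "h = (\<lambda>x. c * f x)" by auto
  then have "dir_deriv b h = (\<lambda>x. c * dir_deriv b f x)"
    unfolding *(2) by (auto simp: fun_eq_iff dir_deriv_mult dir_deriv_const smooth_differentiable schwartz_smooth)
  then show "\<exists>f. schwartz f \<and> dir_deriv b h = (\<lambda>x. c * f x)"
    using * b schwartz_dir_deriv by blast
next
  fix h :: "'a \<Rightarrow> complex"
  assume "\<exists>f. schwartz f \<and> h = (\<lambda>x. c * f x)"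
  then show "rapid h"
    using rapid_mult_bounded_poly[where h="\<lambda>_. c" and A="norm c" and l=0] schwartz_rapid by auto
next
  fix h :: "'a \<Rightarrow> complex" and x
  assume "\<exists>f. schwartz f \<and> h = (\<lambda>x. c * f x)"
  then show "h differentiable (at x)"
    by (auto intro!: differentiable_mult intro: smooth_differentiable schwartz_smooth)
qed (use assms in auto)

lemma schwartz_sum:
  assumes "finite A" "A \<noteq> {}" "\<And>i. i \<in> A \<Longrightarrow> schwartz (f i)"
  shows "schwartz (\<lambda>x. \<Sum>i\<in>A. f i x)"
  using assms by (induction A rule: finite_ne_induct) (auto intro: schwartz_add)

section \<open>Complex Gaussians\<close>
definition gauss :: "complex \<Rightarrow> 'a::euclidean_space \<Rightarrow> complex" where
  "gauss c x = exp (- (of_real pi * c * of_real ((norm x)\<^sup>2)))"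

lemma norm_gauss: "norm (gauss c x) = exp (- (pi * Re c * (norm x)\<^sup>2))"
  unfolding gauss_def by (simp add: norm_exp_eq_Re)

text \<open>
  Polynomial multiples of a Gaussian, generated by multiplication with linear forms, so that the
  class is visibly stable under differentiation. This shows that Gaussians are Schwartz functions,
  together with the polynomial multiples that occur as moments.
\<close>
inductive gauss_poly :: "complex \<Rightarrow> ('a::euclidean_space \<Rightarrow> complex) \<Rightarrow> bool" for c where
  base: "gauss_poly c (gauss c)"
| coord: "gauss_poly c f \<Longrightarrow> gauss_poly c (\<lambda>x. of_real (x \<bullet> b) * f x)"
| cmult: "gauss_poly c f \<Longrightarrow> gauss_poly c (\<lambda>x. k * f x)"
| sum: "gauss_poly c f \<Longrightarrow> gauss_poly c g \<Longrightarrow> gauss_poly c (\<lambda>x. f x + g x)"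

lemma has_derivative_gauss:
  "(gauss c has_derivative (\<lambda>h. - (2 * of_real pi * c) * (of_real (x \<bullet> h) * gauss c x))) (at x)"
proof -
  have "((\<lambda>x. - (of_real pi * c * of_real (x \<bullet> x))) has_derivative
      (\<lambda>h. - (of_real pi * c * of_real (x \<bullet> h + h \<bullet> x)))) (at x)"
    by (auto intro!: derivative_eq_intros)
  then have "((\<lambda>x. exp (- (of_real pi * c * of_real (x \<bullet> x)))) has_derivative
      (\<lambda>h. exp (- (of_real pi * c * of_real (x \<bullet> x))) * (- (of_real pi * c * of_real (x \<bullet> h + h \<bullet> x))))) (at x)"
    using has_derivative_compose[OF _ DERIV_exp[unfolded has_field_derivative_def]] by fast
  then show ?thesis
    unfolding gauss_def power2_norm_eq_inner
    by (rule has_derivative_eq_rhs) (simp add: fun_eq_iff inner_commute algebra_simps)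
qed

lemma gauss_poly_differentiable: "gauss_poly c f \<Longrightarrow> f differentiable (at x)"
proof (induction rule: gauss_poly.induct)
  case base
  then show ?case using has_derivative_gauss differentiableI by blast
next
  case (coord f b)
  then show ?case
    by (intro differentiable_mult smooth_differentiable[OF smooth_inner_left])
qed (auto intro!: differentiable_mult differentiable_add)

lemma gauss_poly_dir_deriv: "gauss_poly c f \<Longrightarrow> gauss_poly c (dir_deriv b f)"
proof (induction rule: gauss_poly.induct)
  case base
  have "dir_deriv b (gauss c) = (\<lambda>x. - (2 * of_real pi * c) * (of_real (x \<bullet> b) * gauss c x))"
    using dir_deriv_eqI[OF has_derivative_gauss] by (auto simp: fun_eq_iff)
  then show ?case by (simp only:) (intro gauss_poly.intros)
next
  case (coord f v)
  have "dir_deriv b (\<lambda>x. of_real (x \<bullet> v) * f x) = (\<lambda>x. of_real (x \<bullet> v) * dir_deriv b f x + of_real (b \<bullet> v) * f x)"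
  proof
    fix x
    have "dir_deriv b (\<lambda>x. complex_of_real (x \<bullet> v)) x = of_real (b \<bullet> v)"
      by (rule dir_deriv_eqI) (auto intro!: derivative_eq_intros)
    moreover have "(\<lambda>x. complex_of_real (x \<bullet> v)) differentiable (at x)"
      by (rule smooth_differentiable[OF smooth_inner_left])
    ultimately show "dir_deriv b (\<lambda>x. of_real (x \<bullet> v) * f x) x = of_real (x \<bullet> v) * dir_deriv b f x + of_real (b \<bullet> v) * f x"
      using coord by (subst dir_deriv_mult) (auto intro: gauss_poly_differentiable)
  qed
  then show ?case using coord by (auto intro!: gauss_poly.intros)
next
  case (cmult f k)
  then have "dir_deriv b (\<lambda>x. k * f x) = (\<lambda>x. k * dir_deriv b f x)"
    by (auto simp: fun_eq_iff dir_deriv_mult dir_deriv_const gauss_poly_differentiable)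
  then show ?case using cmult by (auto intro!: gauss_poly.intros)
next
  case (sum f g)
  then have "dir_deriv b (\<lambda>x. f x + g x) = (\<lambda>x. dir_deriv b f x + dir_deriv b g x)"
    by (auto simp: fun_eq_iff intro!: dir_deriv_add gauss_poly_differentiable)
  then show ?case using sum by (auto intro!: gauss_poly.intros)
qed

lemma bounded_above_of_tendsto_0:
  fixes f :: "real \<Rightarrow> real"
  assumes cont: "continuous_on {0..} f" and lim: "(f \<longlongrightarrow> 0) at_top"
  shows "\<exists>B\<ge>0. \<forall>t\<ge>0. f t \<le> B"
proof -
  have "\<forall>\<^sub>F t in at_top. f t < 1"
    using lim by (rule order_tendstoD) simp
  then obtain T where T: "\<And>t. t \<ge> T \<Longrightarrow> f t < 1"
    unfolding eventually_at_top_linorder by blast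
  have "compact (f ` {0..T})"
    by (intro compact_continuous_image continuous_on_subset[OF cont]) auto
  then obtain B where B: "\<And>t. t \<in> {0..T} \<Longrightarrow> norm (f t) \<le> B"
    using compact_imp_bounded bounded_iff by (metis (no_types, lifting) image_eqI)
  have "f t \<le> max 1 B" if "t \<ge> 0" for t
    using T[of t] B[of t] that by (cases "t \<ge> T") auto
  then show ?thesis by (intro exI[of _ "max 1 B"]) auto
qed

lemma gauss_poly_rapid:
  assumes "0 < Re c" shows "gauss_poly c f \<Longrightarrow> rapid f"
proof (induction rule: gauss_poly.induct)
  case base
  have "\<exists>B\<ge>0. \<forall>t\<ge>0. (1 + t) ^ k * exp (- (pi * Re c * t\<^sup>2)) \<le> B" for k
  proof (rule bounded_above_of_tendsto_0)
    have "((\<lambda>t::real. (1 + t) ^ k * exp (- (d * t\<^sup>2))) \<longlongrightarrow> 0) at_top" if "0 < d" for d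
      using that by real_asymp
    from this[of "pi * Re c"] assms
    show "((\<lambda>t::real. (1 + t) ^ k * exp (- (pi * Re c * t\<^sup>2))) \<longlongrightarrow> 0) at_top"
      by simp
  qed (intro continuous_intros)
  then show ?case unfolding rapid_def norm_gauss by (metis norm_ge_zero)
next
  case (coord f b)
  have "norm (complex_of_real (x \<bullet> b)) \<le> norm b * (1 + norm x) ^ 1" for x
    using Cauchy_Schwarz_ineq2[of x b] by (simp add: algebra_simps add_increasing)
  then show ?case by (rule rapid_mult_bounded_poly[OF coord(2)])
next
  case (cmult f k)
  then show ?case using rapid_mult_bounded_poly[where h="\<lambda>_. k" and A="norm k" and l=0] by auto
qed (rule rapid_add)

lemma gauss_poly_schwartz: "0 < Re c \<Longrightarrow> gauss_poly c f \<Longrightarrow> schwartz f"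
  by (rule schwartz_coinduct[where X="gauss_poly c"])
     (auto intro: gauss_poly_differentiable gauss_poly_dir_deriv gauss_poly_rapid)

section \<open>Integration of Schwartz functions\<close>
lemma has_vector_derivative_iff_quotient:
  "(F has_vector_derivative D) (at t0) \<longleftrightarrow> ((\<lambda>t. (F t - F t0) /\<^sub>R (t - t0)) \<longlongrightarrow> D) (at t0)"
proof -
  have eq: "norm (F t - F t0 - (t - t0) *\<^sub>R D) / norm (t - t0) = norm ((F t - F t0) /\<^sub>R (t - t0) - D)"
    if "t \<noteq> t0" for t
  proof -
    have "(F t - F t0) /\<^sub>R (t - t0) - D = (F t - F t0 - (t - t0) *\<^sub>R D) /\<^sub>R (t - t0)"
      using that by (simp add: scaleR_diff_right)
    then show ?thesis by (simp add: divide_inverse mult.commute)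
  qed
  have "((\<lambda>t. norm (F t - F t0 - (t - t0) *\<^sub>R D) / norm (t - t0)) \<longlongrightarrow> 0) (at t0)
      \<longleftrightarrow> ((\<lambda>t. norm ((F t - F t0) /\<^sub>R (t - t0) - D)) \<longlongrightarrow> 0) (at t0)"
    using eq by (intro filterlim_cong) (auto simp: eventually_at_filter simp del: real_norm_def intro!: always_eventually)
  then show ?thesis
    unfolding has_vector_derivative_def has_derivative_iff_norm
    by (simp add: bounded_linear_scaleR_left tendsto_norm_zero_iff LIM_zero_iff)
qed

text \<open>The mean value theorem turns a bound on the derivative into the same bound on difference
  quotients, to which dominated convergence applies.\<close>
lemma integral_has_vector_derivative_dominated:
  fixes f f' :: "real \<Rightarrow> 'x \<Rightarrow> complex"
  assumes e: "0 < e"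
    and int: "\<And>t. \<bar>t - t0\<bar> < e \<Longrightarrow> integrable M (f t)"
    and der: "\<And>t x. \<bar>t - t0\<bar> < e \<Longrightarrow> x \<in> space M \<Longrightarrow> ((\<lambda>t. f t x) has_vector_derivative f' t x) (at t)"
    and bd: "\<And>t x. \<bar>t - t0\<bar> < e \<Longrightarrow> x \<in> space M \<Longrightarrow> norm (f' t x) \<le> g x"
    and g: "integrable M g" and meas: "f' t0 \<in> borel_measurable M"
  shows "((\<lambda>t. \<integral>x. f t x \<partial>M) has_vector_derivative (\<integral>x. f' t0 x \<partial>M)) (at t0)"
proof -
  let ?q = "\<lambda>t x. (f t x - f t0 x) /\<^sub>R (t - t0)"
  have bound: "norm (?q t x) \<le> g x" if "\<bar>t - t0\<bar> < e" "t \<noteq> t0" "x \<in> space M" for t x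
  proof -
    have "norm (f t x - f t0 x) \<le> g x * norm (t - t0)"
    proof (rule differentiable_bound[where S="ball t0 e" and f'="\<lambda>t h. h *\<^sub>R f' t x"])
      fix s assume "s \<in> ball t0 e"
      then have s: "\<bar>s - t0\<bar> < e" by (simp add: dist_real_def abs_minus_commute)
      show "((\<lambda>t. f t x) has_derivative (\<lambda>h. h *\<^sub>R f' s x)) (at s within ball t0 e)"
        using der[OF s that(3)] unfolding has_vector_derivative_def by (rule has_derivative_at_withinI)
      show "onorm (\<lambda>h. h *\<^sub>R f' s x) \<le> g x"
        using bd[OF s that(3)] by (intro onorm_le) (simp add: mult.commute mult_left_mono)
    qed (use e that in \<open>auto simp: dist_real_def abs_minus_commute\<close>)
    moreover have "0 < \<bar>t - t0\<bar>" using that by simp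
    ultimately show ?thesis by (simp add: pos_divide_le_eq divide_inverse_commute[symmetric])
  qed
  have lim: "((\<lambda>t. ?q t x) \<longlongrightarrow> f' t0 x) (at t0)" if "x \<in> space M" for x
    using der[of t0 x] e that unfolding has_vector_derivative_iff_quotient by simp
  have "((\<lambda>t. ((\<integral>x. f t x \<partial>M) - (\<integral>x. f t0 x \<partial>M)) /\<^sub>R (t - t0)) \<longlongrightarrow> (\<integral>x. f' t0 x \<partial>M)) (at t0)"
    unfolding tendsto_at_iff_sequentially comp_def
  proof (intro allI impI)
    fix X :: "nat \<Rightarrow> real"
    assume X: "\<forall>i. X i \<in> UNIV - {t0}" "X \<longlonglongrightarrow> t0"
    have "\<forall>\<^sub>F i in sequentially. \<bar>X i - t0\<bar> < e"
      using X(2) e by (auto simp: tendsto_iff dist_real_def)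
    then obtain m where m: "\<And>i. i \<ge> m \<Longrightarrow> \<bar>X i - t0\<bar> < e"
      unfolding eventually_sequentially by blast
    have eq: "((\<integral>x. f (X (i + m)) x \<partial>M) - (\<integral>x. f t0 x \<partial>M)) /\<^sub>R (X (i + m) - t0) = (\<integral>x. ?q (X (i + m)) x \<partial>M)" for i
      using int[OF m[of "i+m"]] int[of t0] e by simp
    have "(\<lambda>i. \<integral>x. ?q (X (i + m)) x \<partial>M) \<longlonglongrightarrow> (\<integral>x. f' t0 x \<partial>M)"
    proof (rule integral_dominated_convergence[OF meas _ g])
      show "(\<lambda>x. ?q (X (i + m)) x) \<in> borel_measurable M" for i
        using int[OF m[of "i+m"]] int[of t0] e by (auto intro!: borel_measurable_scaleR borel_measurable_diff borel_measurable_integrable)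
      show "AE x in M. (\<lambda>i. ?q (X (i + m)) x) \<longlonglongrightarrow> f' t0 x"
      proof (rule AE_I2)
        fix x assume "x \<in> space M"
        from lim[OF this] X have "(\<lambda>i. ?q (X i) x) \<longlonglongrightarrow> f' t0 x"
          unfolding tendsto_at_iff_sequentially comp_def by blast
        then show "(\<lambda>i. ?q (X (i + m)) x) \<longlonglongrightarrow> f' t0 x"
          by (rule LIMSEQ_ignore_initial_segment)
      qed
      show "AE x in M. norm (?q (X (i + m)) x) \<le> g x" for i
        using bound m[of "i+m"] X(1) by (intro AE_I2) auto
    qed
    then have "(\<lambda>i. ((\<integral>x. f (X (i + m)) x \<partial>M) - (\<integral>x. f t0 x \<partial>M)) /\<^sub>R (X (i + m) - t0)) \<longlonglongrightarrow> (\<integral>x. f' t0 x \<partial>M)"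
      unfolding eq .
    then show "(\<lambda>i. ((\<integral>x. f (X i) x \<partial>M) - (\<integral>x. f t0 x \<partial>M)) /\<^sub>R (X i - t0)) \<longlonglongrightarrow> (\<integral>x. f' t0 x \<partial>M)"
      by (rule LIMSEQ_offset)
  qed
  then show ?thesis unfolding has_vector_derivative_iff_quotient .
qed

lemma integrable_inverse_one_plus_square: "integrable lborel (\<lambda>x::real. inverse (1 + x\<^sup>2))"
proof -
  have "einterval (-\<infinity>) \<infinity> = UNIV" by (auto simp: einterval_def)
  then show ?thesis
    using integrable_inverse_1_plus_square by (simp add: set_integrable_def)
qed

text \<open>Since \<open>\<Prod>\<^sub>b (1 + x\<^sub>b\<^sup>2) \<le> (1 + |x|)\<^bsup>2d\<^esup>\<close>, this reduces to a product of one-dimensional integrals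
  of \<open>1/(1 + t\<^sup>2)\<close>.\<close>
lemma integrable_inverse_one_plus_norm:
  "integrable lborel (\<lambda>x::'a::euclidean_space. inverse ((1 + norm x) ^ (2 * DIM('a))))"
proof (rule integrableI_bounded)
  show "(\<lambda>x::'a. inverse ((1 + norm x) ^ (2 * DIM('a)))) \<in> borel_measurable lborel" by simp
  have fin1: "(\<integral>\<^sup>+t. ennreal (inverse (1 + t\<^sup>2)) \<partial>(lborel::real measure)) < \<infinity>"
    using integrable_inverse_one_plus_square unfolding integrable_iff_bounded by (auto simp: abs_of_nonneg)
  have "(\<Prod>b\<in>Basis. 1 + (x \<bullet> b)\<^sup>2) \<le> (1 + norm x) ^ (2 * DIM('a))" for x :: 'a
  proof -
    have "(\<Prod>b\<in>Basis. 1 + (x \<bullet> b)\<^sup>2) \<le> (\<Prod>b\<in>(Basis::'a set). (1 + norm x)\<^sup>2)"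
    proof (intro prod_mono conjI)
      fix b :: 'a assume "b \<in> Basis"
      then have "(x \<bullet> b)\<^sup>2 \<le> (norm x)\<^sup>2" by (intro abs_le_square_iff[THEN iffD1]) (simp add: Basis_le_norm)
      then show "1 + (x \<bullet> b)\<^sup>2 \<le> (1 + norm x)\<^sup>2" by (simp add: power2_sum add_increasing2)
    qed auto
    then show ?thesis by (simp add: power_mult)
  qed
  then have "inverse ((1 + norm x) ^ (2 * DIM('a))) \<le> (\<Prod>b\<in>Basis. inverse (1 + (x \<bullet> b)\<^sup>2))" for x :: 'a
    unfolding prod_inversef[unfolded comp_def]
    by (intro le_imp_inverse_le) (auto intro!: prod_pos simp: add_pos_nonneg)
  then have "(\<integral>\<^sup>+x. ennreal (norm (inverse ((1 + norm x) ^ (2 * DIM('a))))) \<partial>(lborel::'a measure))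
    \<le> (\<integral>\<^sup>+x. (\<Prod>b\<in>Basis. ennreal (inverse (1 + (x \<bullet> b)\<^sup>2))) \<partial>(lborel::'a measure))"
    by (intro nn_integral_mono) (simp add: prod_ennreal ennreal_leI abs_of_nonneg add_nonneg_nonneg)
  also have "\<dots> = (\<Prod>b\<in>(Basis::'a set). (\<integral>\<^sup>+t. ennreal (inverse (1 + t\<^sup>2)) \<partial>lborel))"
    by (rule nn_integral_lborel_prod) auto
  also have "\<dots> < \<infinity>" using fin1 by (simp add: power_less_top_ennreal)
  finally show "(\<integral>\<^sup>+x. ennreal (norm (inverse ((1 + norm x) ^ (2 * DIM('a))))) \<partial>(lborel::'a measure)) < \<infinity>" .
qed

lemma rapid_le:
  assumes "rapid f" shows "\<exists>C\<ge>0. \<forall>x. norm (f x) \<le> C * inverse ((1 + norm x) ^ k)"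
proof -
  obtain C where C: "\<And>x. (1 + norm x) ^ k * norm (f x) \<le> C"
    using rapidD[OF assms] by blast
  have pos: "0 < (1 + norm x) ^ k" for x :: 'a
    by (intro zero_less_power) (simp add: add_pos_nonneg)
  have "0 \<le> C" using C[of 0] by (meson norm_ge_zero order_trans mult_nonneg_nonneg pos less_imp_le)
  moreover have "norm (f x) \<le> C * inverse ((1 + norm x) ^ k)" for x
    using C[of x] pos[of x] by (simp add: divide_inverse[symmetric] pos_le_divide_eq mult.commute)
  ultimately show ?thesis by blast
qed

lemma rapid_integrable:
  fixes f :: "'a::euclidean_space \<Rightarrow> complex"
  assumes "rapid f" "f \<in> borel_measurable borel"
  shows "integrable lborel f"
proof -
  obtain C where "\<And>x. norm (f x) \<le> C * inverse ((1 + norm x) ^ (2 * DIM('a)))"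
    using rapid_le[OF assms(1)] by blast
  then show ?thesis
    by (intro Bochner_Integration.integrable_bound[OF integrable_mult_right[OF integrable_inverse_one_plus_norm, of C]])
       (use assms(2) in \<open>auto intro: order_trans[OF _ abs_ge_self]\<close>)
qed

lemma smooth_continuous_on: "smooth f \<Longrightarrow> continuous_on S f"
  by (meson smooth_differentiable differentiable_imp_continuous_within continuous_at_imp_continuous_on)

lemma schwartz_measurable: "schwartz f \<Longrightarrow> f \<in> borel_measurable borel"
  by (intro borel_measurable_continuous_onI smooth_continuous_on schwartz_smooth)

lemma schwartz_integrable: "schwartz f \<Longrightarrow> integrable lborel f"
  by (intro rapid_integrable schwartz_measurable schwartz_rapid)

lemma borel_measurable_cis [measurable (raw)]:
  "f \<in> borel_measurable M \<Longrightarrow> (\<lambda>x. cis (f x)) \<in> borel_measurable M"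
  by (rule borel_measurable_continuous_on[where f=cis]) (auto intro: continuous_intros)

lemma fourier_lborel:
  assumes "f \<in> borel_measurable borel"
  shows "fourier f \<xi> = (LINT x|lborel. f x * cis (- 2 * pi * (x \<bullet> \<xi>)))"
  unfolding fourier_def
  by (intro integral_completion borel_measurable_times borel_measurable_cis) (use assms in simp_all)

lemma integrable_mult_cis:
  fixes f :: "'a::euclidean_space \<Rightarrow> complex"
  assumes "integrable lborel f" 
  shows "integrable lborel (\<lambda>x. f x * cis (a * (x \<bullet> \<xi>)))"
  by (rule Bochner_Integration.integrable_bound[OF assms])
     (use assms in \<open>auto simp: norm_mult intro!: borel_measurable_times borel_measurable_integrable\<close>)

lemma integral_translate:
  fixes f :: "'a::euclidean_space \<Rightarrow> complex"
  assumes "f \<in> borel_measurable borel"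
  shows "(LINT x|lborel. f (c + x)) = (LINT x|lborel. f x)"
proof -
  have "(LINT x|lborel. f x) = (LINT x|distr lborel borel ((+) c). f x)"
    by (simp only: lborel_distr_plus)
  also have "\<dots> = (LINT x|lborel. f (c + x))"
    using assms by (subst integral_distr) auto
  finally show ?thesis ..
qed

lemma fourier_translate:
  fixes f :: "'a::euclidean_space \<Rightarrow> complex"
  assumes "f \<in> borel_measurable borel"
  shows "fourier (\<lambda>x. f (c + x)) \<xi> = cis (2 * pi * (c \<bullet> \<xi>)) * fourier f \<xi>"
proof -
  have [measurable]: "f \<in> borel_measurable borel" by fact
  have "fourier (\<lambda>x. f (c + x)) \<xi> = (LINT x|lborel. cis (2 * pi * (c \<bullet> \<xi>)) * (f (c + x) * cis (- 2 * pi * ((c + x) \<bullet> \<xi>))))"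
    by (subst fourier_lborel, measurable)
       (intro Bochner_Integration.integral_cong refl,
        simp add: mult.left_commute[of "cis _" "f _"] cis_mult inner_add_left distrib_left)
  also have "\<dots> = cis (2 * pi * (c \<bullet> \<xi>)) * (LINT x|lborel. f (c + x) * cis (- 2 * pi * ((c + x) \<bullet> \<xi>)))"
    by simp
  also have "(LINT x|lborel. f (c + x) * cis (- 2 * pi * ((c + x) \<bullet> \<xi>))) = (LINT x|lborel. f x * cis (- 2 * pi * (x \<bullet> \<xi>)))"
    using assms by (intro integral_translate) measurable
  finally show ?thesis using assms by (simp add: fourier_lborel)
qed

lemma has_vector_derivative_cis_linear:
  "((\<lambda>t. cis (k * t)) has_vector_derivative (\<i> * of_real k * cis (k * t))) (at t)"
  unfolding has_vector_derivative_def
  by (rule has_derivative_eq_rhs, rule has_derivative_cis, (rule derivative_intros)+)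
     (auto simp: scaleR_conv_of_real)

text \<open>
  Instead of integrating by parts, differentiate at \<open>t = 0\<close> the identity which says how a
  translation by \<open>t b\<close> acts on the Fourier transform.
\<close>
lemma fourier_dir_deriv:
  fixes f :: "'a::euclidean_space \<Rightarrow> complex"
  assumes f: "schwartz f" and b: "b \<in> Basis"
  shows "fourier (dir_deriv b f) \<xi> = 2 * of_real pi * \<i> * of_real (\<xi> \<bullet> b) * fourier f \<xi>"
proof -
  let ?D = "2 * DIM('a)"
  have [measurable]: "f \<in> borel_measurable borel" "dir_deriv b f \<in> borel_measurable borel"
    using schwartz_measurable f schwartz_dir_deriv[OF f b] by auto
  obtain C where C: "C \<ge> 0" "\<And>x. norm (dir_deriv b f x) \<le> C * inverse ((1 + norm x) ^ ?D)"
    using rapid_le[OF schwartz_rapid[OF schwartz_dir_deriv[OF f b]]] by blast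
  let ?G = "\<lambda>t x. f (t *\<^sub>R b + x) * cis (- 2 * pi * (x \<bullet> \<xi>))"
  have "((\<lambda>t. LINT x|lborel. ?G t x) has_vector_derivative
     (LINT x|lborel. dir_deriv b f (0 *\<^sub>R b + x) * cis (- 2 * pi * (x \<bullet> \<xi>)))) (at 0)"
  proof (rule integral_has_vector_derivative_dominated[where e=1 and f = ?G
        and f' = "\<lambda>t x. dir_deriv b f (t *\<^sub>R b + x) * cis (- 2 * pi * (x \<bullet> \<xi>))"
        and g="\<lambda>x. (C * 2 ^ ?D) * inverse ((1 + norm x) ^ ?D)"])
    show "integrable lborel (?G t)" for t
    proof (rule integrable_mult_cis)
      have "integrable (distr lborel borel ((+) (t *\<^sub>R b))) f"
        using schwartz_integrable[OF f] by (simp only: lborel_distr_plus)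
      then show "integrable lborel (\<lambda>x. f (t *\<^sub>R b + x))"
        by (subst (asm) integrable_distr_eq) auto
    qed
    fix t :: real and x :: 'a
    have "((\<lambda>t. f (t *\<^sub>R b + x)) has_vector_derivative dir_deriv b f (t *\<^sub>R b + x)) (at t)"
    proof -
      have fl: "linear (\<lambda>v. dir_deriv v f (t *\<^sub>R b + x))"
        by (rule has_derivative_linear[OF has_derivative_dir_deriv[OF smooth_differentiable[OF schwartz_smooth[OF f]]]])
      have "((\<lambda>t. f (t *\<^sub>R b + x)) has_derivative (\<lambda>h. dir_deriv (h *\<^sub>R b) f (t *\<^sub>R b + x))) (at t)"
        by (rule has_derivative_compose[of "\<lambda>t. t *\<^sub>R b + x" "\<lambda>h. h *\<^sub>R b"])
           (auto intro!: derivative_eq_intros has_derivative_dir_deriv smooth_differentiable schwartz_smooth[OF f])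
      then show ?thesis
        unfolding has_vector_derivative_def using linear_scale[OF fl] by simp
    qed
    then show "((\<lambda>t. ?G t x) has_vector_derivative dir_deriv b f (t *\<^sub>R b + x) * cis (- 2 * pi * (x \<bullet> \<xi>))) (at t)"
      by (rule has_vector_derivative_mult_left)
    assume t: "\<bar>t - 0\<bar> < 1"
    have "1 + norm x \<le> 2 * (1 + norm (t *\<^sub>R b + x))"
      using norm_triangle_ineq4[of "t *\<^sub>R b + x" "t *\<^sub>R b"] t b norm_ge_zero[of "t *\<^sub>R b + x"]
      by (simp del: norm_ge_zero)
    then have "(1 + norm x) ^ ?D \<le> 2 ^ ?D * (1 + norm (t *\<^sub>R b + x)) ^ ?D"
      unfolding power_mult_distrib[symmetric] by (intro power_mono) auto
    moreover have "0 < (1 + norm x) ^ ?D" "0 < (1 + norm (t *\<^sub>R b + x)) ^ ?D"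
      by (auto intro!: zero_less_power add_pos_nonneg)
    ultimately have "inverse ((1 + norm (t *\<^sub>R b + x)) ^ ?D) \<le> 2 ^ ?D * inverse ((1 + norm x) ^ ?D)"
      by (simp add: divide_simps mult.commute)
    then show "norm (dir_deriv b f (t *\<^sub>R b + x) * cis (- 2 * pi * (x \<bullet> \<xi>))) \<le> (C * 2 ^ ?D) * inverse ((1 + norm x) ^ ?D)"
      using C(2)[of "t *\<^sub>R b + x"] C(1) 
      by (simp add: norm_mult mult.assoc) (meson mult_left_mono order_trans)
  next
    show "integrable lborel (\<lambda>x::'a. C * 2 ^ ?D * inverse ((1 + norm x) ^ ?D))"
      by (intro integrable_mult_right integrable_inverse_one_plus_norm)
  qed (simp_all)
  moreover have "(LINT x|lborel. ?G t x) = cis (2 * pi * (b \<bullet> \<xi>) * t) * fourier f \<xi>" for t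
    using fourier_translate[of f "t *\<^sub>R b" \<xi>] by (simp add: fourier_lborel mult_ac)
  moreover have "((\<lambda>t. cis (2 * pi * (b \<bullet> \<xi>) * t) * fourier f \<xi>) has_vector_derivative
      \<i> * of_real (2 * pi * (b \<bullet> \<xi>)) * cis (2 * pi * (b \<bullet> \<xi>) * 0) * fourier f \<xi>) (at 0)"
    by (rule has_vector_derivative_mult_left[OF has_vector_derivative_cis_linear])
  ultimately have "(LINT x|lborel. dir_deriv b f x * cis (- 2 * pi * (x \<bullet> \<xi>))) = \<i> * of_real (2 * pi * (b \<bullet> \<xi>)) * cis (2 * pi * (b \<bullet> \<xi>) * 0) * fourier f \<xi>"
    by (simp add: vector_derivative_unique_at)
  then show ?thesis by (simp add: fourier_lborel inner_commute mult_ac)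
qed

section \<open>The Fourier transform of complex Gaussians\<close>
lemma nn_integral_gauss_real:
  "(\<integral>\<^sup>+x. ennreal (exp (- (pi * (norm x)\<^sup>2))) \<partial>(lborel :: 'a::euclidean_space measure)) = 1"
proof -
  have "normal_density 0 (1 / sqrt (2 * pi)) t = exp (- (pi * t\<^sup>2))" for t
    by (simp add: normal_density_def power_divide field_simps)
  then have one: "(\<integral>\<^sup>+t. ennreal (exp (- (pi * t\<^sup>2))) \<partial>(lborel :: real measure)) = 1"
    using nn_integral_eq_integral[OF integrable_normal_density[of "1 / sqrt (2 * pi)" 0]]
      integral_normal_density[of "1 / sqrt (2 * pi)" 0] by simp
  have "exp (- (pi * (norm x)\<^sup>2)) = (\<Prod>b\<in>Basis. exp (- (pi * (x \<bullet> b)\<^sup>2)))" for x :: 'a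
    unfolding power2_norm_eq_inner euclidean_inner[of x x]
    by (simp add: exp_sum[symmetric] sum_negf sum_distrib_left power2_eq_square)
  then have "(\<integral>\<^sup>+x. ennreal (exp (- (pi * (norm x)\<^sup>2))) \<partial>(lborel :: 'a measure))
     = (\<integral>\<^sup>+x. (\<Prod>b\<in>Basis. ennreal (exp (- (pi * (x \<bullet> b)\<^sup>2)))) \<partial>(lborel :: 'a measure))"
    by (simp add: prod_ennreal)
  also have "\<dots> = (\<Prod>b\<in>(Basis::'a set). (\<integral>\<^sup>+t. ennreal (exp (- (pi * t\<^sup>2))) \<partial>(lborel :: real measure)))"
    by (rule nn_integral_lborel_prod) auto
  finally show ?thesis by (simp add: one)
qed

lemma integral_gauss_1: "(LINT x|lborel. gauss 1 (x::'a::euclidean_space)) = 1"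
proof -
  have "(LINT x|lborel. exp (- (pi * (norm (x::'a))\<^sup>2))) = 1"
    by (subst integral_eq_nn_integral) (auto simp: nn_integral_gauss_real)
  then have "(LINT x|lborel. complex_of_real (exp (- (pi * (norm (x::'a))\<^sup>2)))) = of_real 1"
    by (simp only: integral_complex_of_real)
  then show ?thesis by (simp add: gauss_def exp_of_real[symmetric])
qed

lemma schwartz_gauss: "0 < Re c \<Longrightarrow> schwartz (gauss c)"
  by (rule gauss_poly_schwartz[OF _ gauss_poly.base])

lemma schwartz_coord_gauss: "0 < Re c \<Longrightarrow> schwartz (\<lambda>x. of_real (x \<bullet> b) * gauss c x)"
  by (rule gauss_poly_schwartz[OF _ gauss_poly.coord[OF gauss_poly.base]])

lemma gauss_measurable [measurable]: "gauss c \<in> borel_measurable borel"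
  unfolding gauss_def[abs_def] by measurable

lemma dir_deriv_gauss: "dir_deriv b (gauss c) x = - (2 * of_real pi * c) * (of_real (x \<bullet> b) * gauss c x)"
  by (rule dir_deriv_eqI[OF has_derivative_gauss])

lemma fourier_cmult:
  assumes "f \<in> borel_measurable borel"
  shows "fourier (\<lambda>x. k * f x) \<xi> = k * fourier f \<xi>"
  using assms by (simp add: fourier_lborel mult.assoc)

lemma fourier_add:
  assumes "integrable lborel f" "integrable lborel g"
  shows "fourier (\<lambda>x. f x + g x) \<xi> = fourier f \<xi> + fourier g \<xi>"
proof -
  have [measurable]: "f \<in> borel_measurable borel" "g \<in> borel_measurable borel"
    using assms[THEN borel_measurable_integrable] by simp_all
  show ?thesis
    using integrable_mult_cis[OF assms(1), of "- 2 * pi" \<xi>] integrable_mult_cis[OF assms(2), of "- 2 * pi" \<xi>]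
    by (simp add: fourier_lborel distrib_right)
qed

text \<open>The derivative of a Gaussian is again a linear form times that Gaussian, so the rule for the
  Fourier transform of a derivative computes this moment.\<close>
lemma fourier_coord_gauss:
  assumes c: "0 < Re c" and b: "b \<in> Basis"
  shows "fourier (\<lambda>x. of_real (x \<bullet> b) * gauss c x) \<eta>
       = - (\<i> / c) * of_real (\<eta> \<bullet> b) * fourier (gauss c) \<eta>"
proof -
  have c0: "c \<noteq> 0" using c by auto
  have "fourier (dir_deriv b (gauss c)) \<eta> = - (2 * of_real pi * c) * fourier (\<lambda>x. of_real (x \<bullet> b) * gauss c x) \<eta>"
    unfolding dir_deriv_gauss[abs_def] by (subst fourier_cmult) auto
  then have "- (2 * of_real pi * c) * fourier (\<lambda>x. of_real (x \<bullet> b) * gauss c x) \<eta>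
      = 2 * of_real pi * \<i> * of_real (\<eta> \<bullet> b) * fourier (gauss c) \<eta>"
    unfolding fourier_dir_deriv[OF schwartz_gauss[OF c] b] by (rule sym)
  moreover have k: "- (2 * of_real pi * c) \<noteq> 0" using c0 by simp
  ultimately have "fourier (\<lambda>x. of_real (x \<bullet> b) * gauss c x) \<eta>
      = 2 * of_real pi * \<i> * of_real (\<eta> \<bullet> b) * fourier (gauss c) \<eta> / - (2 * of_real pi * c)"
    unfolding nonzero_eq_divide_eq[OF k] by (subst mult.commute)
  then show ?thesis using c0 by (simp add: mult_ac)
qed

lemma vector_derivative_0_imp_eq:
  fixes f :: "real \<Rightarrow> complex"
  assumes "\<And>t. t \<in> {0..1} \<Longrightarrow> (f has_vector_derivative 0) (at t)"
  shows "f 1 = f 0"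
proof -
  have "\<exists>c. \<forall>x\<in>{0..1}. f x = c"
    by (rule has_derivative_zero_constant)
       (use assms in \<open>auto simp: has_vector_derivative_def intro: has_derivative_at_withinI\<close>)
  then show ?thesis by auto
qed

lemma integrable_norm_gauss:
  assumes c: "0 < Re c"
  shows "integrable lborel (\<lambda>x::'a::euclidean_space. norm x ^ k * exp (- (pi * Re c * (norm x)\<^sup>2)))"
proof -
  have "rapid (\<lambda>x::'a. of_real (norm x ^ k) * gauss c x)"
    by (rule rapid_mult_bounded_poly[OF schwartz_rapid[OF schwartz_gauss[OF c]], where A=1 and l=k])
       (auto simp: norm_power intro: power_mono)
  then have "integrable lborel (\<lambda>x::'a. norm (of_real (norm x ^ k) * gauss c x))"
    by (intro integrable_norm rapid_integrable) auto
  then show ?thesis by (simp add: norm_mult norm_gauss norm_power)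
qed

text \<open>
  Along the ray \<open>t \<xi>\<close> the transform \<open>H\<close> solves \<open>H' = -2tK H\<close> with \<open>K = \<pi>|\<xi>|\<^sup>2/c\<close>, by the moment formula
  \<open>fourier_coord_gauss\<close>. So \<open>H exp(t\<^sup>2 K)\<close> is constant. This argument works for complex \<open>c\<close> and needs no
  shift of contour; the value at the origin stays as a factor and is treated separately.
\<close>
lemma fourier_gauss:
  fixes \<xi> :: "'a::euclidean_space"
  assumes c: "0 < Re c"
  shows "fourier (gauss c) \<xi> = fourier (gauss c) (0::'a) * gauss (1 / c) \<xi>"
proof -
  have c0: "c \<noteq> 0" using c by auto
  define H where "H t = fourier (gauss c) (t *\<^sub>R \<xi>)" for t
  define K where "K = of_real pi * of_real ((norm \<xi>)\<^sup>2) / c"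
  have H: "(H has_vector_derivative (- 2 * of_real t * K * H t)) (at t)" for t
  proof -
    let ?f = "\<lambda>t x. gauss c x * cis (- 2 * pi * (x \<bullet> \<xi>) * t)"
    let ?f' = "\<lambda>t x. gauss c x * (\<i> * of_real (- 2 * pi * (x \<bullet> \<xi>)) * cis (- 2 * pi * (x \<bullet> \<xi>) * t))"
    have "((\<lambda>t. LINT x|lborel. ?f t x) has_vector_derivative (LINT x|lborel. ?f' t x)) (at t)"
    proof (rule integral_has_vector_derivative_dominated[where e=1
          and g="\<lambda>x. (2 * pi * norm \<xi>) * (norm x ^ 1 * exp (- (pi * Re c * (norm x)\<^sup>2)))"])
      show "integrable lborel (?f s)" for s
        using integrable_mult_cis[OF schwartz_integrable[OF schwartz_gauss[OF c]], of "- 2 * pi * s" \<xi>]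
        by (simp add: mult_ac)
      show "((\<lambda>t. ?f t x) has_vector_derivative ?f' s x) (at s)" for s x
        by (intro has_vector_derivative_mult_right has_vector_derivative_cis_linear)
      show "norm (?f' s x) \<le> (2 * pi * norm \<xi>) * (norm x ^ 1 * exp (- (pi * Re c * (norm x)\<^sup>2)))" for s x
        using Cauchy_Schwarz_ineq2[of x \<xi>]
        by (simp add: norm_mult norm_gauss abs_mult mult_ac)
      show "integrable lborel (\<lambda>x::'a. (2 * pi * norm \<xi>) * (norm x ^ 1 * exp (- (pi * Re c * (norm x)\<^sup>2))))"
        by (intro integrable_mult_right integrable_norm_gauss c)
    qed (auto intro!: borel_measurable_times borel_measurable_cis)
    moreover have "(\<lambda>t. LINT x|lborel. ?f t x) = H"
      unfolding H_def by (auto simp: fun_eq_iff fourier_lborel mult_ac)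
    moreover have "(LINT x|lborel. ?f' t x) = - 2 * of_real t * K * H t"
    proof -
      let ?g = "\<lambda>b x. of_real (x \<bullet> b) * gauss c x"
      let ?k = "\<lambda>b. \<i> * of_real (- 2 * pi * (\<xi> \<bullet> b))"
      have "?f' t x = (\<Sum>b\<in>Basis. ?k b * (?g b x * cis (- 2 * pi * (x \<bullet> (t *\<^sub>R \<xi>)))))" for x
      proof -
        have "complex_of_real (x \<bullet> \<xi>) = (\<Sum>b\<in>Basis. of_real (x \<bullet> b) * of_real (\<xi> \<bullet> b))"
          by (subst euclidean_inner) simp
        then show ?thesis
          by (simp add: sum_distrib_left sum_distrib_right sum_negf mult_ac)
      qed
      then have "(LINT x|lborel. ?f' t x) = (LINT x|lborel. (\<Sum>b\<in>Basis. ?k b * (?g b x * cis (- 2 * pi * (x \<bullet> (t *\<^sub>R \<xi>))))))"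
        by (simp only:)
      also have "\<dots> = (\<Sum>b\<in>Basis. ?k b * (LINT x|lborel. ?g b x * cis (- 2 * pi * (x \<bullet> (t *\<^sub>R \<xi>)))))"
        by (subst Bochner_Integration.integral_sum,
            intro integrable_mult_right integrable_mult_cis schwartz_integrable schwartz_coord_gauss c,
            intro sum.cong refl integral_mult_right_zero)
      also have "\<dots> = (\<Sum>b\<in>Basis. ?k b * (- (\<i> / c) * of_real ((t *\<^sub>R \<xi>) \<bullet> b) * H t))"
        unfolding H_def by (intro sum.cong refl, subst fourier_coord_gauss[OF c, symmetric], simp, subst fourier_lborel) auto
      also have "\<dots> = (\<Sum>b\<in>Basis. of_real ((\<xi> \<bullet> b) * (\<xi> \<bullet> b)) * (- 2 * of_real t * (of_real pi / c) * H t))"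
        by (intro sum.cong refl) (simp add: mult_ac)
      also have "\<dots> = of_real ((norm \<xi>)\<^sup>2) * (- 2 * of_real t * (of_real pi / c) * H t)"
        unfolding sum_distrib_right[symmetric] of_real_sum[symmetric] power2_norm_eq_inner euclidean_inner[of \<xi> \<xi>] ..
      finally show ?thesis by (simp add: K_def mult_ac)
    qed
    ultimately show ?thesis by simp
  qed
  have "H 1 * exp (of_real (1\<^sup>2) * K) = H 0 * exp (of_real (0\<^sup>2) * K)"
  proof (rule vector_derivative_0_imp_eq[where f="\<lambda>t. H t * exp (of_real (t\<^sup>2) * K)"])
    fix t :: real
    have "((\<lambda>t. exp (of_real (t\<^sup>2) * K)) has_vector_derivative (2 * of_real t * K * exp (of_real (t\<^sup>2) * K))) (at t)"
    proof -
      have "((\<lambda>z. exp (z\<^sup>2 * K)) has_field_derivative (2 * of_real t * K * exp ((of_real t)\<^sup>2 * K))) (at (of_real t))"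
        by (auto intro!: derivative_eq_intros)
      from has_vector_derivative_real_field[OF this] show ?thesis by simp
    qed
    from has_vector_derivative_mult[OF H this]
    show "((\<lambda>t. H t * exp (of_real (t\<^sup>2) * K)) has_vector_derivative 0) (at t)"
      by (simp add: algebra_simps)
  qed
  then have "H 1 * exp K = H 0" by simp
  then have "H 1 = H 0 * exp (- K)" by (simp add: exp_minus field_simps)
  then show ?thesis unfolding H_def K_def gauss_def by simp
qed

lemma gauss_second_moment:
  assumes c: "0 < Re c"
  shows "(LINT x|lborel. of_real ((norm x)\<^sup>2) * gauss c (x::'a::euclidean_space))
     = of_nat DIM('a) / (2 * of_real pi * c) * (LINT x|lborel. gauss c (x::'a))"
proof -
  have c0: "c \<noteq> 0" using c by auto
  have sq: "schwartz (\<lambda>x::'a. of_real (x \<bullet> b) * (of_real (x \<bullet> b) * gauss c x))" for b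
    by (rule gauss_poly_schwartz[OF c]) (intro gauss_poly.intros)
  have int: "integrable lborel (\<lambda>x::'a. of_real (x \<bullet> b) * (of_real (x \<bullet> b) * gauss c x))" for b
    by (rule schwartz_integrable[OF sq])
  have b: "(LINT x|lborel. of_real (x \<bullet> b) * (of_real (x \<bullet> b) * gauss c x))
      = 1 / (2 * of_real pi * c) * (LINT x|lborel. gauss c (x::'a))" if "b \<in> Basis" for b :: 'a
  proof -
    have "dir_deriv b (\<lambda>x. of_real (x \<bullet> b) * gauss c x) x
        = gauss c x + - (2 * of_real pi * c) * (of_real (x \<bullet> b) * (of_real (x \<bullet> b) * gauss c x))" for x
    proof -
      have "dir_deriv b (\<lambda>x. complex_of_real (x \<bullet> b)) x = of_real (b \<bullet> b)"
        by (rule dir_deriv_eqI) (auto intro!: derivative_eq_intros)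
      then show ?thesis
        using that by (subst dir_deriv_mult)
          (auto intro!: smooth_differentiable[OF smooth_inner_left] smooth_differentiable[OF schwartz_smooth[OF schwartz_gauss[OF c]]] simp: dir_deriv_gauss)
    qed
    then have "fourier (dir_deriv b (\<lambda>x. of_real (x \<bullet> b) * gauss c x)) 0
      = (LINT x|lborel. gauss c x + - (2 * of_real pi * c) * (of_real (x \<bullet> b) * (of_real (x \<bullet> b) * gauss c x)))"
      by (subst fourier_lborel) (auto intro!: schwartz_measurable schwartz_dir_deriv schwartz_coord_gauss c that)
    also have "\<dots> = (LINT x|lborel. gauss c (x::'a)) + - (2 * of_real pi * c) * (LINT x|lborel. of_real (x \<bullet> b) * (of_real (x \<bullet> b) * gauss c x))"
      by (subst Bochner_Integration.integral_add) (intro schwartz_integrable schwartz_gauss c, intro integrable_mult_right int, subst integral_mult_right_zero, rule refl)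
    finally have "(LINT x|lborel. gauss c (x::'a)) + - (2 * of_real pi * c) * (LINT x|lborel. of_real (x \<bullet> b) * (of_real (x \<bullet> b) * gauss c x)) = 0"
      using fourier_dir_deriv[OF schwartz_coord_gauss[OF c] that, of b 0] by simp
    then show ?thesis using c0 by (simp add: field_simps)
  qed
  have "(LINT x|lborel. of_real ((norm x)\<^sup>2) * gauss c (x::'a))
      = (LINT x|lborel. (\<Sum>b\<in>Basis. of_real (x \<bullet> b) * (of_real (x \<bullet> b) * gauss c (x::'a))))"
    by (intro Bochner_Integration.integral_cong refl)
       (subst power2_norm_eq_inner, subst euclidean_inner, simp add: sum_distrib_right mult.assoc)
  also have "\<dots> = (\<Sum>b\<in>(Basis::'a set). 1 / (2 * of_real pi * c) * (LINT x|lborel. gauss c (x::'a)))"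
    by (subst Bochner_Integration.integral_sum, rule int, intro sum.cong refl b)
  finally show ?thesis by simp
qed

text \<open>
  The integral \<open>J\<close> as a function of \<open>c\<close> satisfies \<open>J' = -(d/2c) J\<close> by the second moment, so \<open>J\<^sup>2 c\<^sup>d\<close> is
  constant on the segment from \<open>1\<close> to \<open>c\<close>, which stays in the right half plane. Squaring avoids the
  choice of a branch of the square root; only the modulus of \<open>J\<close> matters later.
\<close>
lemma gauss_integral_square:
  assumes c: "0 < Re c"
  shows "(LINT x|lborel. gauss c (x::'a::euclidean_space))\<^sup>2 * c ^ DIM('a) = 1"
proof -
  \<comment> \<open>The segment from \<open>1\<close> to \<open>c\<close>. Near each of its points the real part is bounded below, which gives
    one integrable majorant.\<close>
  define p where "p t = 1 + of_real t * (c - 1)" for t :: real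
  have Re_p: "Re (p t) = (1 - t) + t * Re c" for t by (simp add: p_def algebra_simps)
  have p_pos: "0 < Re (p t)" if "t \<in> {0..1}" for t
    using that c unfolding Re_p by (cases "t = 0") (auto intro!: add_nonneg_pos)
  have cont: "\<exists>e>0. \<forall>s. \<bar>s - t\<bar> < e \<longrightarrow> Re (p t) / 2 \<le> Re (p s)" if "t \<in> {0..1}" for t
  proof -
    have "isCont (\<lambda>s. Re (p s)) t" unfolding Re_p by (intro continuous_intros)
    from this[unfolded continuous_at_real_range, rule_format, of "Re (p t) / 2"] p_pos[OF that]
    obtain e where "e > 0" "\<And>s. \<bar>s - t\<bar> < e \<Longrightarrow> \<bar>Re (p s) - Re (p t)\<bar> < Re (p t) / 2" by auto
    then show ?thesis by (intro exI[of _ e]) (force simp: abs_if split: if_splits)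
  qed
  define J where "J t = (LINT x|lborel. gauss (p t) (x::'a))" for t
  have J: "(J has_vector_derivative (- (of_nat DIM('a) * (c - 1) / (2 * p t)) * J t)) (at t)"
    if t: "t \<in> {0..1}" for t
  proof -
    obtain e where e: "e > 0" "\<And>s. \<bar>s - t\<bar> < e \<Longrightarrow> Re (p t) / 2 \<le> Re (p s)"
      using cont[OF t] by blast
    let ?a = "Re (p t) / 2"
    have a: "0 < ?a" using p_pos[OF t] by simp
    let ?f' = "\<lambda>t x::'a. - (of_real pi * (c - 1)) * (of_real ((norm x)\<^sup>2) * gauss (p t) x)"
    have "((\<lambda>t. LINT x|lborel. gauss (p t) (x::'a)) has_vector_derivative (LINT x|lborel. ?f' t x)) (at t)"
    proof (rule integral_has_vector_derivative_dominated[where e=e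
          and g="\<lambda>x. (pi * norm (c - 1)) * (norm x ^ 2 * exp (- (pi * ?a * (norm x)\<^sup>2)))"])
      fix s x assume s: "\<bar>s - t\<bar> < e"
      show "integrable lborel (gauss (p s) :: 'a \<Rightarrow> complex)"
        using e(2)[OF s] a by (intro schwartz_integrable schwartz_gauss) auto
      have "((\<lambda>z. exp (- (of_real pi * (1 + z * (c - 1)) * of_real ((norm x)\<^sup>2)))) has_field_derivative
          ?f' s x) (at (of_real s))"
        by (auto intro!: derivative_eq_intros simp: gauss_def p_def)
      from has_vector_derivative_real_field[OF this]
      show "((\<lambda>t. gauss (p t) x) has_vector_derivative ?f' s x) (at s)"
        by (simp add: gauss_def p_def)
      show "norm (?f' s x) \<le> (pi * norm (c - 1)) * (norm x ^ 2 * exp (- (pi * ?a * (norm x)\<^sup>2)))"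
        using mult_right_mono[OF e(2)[OF s], of "pi * (norm x)\<^sup>2"]
        by (auto simp: norm_mult norm_gauss norm_power mult_ac intro!: mult_left_mono)
    next
      show "integrable lborel (\<lambda>x::'a. (pi * norm (c - 1)) * (norm x ^ 2 * exp (- (pi * ?a * (norm x)\<^sup>2))))"
        using integrable_norm_gauss[of "of_real ?a" 2] a by (intro integrable_mult_right) simp
    qed (use e in auto)
    moreover have "(LINT x|lborel. ?f' t x) = - (of_nat DIM('a) * (c - 1) / (2 * p t)) * J t"
    proof -
      have "p t \<noteq> 0" using p_pos[OF t] by auto
      moreover have "(LINT x|lborel. ?f' t x) = - (of_real pi * (c - 1)) * (LINT x|lborel. of_real ((norm x)\<^sup>2) * gauss (p t) (x::'a))"
        by (rule integral_mult_right_zero)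
      ultimately show ?thesis
        unfolding gauss_second_moment[OF p_pos[OF t], where 'a='a] J_def by simp
    qed
    ultimately show ?thesis unfolding J_def[abs_def] by simp
  qed
  have "(J 1)\<^sup>2 * p 1 ^ DIM('a) = (J 0)\<^sup>2 * p 0 ^ DIM('a)"
  proof (rule vector_derivative_0_imp_eq[where f="\<lambda>t. (J t)\<^sup>2 * p t ^ DIM('a)"])
    fix t :: real assume t: "t \<in> {0..1}"
    have p0: "p t \<noteq> 0" using p_pos[OF t] by auto
    have "((\<lambda>z. (1 + z * (c - 1)) ^ DIM('a)) has_field_derivative (of_nat DIM('a) * (c - 1) * p t ^ (DIM('a) - 1))) (at (of_real t))"
      by (auto intro!: derivative_eq_intros simp: p_def)
    from has_vector_derivative_real_field[OF this]
    have "((\<lambda>t. p t ^ DIM('a)) has_vector_derivative (of_nat DIM('a) * (c - 1) * p t ^ (DIM('a) - 1))) (at t)"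
      by (simp add: p_def)
    from has_vector_derivative_mult[OF has_vector_derivative_mult[OF J[OF t] J[OF t]] this]
    have "((\<lambda>t. J t * J t * p t ^ DIM('a)) has_vector_derivative
        (J t * J t * (of_nat DIM('a) * (c - 1) * p t ^ (DIM('a) - 1)) +
         (J t * (- (of_nat DIM('a) * (c - 1) / (2 * p t)) * J t) + - (of_nat DIM('a) * (c - 1) / (2 * p t)) * J t * J t) * p t ^ DIM('a))) (at t)" .
    moreover have "p t ^ DIM('a) = p t * p t ^ (DIM('a) - 1)"
      by (metis DIM_positive Suc_pred' power_Suc)
    ultimately show "((\<lambda>t. (J t)\<^sup>2 * p t ^ DIM('a)) has_vector_derivative 0) (at t)"
      using p0 by (simp add: power2_eq_square field_simps)
  qed
  then show ?thesis by (simp add: J_def p_def integral_gauss_1)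
qed

definition gauss_mass :: "'a::euclidean_space itself \<Rightarrow> complex \<Rightarrow> complex" where
  "gauss_mass _ c = (LINT x|lborel. gauss c (x::'a))"

lemma fourier_gauss_mass:
  fixes \<xi> :: "'a::euclidean_space"
  assumes c: "0 < Re c"
  shows "fourier (gauss c) \<xi> = gauss_mass TYPE('a) c * gauss (1 / c) \<xi>"
  by (subst fourier_gauss[OF c]) (simp add: gauss_mass_def fourier_lborel)

lemma norm_gauss_mass:
  assumes c: "0 < Re c"
  shows "norm (gauss_mass TYPE('a::euclidean_space) c) = norm c powr (- real DIM('a) / 2)"
proof -
  have c0: "norm c > 0" using c by auto
  let ?n = "norm (gauss_mass TYPE('a) c)"
  from arg_cong[OF gauss_integral_square[OF c, where 'a='a], of norm]
  have "?n\<^sup>2 * norm c ^ DIM('a) = 1"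
    by (simp add: gauss_mass_def norm_mult norm_power)
  then have "?n\<^sup>2 = inverse (norm c ^ DIM('a))"
    using c0 by (simp add: field_simps)
  also have "\<dots> = (norm c powr (- real DIM('a) / 2))\<^sup>2"
    using c0 by (subst powr_power) (simp_all add: powr_minus powr_realpow)
  finally show ?thesis by (simp add: power2_eq_iff_nonneg)
qed

section \<open>Duality and decay of Fourier transforms\<close>
lemma fubini_dominated:
  fixes F :: "'a::euclidean_space \<Rightarrow> 'b::euclidean_space \<Rightarrow> complex"
  assumes [measurable]: "(\<lambda>(x, y). F x y) \<in> borel_measurable (lborel \<Otimes>\<^sub>M lborel)"
    and a: "integrable lborel (a :: 'a \<Rightarrow> real)" and b: "integrable lborel (b :: 'b \<Rightarrow> real)"
    and le: "\<And>x y. norm (F x y) \<le> a x * b y"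
  shows "(LINT x|lborel. LINT y|lborel. F x y) = (LINT y|lborel. LINT x|lborel. F x y)"
proof -
  have [measurable]: "a \<in> borel_measurable borel" "b \<in> borel_measurable borel"
    using a b by (auto dest: borel_measurable_integrable)
  have "integrable (lborel \<Otimes>\<^sub>M lborel) (\<lambda>(x, y). a x * b y)"
  proof (rule lborel_pair.Fubini_integrable)
    show "integrable lborel (\<lambda>x. LINT y|lborel. norm (case (x, y) of (x, y) \<Rightarrow> a x * b y))"
      using a by (simp add: abs_mult)
    show "AE x in lborel. integrable lborel (\<lambda>y. case (x, y) of (x, y) \<Rightarrow> a x * b y)"
      using b by simp
  qed measurable
  then have "integrable (lborel \<Otimes>\<^sub>M lborel) (\<lambda>(x, y). F x y)"
    by (rule Bochner_Integration.integrable_bound)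
       (auto intro!: AE_I2 order_trans[OF le] order_trans[OF _ abs_ge_self])
  from lborel_pair.Fubini_integral[OF this] show ?thesis by simp
qed

lemma norm_fourier_le:
  assumes "integrable lborel f"
  shows "norm (fourier f \<xi>) \<le> (LINT x|lborel. norm (f x))"
proof -
  have [measurable]: "f \<in> borel_measurable borel" using assms by (auto dest: borel_measurable_integrable)
  show ?thesis
    by (subst fourier_lborel, simp)
       (rule order_trans[OF integral_norm_bound], simp add: norm_mult)
qed

lemma fourier_measurable [measurable]:
  fixes f :: "'a::euclidean_space \<Rightarrow> complex"
  assumes [measurable]: "f \<in> borel_measurable borel"
  shows "fourier f \<in> borel_measurable borel"
proof -
  have "(\<lambda>\<xi>. LINT x|lborel. f x * cis (- 2 * pi * (x \<bullet> \<xi>))) \<in> borel_measurable borel"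
    by (rule lborel.borel_measurable_lebesgue_integral) measurable
  moreover have "fourier f = (\<lambda>\<xi>. LINT x|lborel. f x * cis (- 2 * pi * (x \<bullet> \<xi>)))"
    by (intro ext fourier_lborel assms)
  ultimately show ?thesis by simp
qed

text \<open>
  This form of Parseval's identity uses only Fubini's theorem; it replaces Fourier inversion
  throughout.
\<close>
lemma fourier_multiplication_formula:
  fixes f g :: "'a::euclidean_space \<Rightarrow> complex"
  assumes f: "integrable lborel f" and g: "integrable lborel g"
  shows "(LINT \<xi>|lborel. g \<xi> * fourier f \<xi>) = (LINT x|lborel. f x * fourier g x)"
proof -
  have [measurable]: "f \<in> borel_measurable borel" "g \<in> borel_measurable borel"
    using f g by (auto dest: borel_measurable_integrable)
  have "(LINT \<xi>|lborel. g \<xi> * fourier f \<xi>)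
      = (LINT \<xi>|lborel. LINT x|lborel. g \<xi> * (f x * cis (- 2 * pi * (x \<bullet> \<xi>))))"
    by (simp add: fourier_lborel)
  also have "\<dots> = (LINT x|lborel. LINT \<xi>|lborel. g \<xi> * (f x * cis (- 2 * pi * (x \<bullet> \<xi>))))"
    by (rule fubini_dominated[where a="\<lambda>\<xi>. norm (g \<xi>)" and b="\<lambda>x. norm (f x)"])
       (auto intro!: integrable_norm f g simp: norm_mult)
  also have "\<dots> = (LINT x|lborel. LINT \<xi>|lborel. f x * (g \<xi> * cis (- 2 * pi * (\<xi> \<bullet> x))))"
    by (simp add: inner_commute mult.left_commute)
  finally show ?thesis by (simp add: fourier_lborel)
qed

lemma integral_reflect:
  fixes f :: "'a::euclidean_space \<Rightarrow> complex"
  assumes [measurable]: "f \<in> borel_measurable borel"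
  shows "(LINT x|lborel. f (- x)) = (LINT x|lborel. f x)"
proof -
  have "(LINT x|lborel. f x) = (LINT x|density (distr lborel borel (\<lambda>x. 0 + (-1) *\<^sub>R x)) (\<lambda>_. ennreal (\<bar>-1\<bar>^DIM('a))). f x)"
    by (subst lborel_affine[where c="-1" and t=0]) auto
  also have "\<dots> = (LINT x|lborel. f (- x))"
    by (simp add: density_1 integral_distr)
  finally show ?thesis ..
qed

lemma integrable_reflect:
  fixes f :: "'a::euclidean_space \<Rightarrow> complex"
  assumes f: "integrable lborel f"
  shows "integrable lborel (\<lambda>x. f (- x))"
proof -
  have [measurable]: "f \<in> borel_measurable borel" using f by (auto dest: borel_measurable_integrable)
  have "integrable (density (distr lborel borel (\<lambda>x. 0 + (-1) *\<^sub>R x)) (\<lambda>_. ennreal (\<bar>-1\<bar>^DIM('a)))) f"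
    using f by (subst (asm) lborel_affine[where c="-1" and t=0]) auto
  then show ?thesis by (simp add: density_1 integrable_distr_eq)
qed

lemma fourier_reflect:
  fixes f :: "'a::euclidean_space \<Rightarrow> complex"
  assumes [measurable]: "f \<in> borel_measurable borel"
  shows "fourier (\<lambda>x. f (- x)) \<xi> = fourier f (- \<xi>)"
  using integral_reflect[of "\<lambda>x. f x * cis (- 2 * pi * (x \<bullet> - \<xi>))"] by (simp add: fourier_lborel)

lemma schwartz_dir_deriv_iterate:
  assumes "schwartz f" "b \<in> Basis"
  shows "schwartz ((dir_deriv b ^^ k) f)" 
    and "fourier ((dir_deriv b ^^ k) f) \<xi> = (2 * of_real pi * \<i> * of_real (\<xi> \<bullet> b)) ^ k * fourier f \<xi>"
proof (induction k)
  case (Suc k)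
  { case 1 show ?case using Suc(1) schwartz_dir_deriv assms by simp }
  { case 2 show ?case using Suc fourier_dir_deriv[OF _ assms(2)] by simp }
qed (use assms in auto)

lemma ex_large_coordinate: "\<exists>b\<in>Basis. norm (\<xi>::'a::euclidean_space) \<le> DIM('a) * \<bar>\<xi> \<bullet> b\<bar>"
proof (rule ccontr)
  assume "\<not> ?thesis"
  then have *: "\<And>b. b \<in> Basis \<Longrightarrow> \<bar>\<xi> \<bullet> b\<bar> < norm \<xi> / DIM('a)" by (auto simp: field_simps not_le)
  have "norm \<xi> \<le> (\<Sum>b\<in>Basis. \<bar>\<xi> \<bullet> b\<bar>)" by (rule norm_le_l1)
  also have "\<dots> < (\<Sum>b\<in>(Basis::'a set). norm \<xi> / DIM('a))"
    by (rule sum_strict_mono) (auto intro: *)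
  finally show False by simp
qed

text \<open>
  Iterated derivatives in the direction of one basis vector bound \<open>(\<xi> \<bullet> b)\<^sup>K\<close> times the transform.
  At each \<open>\<xi>\<close> one coordinate has size comparable to \<open>|\<xi>|\<close>, so mixed derivatives are not involved.
\<close>
lemma rapid_fourier:
  fixes f :: "'a::euclidean_space \<Rightarrow> complex"
  assumes f: "schwartz f"
  shows "rapid (fourier f)"
  unfolding rapid_def
proof
  fix K
  define I where "I b k = (LINT x|lborel. norm ((dir_deriv b ^^ k) f x))" for b k
  have I0: "0 \<le> I b k" for b k unfolding I_def by simp
  have bd: "(2 * pi * \<bar>\<xi> \<bullet> b\<bar>) ^ k * norm (fourier f \<xi>) \<le> I b k" if "b \<in> Basis" for b k \<xi>
    using norm_fourier_le[OF schwartz_integrable[OF schwartz_dir_deriv_iterate(1)[OF f that]], of k \<xi>]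
    unfolding schwartz_dir_deriv_iterate(2)[OF f that] I_def by (simp add: norm_mult norm_power)
  define C where "C = (\<Sum>b\<in>(Basis::'a set). (1 + real DIM('a)) ^ K * (I b 0 + I b K))"
  have "(1 + norm \<xi>) ^ K * norm (fourier f \<xi>) \<le> C" for \<xi>
  proof -
    obtain b where b: "b \<in> Basis" "norm \<xi> \<le> DIM('a) * \<bar>\<xi> \<bullet> b\<bar>" using ex_large_coordinate by blast
    define t where "t = 2 * pi * \<bar>\<xi> \<bullet> b\<bar>"
    have "1 * \<bar>\<xi> \<bullet> b\<bar> \<le> 2 * pi * \<bar>\<xi> \<bullet> b\<bar>"
      using pi_ge_two by (intro mult_right_mono) auto
    then have t: "norm \<xi> \<le> DIM('a) * t" "0 \<le> t"
      using b(2) unfolding t_def by (auto intro: order_trans mult_left_mono)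
    have "1 + norm \<xi> \<le> (1 + real DIM('a)) * max 1 t"
      unfolding distrib_right
      using order_trans[OF t(1) mult_left_mono[of t "max 1 t" "real DIM('a)"]] by (intro add_mono) auto
    then have "(1 + norm \<xi>) ^ K \<le> ((1 + real DIM('a)) * max 1 t) ^ K"
      by (intro power_mono) auto
    also have "\<dots> \<le> (1 + real DIM('a)) ^ K * (1 + t ^ K)"
      using t(2) unfolding power_mult_distrib by (intro mult_left_mono) (auto simp: max_def)
    finally have "(1 + norm \<xi>) ^ K * norm (fourier f \<xi>)
        \<le> (1 + real DIM('a)) ^ K * (1 + t ^ K) * norm (fourier f \<xi>)"
      by (rule mult_right_mono) auto
    also have "\<dots> = (1 + real DIM('a)) ^ K * (t ^ 0 * norm (fourier f \<xi>) + t ^ K * norm (fourier f \<xi>))"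
      by (simp add: algebra_simps)
    also have "\<dots> \<le> (1 + real DIM('a)) ^ K * (I b 0 + I b K)"
      unfolding t_def by (intro mult_left_mono add_mono bd b) auto
    also have "\<dots> \<le> C"
      unfolding C_def using b(1) I0 by (intro member_le_sum) auto
    finally show ?thesis .
  qed
  then show "\<exists>C. \<forall>x. (1 + norm x) ^ K * norm (fourier f x) \<le> C" by blast
qed

section \<open>Bessel potentials of Schwartz functions\<close>
definition bessel_symbol :: "'a::euclidean_space \<Rightarrow> real" where
  "bessel_symbol \<xi> = 1 + 4 * pi\<^sup>2 * (norm \<xi>)\<^sup>2"

lemma bessel_symbol_ge_1: "1 \<le> bessel_symbol \<xi>"
  by (simp add: bessel_symbol_def)

lemma bessel_symbol_measurable [measurable]: "bessel_symbol \<in> borel_measurable borel"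
  unfolding bessel_symbol_def[abs_def] by measurable

lemma bessel_symbol_powr_le: "\<exists>A k. \<forall>\<xi>::'a::euclidean_space. bessel_symbol \<xi> powr a \<le> A * (1 + norm \<xi>) ^ k"
proof -
  obtain k :: nat where k: "a \<le> real k" using real_arch_simple by blast
  have "bessel_symbol \<xi> powr a \<le> (1 + 4 * pi\<^sup>2) ^ k * (1 + norm \<xi>) ^ (2 * k)" for \<xi> :: 'a
  proof -
    have "bessel_symbol \<xi> powr a \<le> bessel_symbol \<xi> powr real k"
      using k bessel_symbol_ge_1[of \<xi>] by (intro powr_mono) auto
    also have "\<dots> = bessel_symbol \<xi> ^ k" using bessel_symbol_ge_1[of \<xi>] by (intro powr_realpow) auto
    also have "\<dots> \<le> ((1 + 4 * pi\<^sup>2) * (1 + norm \<xi>)\<^sup>2) ^ k"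
    proof (intro power_mono)
      have "1 \<le> (1 + norm \<xi>)\<^sup>2" "(norm \<xi>)\<^sup>2 \<le> (1 + norm \<xi>)\<^sup>2"
        by (auto intro: power_mono simp: one_le_power)
      then show "bessel_symbol \<xi> \<le> (1 + 4 * pi\<^sup>2) * (1 + norm \<xi>)\<^sup>2"
        unfolding bessel_symbol_def distrib_right by (intro add_mono mult_left_mono) auto
    qed (use bessel_symbol_ge_1[of \<xi>] in auto)
    finally show ?thesis by (simp add: power_mult_distrib power_mult)
  qed
  then show ?thesis by blast
qed

lemma rapid_bessel_fourier:
  assumes "schwartz f" shows "rapid (\<lambda>\<xi>. of_real (bessel_symbol \<xi> powr a) * fourier f \<xi>)"
proof -
  obtain A k where "\<And>\<xi>::'a. bessel_symbol \<xi> powr a \<le> A * (1 + norm \<xi>) ^ k"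
    using bessel_symbol_powr_le by blast
  then show ?thesis
    by (intro rapid_mult_bounded_poly[OF rapid_fourier[OF assms], where A=A and l=k]) simp
qed

lemma integrable_bessel_fourier:
  assumes "schwartz f" shows "integrable lborel (\<lambda>\<xi>. of_real (bessel_symbol \<xi> powr a) * fourier f \<xi>)"
proof -
  have [measurable]: "f \<in> borel_measurable borel" by (rule schwartz_measurable[OF assms])
  show ?thesis by (intro rapid_integrable rapid_bessel_fourier[OF assms]) measurable
qed

lemma bessel_op_eq_fourier:
  assumes "schwartz f"
  shows "bessel_op s f x = fourier (\<lambda>\<xi>. of_real (bessel_symbol \<xi> powr (s / 2)) * fourier f \<xi>) (- x)"
proof -
  have [measurable]: "f \<in> borel_measurable borel" by (rule schwartz_measurable[OF assms])
  show ?thesis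
    unfolding bessel_op_def
    by (subst (2) fourier_def) (simp add: inner_commute mult.assoc bessel_symbol_def)
qed

text \<open>
  For a Schwartz function the distribution \<open>(1 - \<Delta>)\<^bsup>s/2\<^esup> h\<close> is the function given by the Fourier integral.
  Both pairings with a test function \<open>\<phi>\<close> equal \<open>\<integral> \<lambda>(\<xi>)\<^bsup>s/2\<^esup> (F h)(-\<xi>) (F \<phi>)(\<xi>) d\<xi>\<close>, where \<open>F\<close> is the
  Fourier transform and \<open>\<lambda>\<close> the Bessel symbol.
\<close>
lemma sobolev_norm_le_bessel_op:
  fixes h :: "'a::euclidean_space \<Rightarrow> complex"
  assumes h: "schwartz h"
  shows "sobolev_norm r s h \<le> Lp_norm r (bessel_op s h)"
proof -
  define \<omega> where "\<omega> f \<xi> = of_real (bessel_symbol \<xi> powr (s / 2)) * fourier f \<xi>" for f :: "'a \<Rightarrow> complex" and \<xi>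
  have \<omega>: "integrable lborel (\<omega> f)" if "schwartz f" for f
    unfolding \<omega>_def[abs_def] by (rule integrable_bessel_fourier[OF that])
  have op: "bessel_op s f = (\<lambda>x. fourier (\<omega> f) (- x))" if "schwartz f" for f
    using bessel_op_eq_fourier[OF that] unfolding \<omega>_def[abs_def] by auto
  have [measurable]: "h \<in> borel_measurable borel" by (rule schwartz_measurable[OF h])
  have mult: "integrable lebesgue (\<lambda>x. k x * \<phi> x)"
    if k: "\<And>x. norm (k x) \<le> A" and [measurable]: "k \<in> borel_measurable borel" and \<phi>: "schwartz \<phi>"
    for k \<phi> :: "'a \<Rightarrow> complex" and A
  proof -
    have [measurable]: "\<phi> \<in> borel_measurable borel" by (rule schwartz_measurable[OF \<phi>])
    have "0 \<le> A" using k[of 0] norm_ge_zero order_trans by blast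
    have "integrable lborel (\<lambda>x. k x * \<phi> x)"
      by (rule Bochner_Integration.integrable_bound[OF integrable_mult_right[OF integrable_norm[OF schwartz_integrable[OF \<phi>]], of A]])
         (use k \<open>0 \<le> A\<close> in \<open>auto simp: norm_mult intro!: AE_I2 mult_right_mono\<close>)
    then show ?thesis by (subst integrable_completion) auto
  qed
  obtain A where A: "\<And>x. norm (h x) \<le> A" using rapidD[OF schwartz_rapid[OF h], of 0] by auto
  have mb [measurable]: "bessel_op s f \<in> borel_measurable borel" if "schwartz f" for f :: "'a \<Rightarrow> complex"
  proof -
    have [measurable]: "fourier (\<omega> f) \<in> borel_measurable borel"
      using borel_measurable_integrable[OF \<omega>[OF that]] by (intro fourier_measurable) simp
    show ?thesis unfolding op[OF that] by measurable
  qed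
  have [measurable]: "bessel_op s h \<in> borel_measurable borel" by (rule mb[OF h])
  have bd: "norm (bessel_op s h x) \<le> (LINT x|lborel. norm (\<omega> h x))" for x
    unfolding op[OF h] by (rule norm_fourier_le[OF \<omega>[OF h]])
  have "(LINT x|lebesgue. bessel_op s h x * \<phi> x) = (LINT x|lebesgue. h x * bessel_op s \<phi> x)"
    if \<phi>: "schwartz \<phi>" for \<phi>
  proof -
    have [measurable]: "\<phi> \<in> borel_measurable borel" by (rule schwartz_measurable[OF \<phi>])
    have [measurable]: "bessel_op s \<phi> \<in> borel_measurable borel" by (rule mb[OF \<phi>])
    have m1: "(\<lambda>x. bessel_op s h x * \<phi> x) \<in> borel_measurable borel"
      and m2: "(\<lambda>x. h x * bessel_op s \<phi> x) \<in> borel_measurable borel" by measurable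
    have "(LINT x|lebesgue. bessel_op s h x * \<phi> x) = (LINT x|lborel. bessel_op s h x * \<phi> x)"
      by (intro integral_completion) measurable
    also have "\<dots> = (LINT x|lborel. \<phi> (- x) * fourier (\<omega> h) x)"
      using integral_reflect[OF m1] op[OF h] by (simp add: mult.commute)
    also have "\<dots> = (LINT \<xi>|lborel. \<omega> h \<xi> * fourier (\<lambda>x. \<phi> (- x)) \<xi>)"
      by (rule fourier_multiplication_formula[symmetric, OF integrable_reflect[OF schwartz_integrable[OF \<phi>]] \<omega>[OF h]])
    also have "\<dots> = (LINT \<xi>|lborel. of_real (bessel_symbol \<xi> powr (s / 2)) * fourier h \<xi> * fourier \<phi> (- \<xi>))"
      by (simp add: \<omega>_def fourier_reflect)
    also have "\<dots> = (LINT \<xi>|lborel. of_real (bessel_symbol \<xi> powr (s / 2)) * fourier h (- \<xi>) * fourier \<phi> \<xi>)"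
      by (subst integral_reflect[symmetric]) (auto simp: bessel_symbol_def)
    also have "\<dots> = (LINT \<xi>|lborel. \<omega> \<phi> \<xi> * fourier (\<lambda>x. h (- x)) \<xi>)"
      by (simp add: \<omega>_def fourier_reflect mult_ac)
    also have "\<dots> = (LINT x|lborel. h (- x) * fourier (\<omega> \<phi>) x)"
      by (rule fourier_multiplication_formula[OF integrable_reflect[OF schwartz_integrable[OF h]] \<omega>[OF \<phi>]])
    also have "\<dots> = (LINT x|lborel. h x * bessel_op s \<phi> x)"
      using integral_reflect[OF m2] op[OF \<phi>] by simp
    also have "\<dots> = (LINT x|lebesgue. h x * bessel_op s \<phi> x)"
      by (intro integral_completion[symmetric]) measurable
    finally show ?thesis .
  qed
  then have "bessel_op_dist s h (bessel_op s h)"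
    unfolding bessel_op_dist_def tempered_fun_def
    using mult[where k=h, OF A] mult[where k="bessel_op s h", OF bd]
    by (auto intro!: measurable_completion)
  then show ?thesis unfolding sobolev_norm_def by (intro Inf_lower) auto
qed

section \<open>Heat operators and their superpositions\<close>
lemma nn_integral_translate:
  fixes g :: "'a::euclidean_space \<Rightarrow> ennreal"
  assumes [measurable]: "g \<in> borel_measurable borel"
  shows "(\<integral>\<^sup>+y. g (y - x) \<partial>lborel) = (\<integral>\<^sup>+y. g y \<partial>lborel)"
proof -
  have "(\<integral>\<^sup>+y. g y \<partial>lborel) = (\<integral>\<^sup>+y. g y \<partial>distr lborel borel ((+) (- x)))"
    by (simp only: lborel_distr_plus)
  also have "\<dots> = (\<integral>\<^sup>+y. g (y - x) \<partial>lborel)"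
    by (subst nn_integral_distr) auto
  finally show ?thesis ..
qed

lemma nn_integral_gauss:
  assumes a: "0 < a"
  shows "(\<integral>\<^sup>+x. ennreal (exp (- (pi * a * (norm x)\<^sup>2))) \<partial>(lborel::'a::euclidean_space measure)) = ennreal (a powr (- real DIM('a) / 2))"
proof -
  have int: "integrable lborel (\<lambda>x::'a. exp (- (pi * a * (norm x)\<^sup>2)))"
    using integrable_norm_gauss[of "of_real a" 0, where 'a='a] a by simp
  have "(LINT x|lborel. gauss (of_real a) (x::'a)) = (LINT x|lborel. of_real (exp (- (pi * a * (norm (x::'a))\<^sup>2))))"
    by (simp add: gauss_def exp_of_real[symmetric])
  then have "gauss_mass TYPE('a) (of_real a) = of_real (LINT x|lborel. exp (- (pi * a * (norm (x::'a))\<^sup>2)))"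
    unfolding gauss_mass_def by (simp only: integral_complex_of_real)
  with norm_gauss_mass[of "of_real a", where 'a='a] a
  have "\<bar>LINT x|lborel. exp (- (pi * a * (norm (x::'a))\<^sup>2))\<bar> = a powr (- real DIM('a) / 2)"
    by simp
  moreover have "0 \<le> (LINT x|lborel. exp (- (pi * a * (norm (x::'a))\<^sup>2)))" by simp
  ultimately show ?thesis using nn_integral_eq_integral[OF int] by simp
qed

definition fourier_mult :: "('a::euclidean_space \<Rightarrow> real) \<Rightarrow> ('a \<Rightarrow> complex) \<Rightarrow> 'a \<Rightarrow> complex" where
  "fourier_mult M f x = (LINT \<xi>|lborel. of_real (M \<xi>) * fourier f \<xi> * cis (2 * pi * (x \<bullet> \<xi>)))"

text \<open>Bounds in these two norms pass to superpositions by elementary means, and together they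
  give an \<open>L\<^sup>r\<close> bound by \<open>Lp_norm_le_interpolation\<close>.\<close>
definition L1_Linf_symbol :: "('a::euclidean_space \<Rightarrow> real) \<Rightarrow> real \<Rightarrow> bool" where
  "L1_Linf_symbol M B \<longleftrightarrow> (\<forall>f. schwartz f \<longrightarrow>
     (\<forall>A. (\<forall>y. norm (f y) \<le> A) \<longrightarrow> (\<forall>x. norm (fourier_mult M f x) \<le> B * A)) \<and>
     (\<integral>\<^sup>+x. norm (fourier_mult M f x) \<partial>lborel) \<le> ennreal B * (\<integral>\<^sup>+x. norm (f x) \<partial>lborel))"

lemma fourier_mult_measurable:
  assumes [measurable]: "f \<in> borel_measurable borel" "M \<in> borel_measurable borel"
  shows "fourier_mult M f \<in> borel_measurable borel"
  unfolding fourier_mult_def[abs_def]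
  by (rule lborel.borel_measurable_lebesgue_integral) measurable

text \<open>The symbol of \<open>exp(-\<tau>(1 - \<Delta>))\<close>, the heat operator damped by \<open>exp(-\<tau>)\<close>.\<close>
abbreviation heat_symbol :: "real \<Rightarrow> 'a::euclidean_space \<Rightarrow> real" where
  "heat_symbol \<tau> \<xi> \<equiv> exp (- (\<tau> * bessel_symbol \<xi>))"

lemma heat_kernel_representation:
  fixes f :: "'a::euclidean_space \<Rightarrow> complex"
  assumes \<tau>: "0 < \<tau>" and f: "integrable lborel f"
  defines "c \<equiv> complex_of_real (4 * pi * \<tau>)"
  shows "fourier_mult (heat_symbol \<tau>) f x
    = of_real (exp (- \<tau>)) * (LINT y|lborel. f y * (gauss_mass TYPE('a) c * gauss (1 / c) (y - x)))"
proof -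
  have [measurable]: "f \<in> borel_measurable borel" using f by (auto dest: borel_measurable_integrable)
  have c: "0 < Re c" using \<tau> by (simp add: c_def)
  \<comment> \<open>The transform of \<open>\<omega>\<close> is the heat kernel centred at \<open>x\<close>.\<close>
  define \<omega> where "\<omega> \<xi> = gauss c \<xi> * cis (2 * pi * (\<xi> \<bullet> x))" for \<xi> :: 'a
  have \<omega>: "integrable lborel \<omega>"
    unfolding \<omega>_def[abs_def] by (rule integrable_mult_cis[OF schwartz_integrable[OF schwartz_gauss[OF c]]])
  have [measurable]: "\<omega> \<in> borel_measurable borel" using \<omega> by (auto dest: borel_measurable_integrable)
  have sym: "complex_of_real (heat_symbol \<tau> \<xi>) = of_real (exp (- \<tau>)) * gauss c \<xi>" for \<xi> :: 'a
  proof -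
    have "- (\<tau> * bessel_symbol \<xi>) = - \<tau> + - (pi * (4 * pi * \<tau>) * (norm \<xi>)\<^sup>2)"
      by (simp add: bessel_symbol_def algebra_simps power2_eq_square)
    then have "heat_symbol \<tau> \<xi> = exp (- \<tau>) * exp (- (pi * (4 * pi * \<tau>) * (norm \<xi>)\<^sup>2))"
      by (simp only: exp_add)
    moreover have "gauss c \<xi> = of_real (exp (- (pi * (4 * pi * \<tau>) * (norm \<xi>)\<^sup>2)))"
      by (simp add: gauss_def c_def exp_of_real[symmetric])
    ultimately show ?thesis by simp
  qed
  have "fourier_mult (heat_symbol \<tau>) f x = (LINT \<xi>|lborel. of_real (exp (- \<tau>)) * (\<omega> \<xi> * fourier f \<xi>))"
    unfolding fourier_mult_def sym \<omega>_def
    by (intro Bochner_Integration.integral_cong refl) (simp add: mult_ac inner_commute)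
  also have "\<dots> = of_real (exp (- \<tau>)) * (LINT y|lborel. f y * fourier \<omega> y)"
    by (subst integral_mult_right_zero, subst fourier_multiplication_formula[OF f \<omega>], rule refl)
  finally have rep: "fourier_mult (heat_symbol \<tau>) f x = of_real (exp (- \<tau>)) * (LINT y|lborel. f y * fourier \<omega> y)" .
  have "fourier \<omega> y = gauss_mass TYPE('a) c * gauss (1 / c) (y - x)" for y
  proof -
    have "fourier \<omega> y = fourier (gauss c) (y - x)"
      by (simp add: fourier_lborel \<omega>_def mult.assoc cis_mult inner_diff_right algebra_simps)
    then show ?thesis by (simp add: fourier_gauss_mass[OF c])
  qed
  then show ?thesis unfolding rep by simp
qed

text \<open>The heat kernel is positive and has integral one, and the damping factor is at most one.\<close>
lemma L1_Linf_symbol_heat: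
  assumes \<tau>: "0 < \<tau>"
  shows "L1_Linf_symbol (heat_symbol \<tau> :: 'a::euclidean_space \<Rightarrow> real) 1"
  unfolding L1_Linf_symbol_def
proof (intro allI impI)
  fix f :: "'a \<Rightarrow> complex" assume "schwartz f"
  then have f: "integrable lborel f" by (rule schwartz_integrable)
  then have [measurable]: "f \<in> borel_measurable borel" by (auto dest: borel_measurable_integrable)
  define c where "c = complex_of_real (4 * pi * \<tau>)"
  define a where "a = 1 / (4 * pi * \<tau>)"
  have a: "0 < a" using \<tau> by (simp add: a_def)
  have ca: "1 / c = of_real a" "norm c = 1 / a" "0 < Re c" using \<tau> by (auto simp: c_def a_def norm_mult)
  let ?H = "fourier_mult (heat_symbol \<tau>) f"
  let ?I = "\<lambda>x. LINT y|lborel. f y * (gauss_mass TYPE('a) c * gauss (1 / c) (y - x))"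
  define K where "K z = norm (gauss_mass TYPE('a) c) * exp (- (pi * a * (norm z)\<^sup>2))" for z :: 'a
  have K0: "0 \<le> K z" for z by (simp add: K_def)
  have K_m: "K \<in> borel_measurable borel" unfolding K_def[abs_def] by measurable
  note [measurable] = K_m
  have K_sym: "K (y - x) = K (x - y)" for x y by (simp add: K_def norm_minus_commute)
  have "(\<integral>\<^sup>+z. ennreal (K z) \<partial>lborel)
      = ennreal (norm (gauss_mass TYPE('a) c)) * (\<integral>\<^sup>+z. ennreal (exp (- (pi * a * (norm z)\<^sup>2))) \<partial>(lborel::'a measure))"
    unfolding K_def by (subst nn_integral_cmult[symmetric]) (auto simp: ennreal_mult)
  also have "\<dots> = 1"
    unfolding nn_integral_gauss[OF a] norm_gauss_mass[OF ca(3)] ca(2) using a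
    by (simp add: ennreal_mult'[symmetric] powr_minus powr_divide)
  finally have K1: "(\<integral>\<^sup>+y. ennreal (K (y - x)) \<partial>lborel) = 1" for x
    using nn_integral_translate[of "\<lambda>z. ennreal (K z)" x] by simp
  have bound: "ennreal (norm (?H x)) \<le> (\<integral>\<^sup>+y. ennreal (norm (f y)) * ennreal (K (y - x)) \<partial>lborel)" for x
  proof -
    have "norm (?H x) 
       = exp (- \<tau>) * norm (?I x)"
      unfolding heat_kernel_representation[OF \<tau> f] c_def by (simp add: norm_mult)
    also have "\<dots> \<le> 1 * norm (?I x)"
      using \<tau> by (intro mult_right_mono) auto
    finally have "norm (?H x) \<le> norm (?I x)" by simp
    then have "ennreal (norm (?H x)) \<le> ennreal (norm (?I x))"
      by (rule ennreal_leI)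
    also have "\<dots> \<le> (\<integral>\<^sup>+y. ennreal (norm (f y * (gauss_mass TYPE('a) c * gauss (1 / c) (y - x)))) \<partial>lborel)"
    proof (rule integral_norm_bound_ennreal)
      have "integrable lborel (\<lambda>y. gauss_mass TYPE('a) c * f y)" using f by (rule integrable_mult_right)
      then show "integrable lborel (\<lambda>y. f y * (gauss_mass TYPE('a) c * gauss (1 / c) (y - x)))"
        by (rule Bochner_Integration.integrable_bound)
           (use a in \<open>auto simp: norm_mult norm_gauss ca(1) mult.left_commute[of "norm (f _)"] intro!: AE_I2 mult_left_mono mult_left_le\<close>)
    qed
    also have "\<dots> = (\<integral>\<^sup>+y. ennreal (norm (f y)) * ennreal (K (y - x)) \<partial>lborel)"
      by (intro nn_integral_cong) (simp add: norm_mult norm_gauss K_def ca(1) ennreal_mult)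
    finally show ?thesis .
  qed
  show "(\<forall>A. (\<forall>y. norm (f y) \<le> A) \<longrightarrow> (\<forall>x. norm (?H x) \<le> 1 * A)) \<and>
     (\<integral>\<^sup>+x. norm (?H x) \<partial>lborel) \<le> ennreal 1 * (\<integral>\<^sup>+x. norm (f x) \<partial>lborel)"
  proof (intro conjI allI impI)
    fix A x assume A: "\<forall>y. norm (f y) \<le> A"
    then have A0: "0 \<le> A" using norm_ge_zero order_trans by blast
    have "ennreal (norm (?H x)) \<le> (\<integral>\<^sup>+y. ennreal A * ennreal (K (y - x)) \<partial>lborel)"
      by (rule order_trans[OF bound]) (intro nn_integral_mono mult_right_mono ennreal_leI, use A in auto)
    also have "\<dots> = ennreal A" by (subst nn_integral_cmult) (auto simp: K1)
    finally show "norm (?H x) \<le> 1 * A" using A0 by (simp add: ennreal_le_iff)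
  next
    have "(\<integral>\<^sup>+x. norm (?H x) \<partial>lborel)
       \<le> (\<integral>\<^sup>+x. (\<integral>\<^sup>+y. ennreal (norm (f y)) * ennreal (K (y - x)) \<partial>lborel) \<partial>lborel)"
      by (intro nn_integral_mono bound)
    also have "\<dots> = (\<integral>\<^sup>+y. (\<integral>\<^sup>+x. ennreal (norm (f y)) * ennreal (K (y - x)) \<partial>lborel) \<partial>lborel)"
      by (rule lborel_pair.Fubini') measurable
    also have "\<dots> = (\<integral>\<^sup>+y. ennreal (norm (f y)) \<partial>lborel)"
    proof -
      have "(\<lambda>x. ennreal (K (y - x))) = (\<lambda>x. ennreal (K (x - y)))" for y
        by (intro ext arg_cong[where f=ennreal] K_sym)
      then have "(\<integral>\<^sup>+x. ennreal (K (y - x)) \<partial>lborel) = 1" for y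
        using K1[of y] by simp
      then show ?thesis by (simp add: nn_integral_cmult)
    qed
    finally show "(\<integral>\<^sup>+x. norm (?H x) \<partial>lborel) \<le> ennreal 1 * (\<integral>\<^sup>+x. norm (f x) \<partial>lborel)"
      by simp
  qed
qed

text \<open>Minkowski's integral inequality, which for these two norms is just the triangle inequality
  and Tonelli's theorem.\<close>
lemma L1_Linf_symbol_heat_superposition:
  fixes \<kappa> :: "real \<Rightarrow> real"
  assumes int: "integrable lborel \<kappa>" and nonneg: "\<And>\<tau>. 0 \<le> \<kappa> \<tau>" and supp: "\<And>\<tau>. \<tau> \<le> 0 \<Longrightarrow> \<kappa> \<tau> = 0"
  shows "L1_Linf_symbol (\<lambda>\<xi>::'a::euclidean_space. LINT \<tau>|lborel. \<kappa> \<tau> * heat_symbol \<tau> \<xi>) (LINT \<tau>|lborel. \<kappa> \<tau>)"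
    (is "L1_Linf_symbol ?M ?B")
  unfolding L1_Linf_symbol_def
proof (intro allI impI)
  have [measurable]: "\<kappa> \<in> borel_measurable borel" using int by (auto dest: borel_measurable_integrable)
  fix f :: "'a \<Rightarrow> complex" assume f: "schwartz f"
  note [measurable] = schwartz_measurable[OF f]
  have fint: "integrable lborel (fourier f)" by (rule rapid_integrable[OF rapid_fourier[OF f]]) measurable
  have B: "ennreal ?B = (\<integral>\<^sup>+\<tau>. ennreal (\<kappa> \<tau>) \<partial>lborel)"
    using nn_integral_eq_integral[OF int] nonneg by simp
  have [measurable]: "(\<lambda>p. fourier_mult (heat_symbol (fst p)) f (snd p)) \<in> borel_measurable (borel \<Otimes>\<^sub>M borel)"
    unfolding fourier_mult_def
    by (rule lborel.borel_measurable_lebesgue_integral) measurable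
  have le1: "\<kappa> \<tau> * heat_symbol \<tau> \<xi> \<le> \<kappa> \<tau>" for \<tau> and \<xi> :: 'a
    using supp[of \<tau>] nonneg[of \<tau>] bessel_symbol_ge_1[of \<xi>] by (cases "\<tau> \<le> 0") (auto intro!: mult_left_le)
  have eq: "fourier_mult ?M f x = (LINT \<tau>|lborel. of_real (\<kappa> \<tau>) * fourier_mult (heat_symbol \<tau>) f x)" for x
  proof -
    have "fourier_mult ?M f x = (LINT \<xi>|lborel. LINT \<tau>|lborel. of_real (\<kappa> \<tau> * heat_symbol \<tau> \<xi>) * (fourier f \<xi> * cis (2 * pi * (x \<bullet> \<xi>))))"
      unfolding fourier_mult_def integral_complex_of_real[symmetric]
      by (simp only: integral_mult_left_zero mult.assoc)
    also have "\<dots> = (LINT \<tau>|lborel. LINT \<xi>|lborel. of_real (\<kappa> \<tau> * heat_symbol \<tau> \<xi>) * (fourier f \<xi> * cis (2 * pi * (x \<bullet> \<xi>))))"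
    proof (rule fubini_dominated[where a="\<lambda>\<xi>. norm (fourier f \<xi>)" and b=\<kappa>])
      show "norm (of_real (\<kappa> \<tau> * heat_symbol \<tau> \<xi>) * (fourier f \<xi> * cis (2 * pi * (x \<bullet> \<xi>)))) \<le> norm (fourier f \<xi>) * \<kappa> \<tau>" for \<xi> \<tau>
        using mult_right_mono[OF le1, of "norm (fourier f \<xi>)" \<tau> \<xi>] nonneg[of \<tau>] by (simp add: norm_mult mult_ac)
    qed (measurable, rule integrable_norm[OF fint], rule int)
    also have "\<dots> = (LINT \<tau>|lborel. of_real (\<kappa> \<tau>) * fourier_mult (heat_symbol \<tau>) f x)"
      unfolding fourier_mult_def by (simp add: mult.assoc)
    finally show ?thesis .
  qed
  have bound: "ennreal (norm (fourier_mult ?M f x)) \<le> (\<integral>\<^sup>+\<tau>. ennreal (\<kappa> \<tau>) * ennreal (norm (fourier_mult (heat_symbol \<tau>) f x)) \<partial>lborel)" for x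
  proof (cases "integrable lborel (\<lambda>\<tau>. of_real (\<kappa> \<tau>) * fourier_mult (heat_symbol \<tau>) f x)")
    case True
    from integral_norm_bound_ennreal[OF this] show ?thesis
      unfolding eq using nonneg by (simp add: norm_mult ennreal_mult)
  qed (simp add: eq not_integrable_integral_eq)
  show "(\<forall>A. (\<forall>y. norm (f y) \<le> A) \<longrightarrow> (\<forall>x. norm (fourier_mult ?M f x) \<le> ?B * A)) \<and>
     (\<integral>\<^sup>+x. norm (fourier_mult ?M f x) \<partial>lborel) \<le> ennreal ?B * (\<integral>\<^sup>+x. norm (f x) \<partial>lborel)"
  proof (intro conjI allI impI)
    fix A x assume A: "\<forall>y. norm (f y) \<le> A"
    then have A0: "0 \<le> A" using norm_ge_zero order_trans by blast
    have le: "ennreal (\<kappa> \<tau>) * ennreal (norm (fourier_mult (heat_symbol \<tau>) f x)) \<le> ennreal (\<kappa> \<tau>) * ennreal A" for \<tau>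
      using L1_Linf_symbol_heat[of \<tau>, where 'a='a] f A supp[of \<tau>] unfolding L1_Linf_symbol_def
      by (cases "\<tau> \<le> 0") (auto intro!: mult_left_mono ennreal_leI)
    have "ennreal (norm (fourier_mult ?M f x)) \<le> (\<integral>\<^sup>+\<tau>. ennreal (\<kappa> \<tau>) * ennreal A \<partial>lborel)"
      by (rule order_trans[OF bound]) (intro nn_integral_mono le)
    also have "\<dots> = ennreal (?B * A)" using A0 nonneg by (subst nn_integral_multc) (auto simp: B[symmetric] ennreal_mult)
    finally show "norm (fourier_mult ?M f x) \<le> ?B * A" using A0 nonneg by (simp add: ennreal_le_iff)
  next
    have le: "(\<integral>\<^sup>+x. ennreal (\<kappa> \<tau>) * ennreal (norm (fourier_mult (heat_symbol \<tau>) f x)) \<partial>lborel) \<le> ennreal (\<kappa> \<tau>) * (\<integral>\<^sup>+x. norm (f x) \<partial>lborel)" for \<tau>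
    proof (cases "\<tau> \<le> 0")
      case False
      have [measurable]: "fourier_mult (heat_symbol \<tau>) f \<in> borel_measurable borel" by (rule fourier_mult_measurable) measurable
      show ?thesis using L1_Linf_symbol_heat[of \<tau>, where 'a='a] f False unfolding L1_Linf_symbol_def
        by (subst nn_integral_cmult) (auto intro!: mult_left_mono)
    qed (simp add: supp)
    have "(\<integral>\<^sup>+x. norm (fourier_mult ?M f x) \<partial>lborel)
       \<le> (\<integral>\<^sup>+x. (\<integral>\<^sup>+\<tau>. ennreal (\<kappa> \<tau>) * ennreal (norm (fourier_mult (heat_symbol \<tau>) f x)) \<partial>lborel) \<partial>lborel)"
      by (intro nn_integral_mono bound)
    also have "\<dots> = (\<integral>\<^sup>+\<tau>. (\<integral>\<^sup>+x. ennreal (\<kappa> \<tau>) * ennreal (norm (fourier_mult (heat_symbol \<tau>) f x)) \<partial>lborel) \<partial>lborel)"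
      by (rule lborel_pair.Fubini') (simp add: split_beta')
    also have "\<dots> \<le> (\<integral>\<^sup>+\<tau>. ennreal (\<kappa> \<tau>) * (\<integral>\<^sup>+x. norm (f x) \<partial>lborel) \<partial>lborel)"
      by (intro nn_integral_mono le)
    also have "\<dots> = ennreal ?B * (\<integral>\<^sup>+x. norm (f x) \<partial>lborel)"
      by (subst nn_integral_multc) (auto simp: B)
    finally show "(\<integral>\<^sup>+x. norm (fourier_mult ?M f x) \<partial>lborel) \<le> ennreal ?B * (\<integral>\<^sup>+x. norm (f x) \<partial>lborel)" .
  qed
qed

section \<open>Fractional powers of the Bessel operator\<close>
lemma has_bochner_integral_of_has_integral:
  fixes f :: "real \<Rightarrow> real"
  assumes "(f has_integral I) S" "\<And>t. t \<in> S \<Longrightarrow> 0 \<le> f t"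
    and [measurable]: "f \<in> borel_measurable borel" "S \<in> sets borel"
  shows "has_bochner_integral lborel (\<lambda>t. indicator S t * f t) I"
proof (rule has_bochner_integral_nn_integral)
  show "0 \<le> I" using assms(1,2) by (rule has_integral_nonneg)
  show "(\<integral>\<^sup>+t. ennreal (indicator S t * f t) \<partial>lborel) = ennreal I"
    using nn_integral_has_integral_lebesgue[OF assms(2,1)] by simp
qed (use assms(2) in \<open>auto simp: indicator_def\<close>)

text \<open>
  The weights in the two halves of \<open>fractional_power_identity\<close>: on \<open>[0, t0)\<close> the Gamma-function
  weight \<open>\<tau>\<^bsup>-\<theta>\<^esup>\<close>, and on \<open>[t0, \<infinity>)\<close> minus its derivative, which appears after integration by parts.
\<close>
definition kernel_near :: "real \<Rightarrow> real \<Rightarrow> real \<Rightarrow> real" where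
  "kernel_near \<theta> t0 \<tau> = indicator {0..<t0} \<tau> * \<tau> powr (- \<theta>)"

definition kernel_far :: "real \<Rightarrow> real \<Rightarrow> real \<Rightarrow> real" where
  "kernel_far \<theta> t0 \<tau> = indicator {t0..} \<tau> * (\<theta> * \<tau> powr (- \<theta> - 1))"

lemma kernel_near_integral:
  assumes "\<theta> < 1" "0 < t0"
  shows "integrable lborel (kernel_near \<theta> t0)"
    and "(LINT \<tau>|lborel. kernel_near \<theta> t0 \<tau>) \<le> t0 powr (1 - \<theta>) / (1 - \<theta>)"
proof -
  have "has_bochner_integral lborel (\<lambda>\<tau>. indicator {0..t0} \<tau> * \<tau> powr (- \<theta>)) (t0 powr (- \<theta> + 1) / (- \<theta> + 1))"
    using assms by (intro has_bochner_integral_of_has_integral has_integral_powr_from_0) auto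
  then have 1: "integrable lborel (\<lambda>\<tau>. indicator {0..t0} \<tau> * \<tau> powr (- \<theta>))"
    and 2: "(LINT \<tau>|lborel. indicator {0..t0} \<tau> * \<tau> powr (- \<theta>)) = t0 powr (1 - \<theta>) / (1 - \<theta>)"
    by (auto simp: has_bochner_integral_iff add.commute)
  show 3: "integrable lborel (kernel_near \<theta> t0)"
    unfolding kernel_near_def[abs_def]
    by (rule Bochner_Integration.integrable_bound[OF 1]) (auto simp: indicator_def)
  show "(LINT \<tau>|lborel. kernel_near \<theta> t0 \<tau>) \<le> t0 powr (1 - \<theta>) / (1 - \<theta>)"
    unfolding 2[symmetric] by (intro integral_mono 1 3) (auto simp: kernel_near_def indicator_def)
qed

lemma kernel_far_integral:
  assumes "0 \<le> \<theta>" "0 < t0"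
  shows "integrable lborel (kernel_far \<theta> t0)"
    and "(LINT \<tau>|lborel. kernel_far \<theta> t0 \<tau>) \<le> t0 powr (- \<theta>)"
proof -
  have "integrable lborel (kernel_far \<theta> t0) \<and> (LINT \<tau>|lborel. kernel_far \<theta> t0 \<tau>) \<le> t0 powr (- \<theta>)"
  proof (cases "\<theta> = 0")
    case True
    then show ?thesis by (simp add: kernel_far_def[abs_def])
  next
    case False
    then have "has_bochner_integral lborel (\<lambda>\<tau>. indicator {t0..} \<tau> * \<tau> powr (- \<theta> - 1)) (- (t0 powr (- \<theta> - 1 + 1)) / (- \<theta> - 1 + 1))"
      using assms by (intro has_bochner_integral_of_has_integral has_integral_powr_to_inf) auto
    from has_bochner_integral_mult_right[OF this, of \<theta>]
    have "has_bochner_integral lborel (kernel_far \<theta> t0) (t0 powr (- \<theta>))"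
      using False by (simp add: kernel_far_def[abs_def] mult_ac)
    then show ?thesis by (simp add: has_bochner_integral_iff)
  qed
  then show "integrable lborel (kernel_far \<theta> t0)" "(LINT \<tau>|lborel. kernel_far \<theta> t0 \<tau>) \<le> t0 powr (- \<theta>)"
    by auto
qed

text \<open>
  Start from \<open>\<Gamma>(1 - \<theta>) l\<^sup>\<theta> = \<integral>\<^sub>0\<^sup>\<infinity> \<tau>\<^bsup>-\<theta>\<^esup> l exp(-\<tau>l) d\<tau>\<close> and integrate by parts on \<open>[t0, \<infinity>)\<close> only. The factor
  \<open>l\<close>, which costs two derivatives, is then confined to the short times, where the weight has the
  small mass \<open>t0\<^bsup>1-\<theta>\<^esup>/(1 - \<theta>)\<close>; the terms without \<open>l\<close> have mass of order \<open>t0\<^bsup>-\<theta>\<^esup>\<close>. The case \<open>\<theta> = 0\<close> is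
  included.
\<close>
lemma fractional_power_identity:
  assumes \<theta>: "0 \<le> \<theta>" "\<theta> < 1" and t0: "0 < t0" and l: "0 < l"
  shows "Gamma (1 - \<theta>) * l powr \<theta> = l * (LINT \<tau>|lborel. kernel_near \<theta> t0 \<tau> * exp (- (\<tau> * l)))
    + t0 powr (- \<theta>) * exp (- (t0 * l)) - (LINT \<tau>|lborel. kernel_far \<theta> t0 \<tau> * exp (- (\<tau> * l)))"
proof -
  let ?g = "\<lambda>\<tau>. \<tau> powr (- \<theta>) * exp (- (\<tau> * l))"
  have "has_bochner_integral lborel (\<lambda>t. indicator {0..} t * (t powr (1 - \<theta> - 1) / exp t)) (Gamma (1 - \<theta>))"
    using \<theta> by (intro has_bochner_integral_of_has_integral Gamma_integral_real) auto
  then have "has_bochner_integral lborel (\<lambda>t. indicator {0..} (0 + l * t) * ((0 + l * t) powr (1 - \<theta> - 1) / exp (0 + l * t))) (Gamma (1 - \<theta>) /\<^sub>R \<bar>l\<bar>)"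
    using l by (subst (asm) lborel_has_bochner_integral_real_affine_iff[of l _ _ 0]) auto
  moreover have "indicator {0..} (0 + l * t) * ((0 + l * t) powr (1 - \<theta> - 1) / exp (0 + l * t)) = l powr (- \<theta>) * (indicator {0..} t * ?g t)" for t
    using l by (auto simp: indicator_def powr_mult exp_minus field_simps zero_le_mult_iff)
  ultimately have "has_bochner_integral lborel (\<lambda>t. l powr (- \<theta>) * (indicator {0..} t * ?g t)) (Gamma (1 - \<theta>) / l)"
    using l by (simp add: divide_inverse mult.commute)
  from has_bochner_integral_mult_right[OF this, of "l powr \<theta>"]
  have "has_bochner_integral lborel (\<lambda>t. indicator {0..} t * ?g t) (l powr \<theta> * (Gamma (1 - \<theta>) / l))"
    using l by (simp add: mult.assoc[symmetric] powr_add[symmetric])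
  then have A: "integrable lborel (\<lambda>t. indicator {0..} t * ?g t)"
    and A': "l * (LINT t|lborel. indicator {0..} t * ?g t) = Gamma (1 - \<theta>) * l powr \<theta>"
    using l by (auto simp: has_bochner_integral_iff)
  have near: "integrable lborel (\<lambda>\<tau>. kernel_near \<theta> t0 \<tau> * exp (- (\<tau> * l)))"
    unfolding kernel_near_def[abs_def]
    by (rule Bochner_Integration.integrable_bound[OF A]) (auto simp: indicator_def)
  have far1: "integrable lborel (\<lambda>\<tau>. indicator {t0..} \<tau> * ?g \<tau>)"
    using t0 by (intro Bochner_Integration.integrable_bound[OF A]) (auto simp: indicator_def)
  have far2: "integrable lborel (\<lambda>\<tau>. kernel_far \<theta> t0 \<tau> * exp (- (\<tau> * l)))"
    using kernel_far_integral(1)[OF \<theta>(1) t0]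
  proof (rule Bochner_Integration.integrable_bound)
    show "AE \<tau> in lborel. norm (kernel_far \<theta> t0 \<tau> * exp (- (\<tau> * l))) \<le> norm (kernel_far \<theta> t0 \<tau>)"
    proof (rule AE_I2)
      fix \<tau> show "norm (kernel_far \<theta> t0 \<tau> * exp (- (\<tau> * l))) \<le> norm (kernel_far \<theta> t0 \<tau>)"
        using t0 l by (cases "t0 \<le> \<tau>") (auto simp: kernel_far_def abs_mult intro!: mult_left_le mult_nonneg_nonneg)
    qed
  qed (unfold kernel_far_def[abs_def], measurable)
  let ?f = "\<lambda>\<tau>. \<theta> * \<tau> powr (- \<theta> - 1) * exp (- (\<tau> * l)) + l * ?g \<tau>"
  \<comment> \<open>Integration by parts in the form that \<open>?f\<close> is the derivative of \<open>-?g\<close>.\<close>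
  have "(\<integral>\<^sup>+\<tau>. ennreal (?f \<tau>) * indicator {t0..} \<tau> \<partial>lborel) = ennreal (0 - (- ?g t0))"
  proof (rule nn_integral_FTC_atLeast)
    fix \<tau> assume \<tau>: "t0 \<le> \<tau>"
    show "((\<lambda>\<tau>. - ?g \<tau>) has_real_derivative ?f \<tau>) (at \<tau>)"
      using \<tau> t0 by (auto intro!: derivative_eq_intros simp: powr_diff field_simps)
    show "0 \<le> ?f \<tau>" using \<theta> l by auto
  next
    show "((\<lambda>\<tau>. - ?g \<tau>) \<longlongrightarrow> 0) at_top"
      using l \<theta> by real_asymp
  qed simp
  then have "has_bochner_integral lborel (\<lambda>\<tau>. ?f \<tau> * indicator {t0..} \<tau>) (?g t0)"
    using l \<theta> by (intro has_bochner_integral_nn_integral) (auto simp: ennreal_mult' ennreal_indicator)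
  then have "(LINT \<tau>|lborel. ?f \<tau> * indicator {t0..} \<tau>) = ?g t0"
    by (simp add: has_bochner_integral_iff)
  moreover have "(\<lambda>\<tau>. ?f \<tau> * indicator {t0..} \<tau>) = (\<lambda>\<tau>. kernel_far \<theta> t0 \<tau> * exp (- (\<tau> * l)) + l * (indicator {t0..} \<tau> * ?g \<tau>))"
    by (auto simp: kernel_far_def indicator_def fun_eq_iff)
  ultimately have B: "(LINT \<tau>|lborel. kernel_far \<theta> t0 \<tau> * exp (- (\<tau> * l))) + l * (LINT \<tau>|lborel. indicator {t0..} \<tau> * ?g \<tau>) = ?g t0"
    using far1 far2 by (simp add: Bochner_Integration.integral_add)
  have "(\<lambda>t. indicator {0..} t * ?g t) = (\<lambda>\<tau>. kernel_near \<theta> t0 \<tau> * exp (- (\<tau> * l)) + indicator {t0..} \<tau> * ?g \<tau>)"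
    using t0 by (auto simp: kernel_near_def indicator_def fun_eq_iff)
  then have "(LINT t|lborel. indicator {0..} t * ?g t) = (LINT \<tau>|lborel. kernel_near \<theta> t0 \<tau> * exp (- (\<tau> * l))) + (LINT \<tau>|lborel. indicator {t0..} \<tau> * ?g \<tau>)"
    using near far1 by (simp add: Bochner_Integration.integral_add)
  with A' B show ?thesis by (simp add: distrib_left)
qed

lemma L1_Linf_symbol_mono:
  assumes "L1_Linf_symbol M B" "B \<le> B'" shows "L1_Linf_symbol M B'"
  unfolding L1_Linf_symbol_def
proof (intro allI impI conjI)
  fix f :: "'a \<Rightarrow> complex" assume f: "schwartz f"
  show "norm (fourier_mult M f x) \<le> B' * A" if A: "\<forall>y. norm (f y) \<le> A" for A x
  proof -
    have "0 \<le> A" using A norm_ge_zero order_trans by blast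
    moreover have "norm (fourier_mult M f x) \<le> B * A" using assms(1) f A unfolding L1_Linf_symbol_def by blast
    ultimately show ?thesis using assms(2) by (meson mult_right_mono order_trans)
  qed
  have "(\<integral>\<^sup>+x. norm (fourier_mult M f x) \<partial>lborel) \<le> ennreal B * (\<integral>\<^sup>+x. norm (f x) \<partial>lborel)"
    using assms(1) f unfolding L1_Linf_symbol_def by blast
  also have "\<dots> \<le> ennreal B' * (\<integral>\<^sup>+x. norm (f x) \<partial>lborel)"
    using assms(2) by (intro mult_right_mono ennreal_leI) auto
  finally show "(\<integral>\<^sup>+x. norm (fourier_mult M f x) \<partial>lborel) \<le> ennreal B' * (\<integral>\<^sup>+x. norm (f x) \<partial>lborel)" .
qed

text \<open>From \<open>\<integral> |g|\<^sup>r \<le> B\<^bsup>r-1\<^esup> \<integral> |g|\<close>. The parameter \<open>V\<close> plays the role of the volume of a set carrying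
  the bulk of \<open>g\<close>.\<close>
lemma Lp_norm_le_interpolation:
  fixes g :: "'a::euclidean_space \<Rightarrow> complex"
  assumes r: "1 < r" and [measurable]: "g \<in> borel_measurable borel"
    and B: "\<And>x. norm (g x) \<le> B" and V: "0 \<le> V"
    and L1: "(\<integral>\<^sup>+x. norm (g x) \<partial>lborel) \<le> ennreal (B * V)"
  shows "Lp_norm r g \<le> ennreal (B * V powr (1 / r))"
proof -
  have B0: "0 \<le> B" using B[of 0] norm_ge_zero order_trans by blast
  have powr_split: "x powr (r - 1) * x = x powr r" if "0 \<le> x" for x :: real
    using powr_mult_base[OF that, of "r - 1"] by (simp add: mult.commute)
  have "(\<integral>\<^sup>+x. ennreal (norm (g x) powr r) \<partial>lebesgue) = (\<integral>\<^sup>+x. ennreal (norm (g x) powr r) \<partial>lborel)"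
    by (intro nn_integral_completion) measurable
  also have "\<dots> \<le> (\<integral>\<^sup>+x. ennreal (B powr (r - 1)) * ennreal (norm (g x)) \<partial>lborel)"
  proof (intro nn_integral_mono)
    fix x
    have "norm (g x) powr r = norm (g x) powr (r - 1) * norm (g x)" by (simp add: powr_split)
    also have "\<dots> \<le> B powr (r - 1) * norm (g x)"
      using r B by (intro mult_right_mono powr_mono2) auto
    finally show "ennreal (norm (g x) powr r) \<le> ennreal (B powr (r - 1)) * ennreal (norm (g x))"
      by (simp add: ennreal_mult[symmetric] ennreal_leI)
  qed
  also have "\<dots> = ennreal (B powr (r - 1)) * (\<integral>\<^sup>+x. norm (g x) \<partial>lborel)"
    by (rule nn_integral_cmult) measurable
  also have "\<dots> \<le> ennreal (B powr (r - 1)) * ennreal (B * V)"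
    by (intro mult_left_mono L1) auto
  also have "\<dots> = ennreal (B powr r * V)"
    using B0 V by (simp add: ennreal_mult[symmetric] mult.assoc[symmetric] powr_split)
  finally have J: "(\<integral>\<^sup>+x. ennreal (norm (g x) powr r) \<partial>lebesgue) \<le> ennreal (B powr r * V)" (is "?J \<le> _") .
  then have fin: "?J < \<infinity>" by (auto simp: less_top[symmetric] top_unique)
  have "enn2real ?J \<le> B powr r * V"
    using J B0 V by (intro enn2real_leI) auto
  then have "enn2real ?J powr (1 / r) \<le> (B powr r * V) powr (1 / r)"
    using r by (intro powr_mono2) auto
  also have "\<dots> = B * V powr (1 / r)"
    using r B0 V by (simp add: powr_mult powr_powr)
  finally show ?thesis
    unfolding Lp_norm_def using fin by (auto simp: Let_def intro!: ennreal_leI)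
qed

text \<open>The differential operator \<open>1 - \<Delta>\<close>. The difference is written as a sum so that the closure
  properties of the function classes under sums and multiples apply.\<close>
definition bessel_laplace :: "('a::euclidean_space \<Rightarrow> complex) \<Rightarrow> 'a \<Rightarrow> complex" where
  "bessel_laplace f x = f x + (- 1) * (\<Sum>b\<in>Basis. dir_deriv b (dir_deriv b f) x)"

lemma schwartz_bessel_laplace: "schwartz f \<Longrightarrow> schwartz (bessel_laplace f)"
  unfolding bessel_laplace_def[abs_def]
  by (intro schwartz_add schwartz_cmult schwartz_sum schwartz_dir_deriv) auto

lemma fourier_bessel_laplace:
  fixes f :: "'a::euclidean_space \<Rightarrow> complex"
  assumes f: "schwartz f"
  shows "fourier (bessel_laplace f) \<xi> = of_real (bessel_symbol \<xi>) * fourier f \<xi>"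
proof -
  have b: "schwartz (dir_deriv b (dir_deriv b f))" if "b \<in> Basis" for b using f that by (intro schwartz_dir_deriv) auto
  have S: "schwartz (\<lambda>x. \<Sum>b\<in>Basis. dir_deriv b (dir_deriv b f) x)" by (intro schwartz_sum b) auto
  have "fourier (\<lambda>x. \<Sum>b\<in>Basis. dir_deriv b (dir_deriv b f) x) \<xi> = (\<Sum>b\<in>Basis. fourier (dir_deriv b (dir_deriv b f)) \<xi>)"
    by (simp add: fourier_lborel schwartz_measurable[OF S] schwartz_measurable[OF b] sum_distrib_right
        Bochner_Integration.integral_sum integrable_mult_cis[OF schwartz_integrable[OF b], of _ "- 2 * pi", simplified])
  also have "\<dots> = (\<Sum>b\<in>Basis. - (4 * (of_real pi)\<^sup>2 * of_real ((\<xi> \<bullet> b) * (\<xi> \<bullet> b)) * fourier f \<xi>))"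
    by (intro sum.cong refl) (simp add: fourier_dir_deriv schwartz_dir_deriv f power2_eq_square)
  also have "\<dots> = - (4 * (of_real pi)\<^sup>2 * of_real ((norm \<xi>)\<^sup>2) * fourier f \<xi>)"
    unfolding power2_norm_eq_inner euclidean_inner[of \<xi> \<xi>]
    by (simp add: sum_negf sum_distrib_left sum_distrib_right)
  finally have fS: "fourier (\<lambda>x. \<Sum>b\<in>Basis. dir_deriv b (dir_deriv b f) x) \<xi> = - (4 * (of_real pi)\<^sup>2 * of_real ((norm \<xi>)\<^sup>2) * fourier f \<xi>)" .
  have "fourier (bessel_laplace f) \<xi> = fourier f \<xi> + fourier (\<lambda>x. - 1 * (\<Sum>b\<in>Basis. dir_deriv b (dir_deriv b f) x)) \<xi>"
    unfolding bessel_laplace_def[abs_def]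
    by (rule fourier_add[OF schwartz_integrable[OF f] schwartz_integrable[OF schwartz_cmult[OF S]]])
  also have "\<dots> = fourier f \<xi> + - 1 * fourier (\<lambda>x. \<Sum>b\<in>Basis. dir_deriv b (dir_deriv b f) x) \<xi>"
    by (subst fourier_cmult[OF schwartz_measurable[OF S]]) (rule refl)
  finally show ?thesis unfolding fS by (simp add: bessel_symbol_def algebra_simps)
qed

lemma bessel_laplace_iterate:
  assumes "schwartz f"
  shows "schwartz ((bessel_laplace ^^ k) f)"
    and "fourier ((bessel_laplace ^^ k) f) \<xi> = of_real (bessel_symbol \<xi> ^ k) * fourier f \<xi>"
proof (induction k)
  case (Suc k)
  { case 1 show ?case using Suc(1) schwartz_bessel_laplace by simp }
  { case 2 show ?case using Suc(2) fourier_bessel_laplace[OF Suc(1)] by simp }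
qed (use assms in auto)

lemma integrable_fourier_mult:
  fixes f :: "'a::euclidean_space \<Rightarrow> complex"
  assumes f: "schwartz f" and [measurable]: "M \<in> borel_measurable borel" and B: "\<And>\<xi>. \<bar>M \<xi>\<bar> \<le> B"
  shows "integrable lborel (\<lambda>\<xi>. of_real (M \<xi>) * fourier f \<xi> * cis (2 * pi * (x \<bullet> \<xi>)))"
proof -
  note [measurable] = schwartz_measurable[OF f]
  have "integrable lborel (fourier f)" by (rule rapid_integrable[OF rapid_fourier[OF f]]) measurable
  then have "integrable lborel (\<lambda>\<xi>. of_real B * fourier f \<xi>)" by (rule integrable_mult_right)
  then show ?thesis
    by (rule Bochner_Integration.integrable_bound)
       (use B in \<open>auto simp: norm_mult intro!: AE_I2 mult_right_mono order_trans[OF B abs_ge_self]\<close>)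
qed

text \<open>
  With \<open>u = (1 - \<Delta>)\<^sup>k h\<close> and \<open>w = (1 - \<Delta>) u\<close>, the identity for \<open>\<lambda>\<^sup>\<theta>\<close> writes \<open>(1 - \<Delta>)\<^bsup>s/2\<^esup> h\<close> as a short-time
  superposition applied to \<open>w\<close> plus long-time terms applied to \<open>u\<close>. The parameter \<open>t0\<close> is free, so this
  is an interpolation inequality between \<open>U\<close> and \<open>W\<close>.
\<close>
lemma bessel_op_interpolation:
  fixes h :: "'a::euclidean_space \<Rightarrow> complex"
  assumes h: "schwartz h" and s: "s = 2 * (real k + \<theta>)" and \<theta>: "0 \<le> \<theta>" "\<theta> < 1" and r: "1 < r"
    and t0: "0 < t0" and V: "0 \<le> V"
    and u: "\<And>x. norm ((bessel_laplace ^^ k) h x) \<le> U"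
      "(\<integral>\<^sup>+x. norm ((bessel_laplace ^^ k) h x) \<partial>lborel) \<le> ennreal (U * V)"
    and w: "\<And>x. norm ((bessel_laplace ^^ Suc k) h x) \<le> W"
      "(\<integral>\<^sup>+x. norm ((bessel_laplace ^^ Suc k) h x) \<partial>lborel) \<le> ennreal (W * V)"
  shows "Lp_norm r (bessel_op s h) \<le>
    ennreal ((t0 powr (1 - \<theta>) / (1 - \<theta>) * W + 2 * t0 powr (- \<theta>) * U) / Gamma (1 - \<theta>) * V powr (1 / r))"
proof -
  let ?e = "\<lambda>x \<xi>. cis (2 * pi * (x \<bullet> \<xi>))"
  define uu where "uu = (bessel_laplace ^^ k) h"
  define ww where "ww = (bessel_laplace ^^ Suc k) h"
  have su: "schwartz uu" and sw: "schwartz ww"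
    unfolding uu_def ww_def by (rule bessel_laplace_iterate(1)[OF h])+
  note [measurable] = schwartz_measurable[OF su] schwartz_measurable[OF sw] schwartz_measurable[OF h]
  have U0: "0 \<le> U" and W0: "0 \<le> W" using u(1)[of 0] w(1)[of 0] norm_ge_zero order_trans by blast+
  have G: "0 < Gamma (1 - \<theta>)" using \<theta> by (intro Gamma_real_pos) auto
  define M1 where "M1 \<xi> = (LINT \<tau>|lborel. kernel_near \<theta> t0 \<tau> * heat_symbol \<tau> \<xi>)" for \<xi> :: 'a
  define M2 where "M2 \<xi> = (LINT \<tau>|lborel. kernel_far \<theta> t0 \<tau> * heat_symbol \<tau> \<xi>)" for \<xi> :: 'a
  let ?E = "heat_symbol t0 :: 'a \<Rightarrow> real"
  define b1 where "b1 = t0 powr (1 - \<theta>) / (1 - \<theta>)"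
  define b2 where "b2 = t0 powr (- \<theta>)"
  have b0: "0 \<le> b1" "0 \<le> b2" using \<theta> by (auto simp: b1_def b2_def)
  have k1: "\<And>\<tau>. 0 \<le> kernel_near \<theta> t0 \<tau>" "\<And>\<tau>. \<tau> \<le> 0 \<Longrightarrow> kernel_near \<theta> t0 \<tau> = 0"
    by (auto simp: kernel_near_def indicator_def)
  have k2: "\<And>\<tau>. 0 \<le> kernel_far \<theta> t0 \<tau>" "\<And>\<tau>. \<tau> \<le> 0 \<Longrightarrow> kernel_far \<theta> t0 \<tau> = 0"
    using \<theta> t0 by (auto simp: kernel_far_def indicator_def)
  have mb1: "L1_Linf_symbol M1 b1" unfolding M1_def b1_def
    using L1_Linf_symbol_mono[OF L1_Linf_symbol_heat_superposition[OF kernel_near_integral(1)[OF \<theta>(2) t0] k1] kernel_near_integral(2)[OF \<theta>(2) t0]] .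
  have mb2: "L1_Linf_symbol M2 b2" unfolding M2_def b2_def
    using L1_Linf_symbol_mono[OF L1_Linf_symbol_heat_superposition[OF kernel_far_integral(1)[OF \<theta>(1) t0] k2] kernel_far_integral(2)[OF \<theta>(1) t0]] .
  have [measurable]: "kernel_near \<theta> t0 \<in> borel_measurable borel" "kernel_far \<theta> t0 \<in> borel_measurable borel"
    using kernel_near_integral(1)[OF \<theta>(2) t0] kernel_far_integral(1)[OF \<theta>(1) t0] by (auto dest: borel_measurable_integrable)
  have m1: "M1 \<in> borel_measurable borel" and m2: "M2 \<in> borel_measurable borel"
    unfolding M1_def[abs_def] M2_def[abs_def] by (rule lborel.borel_measurable_lebesgue_integral, measurable)+
  note [measurable] = m1 m2
  have bd: "\<bar>LINT \<tau>|lborel. \<kappa> \<tau> * heat_symbol \<tau> \<xi>\<bar> \<le> (LINT \<tau>|lborel. \<kappa> \<tau>)"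
    if \<kappa>: "integrable lborel \<kappa>" "\<And>\<tau>. 0 \<le> \<kappa> \<tau>" "\<And>\<tau>. \<tau> \<le> 0 \<Longrightarrow> \<kappa> \<tau> = 0" for \<kappa> and \<xi> :: 'a
  proof -
    have le: "\<kappa> \<tau> * heat_symbol \<tau> \<xi> \<le> \<kappa> \<tau>" for \<tau>
      using \<kappa>(2,3)[of \<tau>] bessel_symbol_ge_1[of \<xi>] by (cases "\<tau> \<le> 0") (auto intro!: mult_left_le)
    have "(LINT \<tau>|lborel. \<kappa> \<tau> * heat_symbol \<tau> \<xi>) \<le> (LINT \<tau>|lborel. \<kappa> \<tau>)"
      by (rule integral_mono') (use \<kappa> le in auto)
    moreover have "0 \<le> (LINT \<tau>|lborel. \<kappa> \<tau> * heat_symbol \<tau> \<xi>)" using \<kappa> by simp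
    ultimately show ?thesis by simp
  qed
  have i1: "integrable lborel (\<lambda>\<xi>. of_real (M1 \<xi>) * fourier ww \<xi> * ?e x \<xi>)" for x
    using bd[OF kernel_near_integral(1)[OF \<theta>(2) t0] k1]
    by (intro integrable_fourier_mult[OF sw m1]) (auto simp: M1_def)
  have i2: "integrable lborel (\<lambda>\<xi>. of_real (M2 \<xi>) * fourier uu \<xi> * ?e x \<xi>)" for x
    using bd[OF kernel_far_integral(1)[OF \<theta>(1) t0] k2]
    by (intro integrable_fourier_mult[OF su m2]) (auto simp: M2_def)
  have i3: "integrable lborel (\<lambda>\<xi>. of_real (?E \<xi>) * fourier uu \<xi> * ?e x \<xi>)" for x
    using t0 bessel_symbol_ge_1[where 'a='a]
    by (intro integrable_fourier_mult[OF su, where B=1]) (auto intro!: mult_nonneg_nonneg intro: order_trans[of 0 1])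
  have eq: "of_real (Gamma (1 - \<theta>)) * bessel_op s h x =
      fourier_mult M1 ww x + of_real b2 * fourier_mult ?E uu x - fourier_mult M2 uu x" for x
  proof -
    have "bessel_op s h x = (LINT \<xi>|lborel. of_real (bessel_symbol \<xi> powr (s / 2)) * fourier h \<xi> * ?e x \<xi>)"
      unfolding bessel_op_def bessel_symbol_def[symmetric] by (intro integral_completion) measurable
    then have "of_real (Gamma (1 - \<theta>)) * bessel_op s h x
        = (LINT \<xi>|lborel. of_real (Gamma (1 - \<theta>)) * (of_real (bessel_symbol \<xi> powr (s / 2)) * fourier h \<xi> * ?e x \<xi>))"
      by simp
    also have "\<dots> = (LINT \<xi>|lborel. of_real (M1 \<xi>) * fourier ww \<xi> * ?e x \<xi>
        + of_real b2 * (of_real (?E \<xi>) * fourier uu \<xi> * ?e x \<xi>)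
        - of_real (M2 \<xi>) * fourier uu \<xi> * ?e x \<xi>)"
    proof (intro Bochner_Integration.integral_cong refl)
      fix \<xi> :: 'a
      have l: "0 < bessel_symbol \<xi>" using bessel_symbol_ge_1[of \<xi>] by simp
      have "bessel_symbol \<xi> powr (s / 2) = bessel_symbol \<xi> powr \<theta> * bessel_symbol \<xi> ^ k"
      proof -
        have "s / 2 = \<theta> + real k" by (simp add: s)
        then show ?thesis using l by (simp only: powr_add powr_realpow)
      qed
      then have "Gamma (1 - \<theta>) * bessel_symbol \<xi> powr (s / 2) = (bessel_symbol \<xi> * M1 \<xi> + b2 * ?E \<xi> - M2 \<xi>) * bessel_symbol \<xi> ^ k"
        using fractional_power_identity[OF \<theta> t0 l] by (simp add: M1_def M2_def b2_def)
      then have "complex_of_real (Gamma (1 - \<theta>)) * of_real (bessel_symbol \<xi> powr (s / 2)) =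
         (of_real (bessel_symbol \<xi>) * of_real (M1 \<xi>) + of_real b2 * of_real (?E \<xi>) - of_real (M2 \<xi>)) * of_real (bessel_symbol \<xi> ^ k)"
        unfolding of_real_mult[symmetric] of_real_add[symmetric] of_real_diff[symmetric] by simp
      then have "complex_of_real (Gamma (1 - \<theta>)) * (of_real (bessel_symbol \<xi> powr (s / 2)) * fourier h \<xi> * ?e x \<xi>)
         = (of_real (bessel_symbol \<xi>) * of_real (M1 \<xi>) + of_real b2 * of_real (?E \<xi>) - of_real (M2 \<xi>)) * of_real (bessel_symbol \<xi> ^ k) * (fourier h \<xi> * ?e x \<xi>)"
        by (simp only: mult.assoc[symmetric])
      also have "\<dots> = of_real (M1 \<xi>) * (of_real (bessel_symbol \<xi> ^ Suc k) * fourier h \<xi>) * ?e x \<xi>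
        + of_real b2 * (of_real (?E \<xi>) * (of_real (bessel_symbol \<xi> ^ k) * fourier h \<xi>) * ?e x \<xi>)
        - of_real (M2 \<xi>) * (of_real (bessel_symbol \<xi> ^ k) * fourier h \<xi>) * ?e x \<xi>"
        by (simp add: algebra_simps)
      finally show "complex_of_real (Gamma (1 - \<theta>)) * (of_real (bessel_symbol \<xi> powr (s / 2)) * fourier h \<xi> * ?e x \<xi>)
        = of_real (M1 \<xi>) * fourier ww \<xi> * ?e x \<xi>
        + of_real b2 * (of_real (?E \<xi>) * fourier uu \<xi> * ?e x \<xi>)
        - of_real (M2 \<xi>) * fourier uu \<xi> * ?e x \<xi>"
        unfolding uu_def ww_def bessel_laplace_iterate(2)[OF h] .
    qed
    also have "\<dots> = fourier_mult M1 ww x + of_real b2 * fourier_mult ?E uu x - fourier_mult M2 uu x"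
      unfolding fourier_mult_def
      by (subst Bochner_Integration.integral_diff, intro Bochner_Integration.integrable_add i1 integrable_mult_right i3, rule i2,
          subst Bochner_Integration.integral_add, rule i1, rule integrable_mult_right[OF i3], subst integral_mult_right_zero, rule refl)
    finally show ?thesis .
  qed
  let ?n = "\<lambda>x. norm (fourier_mult M1 ww x) + b2 * norm (fourier_mult ?E uu x) + norm (fourier_mult M2 uu x)"
  have le: "Gamma (1 - \<theta>) * norm (bessel_op s h x) \<le> ?n x" for x
  proof -
    have "Gamma (1 - \<theta>) * norm (bessel_op s h x) = norm (of_real (Gamma (1 - \<theta>)) * bessel_op s h x)"
      using G by (simp add: norm_mult)
    also have "\<dots> \<le> norm (fourier_mult M1 ww x + of_real b2 * fourier_mult ?E uu x) + norm (fourier_mult M2 uu x)"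
      unfolding eq by (rule norm_triangle_ineq4)
    also have "\<dots> \<le> ?n x"
      using norm_triangle_ineq[of "fourier_mult M1 ww x" "of_real b2 * fourier_mult ?E uu x"] b0 by (simp add: norm_mult)
    finally show ?thesis .
  qed
  define B where "B = (b1 * W + 2 * b2 * U) / Gamma (1 - \<theta>)"
  have uA: "\<forall>y. norm (uu y) \<le> U" and wA: "\<forall>y. norm (ww y) \<le> W" using u w unfolding uu_def ww_def by auto
  have mbE: "L1_Linf_symbol ?E 1" by (rule L1_Linf_symbol_heat[OF t0])
  have sup: "norm (bessel_op s h x) \<le> B" for x
  proof -
    have "?n x \<le> b1 * W + b2 * (1 * U) + b2 * U"
      using mb1 mb2 mbE su sw uA wA b0 unfolding L1_Linf_symbol_def by (intro add_mono mult_left_mono) blast+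
    then have "Gamma (1 - \<theta>) * norm (bessel_op s h x) \<le> b1 * W + 2 * b2 * U" using le[of x] by (simp add: algebra_simps)
    then show ?thesis unfolding B_def using G by (simp add: pos_le_divide_eq mult.commute)
  qed
  have fm [measurable]: "fourier_mult M1 ww \<in> borel_measurable borel" "fourier_mult ?E uu \<in> borel_measurable borel"
    "fourier_mult M2 uu \<in> borel_measurable borel"
    by (intro fourier_mult_measurable; measurable)+
  have bm: "bessel_op s h \<in> borel_measurable borel"
  proof -
    have "bessel_op s h = (\<lambda>x. (fourier_mult M1 ww x + of_real b2 * fourier_mult ?E uu x - fourier_mult M2 uu x) / of_real (Gamma (1 - \<theta>)))"
      using G by (auto simp: fun_eq_iff eq[symmetric])
    then show ?thesis by simp
  qed
  note [measurable] = bm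
  have L1: "(\<integral>\<^sup>+x. norm (bessel_op s h x) \<partial>lborel) \<le> ennreal (B * V)"
  proof -
    have "(\<integral>\<^sup>+x. norm (bessel_op s h x) \<partial>lborel) \<le> (\<integral>\<^sup>+x. ennreal (1 / Gamma (1 - \<theta>)) * ennreal (?n x) \<partial>lborel)"
    proof (intro nn_integral_mono)
      fix x
      have "norm (bessel_op s h x) \<le> 1 / Gamma (1 - \<theta>) * ?n x"
        using le[of x] G by (simp add: field_simps)
      then have "ennreal (norm (bessel_op s h x)) \<le> ennreal (1 / Gamma (1 - \<theta>) * ?n x)" by (rule ennreal_leI)
      also have "\<dots> = ennreal (1 / Gamma (1 - \<theta>)) * ennreal (?n x)"
        using G b0 by (intro ennreal_mult) auto
      finally show "ennreal (norm (bessel_op s h x)) \<le> ennreal (1 / Gamma (1 - \<theta>)) * ennreal (?n x)" .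
    qed
    also have "\<dots> = ennreal (1 / Gamma (1 - \<theta>)) * ((\<integral>\<^sup>+x. norm (fourier_mult M1 ww x) \<partial>lborel)
       + ennreal b2 * (\<integral>\<^sup>+x. norm (fourier_mult ?E uu x) \<partial>lborel) + (\<integral>\<^sup>+x. norm (fourier_mult M2 uu x) \<partial>lborel))"
      using b0 by (simp add: nn_integral_cmult nn_integral_add ennreal_mult)
    also have "\<dots> \<le> ennreal (1 / Gamma (1 - \<theta>)) * (ennreal b1 * ennreal (W * V)
       + ennreal b2 * (ennreal 1 * ennreal (U * V)) + ennreal b2 * ennreal (U * V))"
    proof (intro mult_left_mono add_mono)
      show "(\<integral>\<^sup>+x. norm (fourier_mult M1 ww x) \<partial>lborel) \<le> ennreal b1 * ennreal (W * V)"
        using mb1 sw w(2) unfolding L1_Linf_symbol_def ww_def[symmetric] by (meson mult_left_mono order_trans zero_le)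
      show "(\<integral>\<^sup>+x. norm (fourier_mult ?E uu x) \<partial>lborel) \<le> ennreal 1 * ennreal (U * V)"
        using mbE su u(2) unfolding L1_Linf_symbol_def uu_def[symmetric] by (meson mult_left_mono order_trans zero_le)
      show "(\<integral>\<^sup>+x. norm (fourier_mult M2 uu x) \<partial>lborel) \<le> ennreal b2 * ennreal (U * V)"
        using mb2 su u(2) unfolding L1_Linf_symbol_def uu_def[symmetric] by (meson mult_left_mono order_trans zero_le)
    qed auto
    also have "\<dots> = ennreal (B * V)"
      using b0 U0 W0 V G
      by (simp add: ennreal_mult[symmetric] ennreal_plus[symmetric] B_def field_simps del: ennreal_plus)
    finally show ?thesis .
  qed
  from Lp_norm_le_interpolation[OF r bm sup V L1]
  show ?thesis unfolding B_def b1_def b2_def .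
qed

section \<open>Sobolev norms of chirps\<close>

text \<open>The parameter \<open>a\<close> is the square of the dilation factor; it multiplies the real and the imaginary
  part of the exponent alike because both are homogeneous of degree two.\<close>
definition chirp :: "('a \<Rightarrow> real) \<Rightarrow> ('a \<Rightarrow> real) \<Rightarrow> real \<Rightarrow> real \<Rightarrow> 'a \<Rightarrow> complex" where
  "chirp q1 q2 a N x = exp (- (of_real (pi * a) * (of_real (q1 x) + \<i> * of_real N * of_real (q2 x))))"

lemma norm_chirp: "norm (chirp q1 q2 a N x) = exp (- (pi * a * q1 x))"
  by (simp add: chirp_def norm_exp_eq_Re)

definition annular :: "('a::euclidean_space \<Rightarrow> complex) \<Rightarrow> bool" where
  "annular \<psi> \<longleftrightarrow> smooth \<psi> \<and> (\<forall>x. \<psi> x \<noteq> 0 \<longrightarrow> 1/2 \<le> norm x \<and> norm x \<le> 2)"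

lemma annular_dir_deriv:
  assumes "annular \<psi>" "b \<in> Basis" shows "annular (dir_deriv b \<psi>)"
  unfolding annular_def
proof (intro conjI allI impI)
  show "smooth (dir_deriv b \<psi>)" using assms smooth_dir_deriv unfolding annular_def by blast
  fix x assume nz: "dir_deriv b \<psi> x \<noteq> 0"
  have "1/2 \<le> norm x \<and> norm x \<le> 2"
  proof (rule ccontr)
    let ?S = "{x::'a. norm x < 1/2} \<union> {x. 2 < norm x}"
    assume "\<not> ?thesis"
    then have x: "x \<in> ?S" by auto
    have "open ?S" by (intro open_Un open_Collect_less continuous_intros)
    then have "(\<psi> has_derivative (\<lambda>_. 0)) (at x)"
      by (rule has_derivative_transform_within_open[OF has_derivative_const[of 0] _ x])
         (use assms(1) in \<open>force simp: annular_def\<close>)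
    then show False using nz dir_deriv_eqI by fastforce
  qed
  then show "1/2 \<le> norm x" "norm x \<le> 2" by auto
qed

lemma annular_mult:
  assumes "annular \<psi>" "smooth g" shows "annular (\<lambda>x. g x * \<psi> x)"
  using assms unfolding annular_def by (auto intro: smooth_mult)

lemma annular_bounded:
  assumes "annular \<psi>" shows "\<exists>B\<ge>0. \<forall>x. norm (\<psi> x) \<le> B"
proof -
  have "bounded (\<psi> ` cball 0 2)"
    using assms unfolding annular_def
    by (intro compact_imp_bounded compact_continuous_image smooth_continuous_on) auto
  then obtain B where B: "\<And>x. x \<in> cball 0 2 \<Longrightarrow> norm (\<psi> x) \<le> B" unfolding bounded_iff by blast
  have "norm (\<psi> x) \<le> max 0 B" for x
    using B[of x] assms unfolding annular_def by (cases "\<psi> x = 0") auto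
  then show ?thesis by (intro exI[of _ "max 0 B"]) auto
qed

text \<open>
  Families, indexed by \<open>a\<close> and \<open>N\<close>, of sums of products of a cutoff, the chirp, and a monomial in \<open>a\<close>
  and \<open>N\<close> whose degree in \<open>N\<close> is at most \<open>d\<close>. A derivative raises \<open>d\<close> by one. The degree in \<open>a\<close> is not
  recorded, because the decay of the chirp in \<open>a\<close> beats every power. The cutoffs do not depend on
  the parameters, which makes all bounds uniform.
\<close>
inductive chirp_family ::
  "('a::euclidean_space \<Rightarrow> real) \<Rightarrow> ('a \<Rightarrow> real) \<Rightarrow> nat \<Rightarrow> (real \<Rightarrow> real \<Rightarrow> 'a \<Rightarrow> complex) \<Rightarrow> bool"
  for q1 q2 :: "'a \<Rightarrow> real" where
  summand: "annular \<psi> \<Longrightarrow> l \<le> d \<Longrightarrow>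
    chirp_family q1 q2 d (\<lambda>a N x. of_real (a ^ k * N ^ l) * (\<psi> x * chirp q1 q2 a N x))"
| sum: "chirp_family q1 q2 d F \<Longrightarrow> chirp_family q1 q2 d G \<Longrightarrow> chirp_family q1 q2 d (\<lambda>a N x. F a N x + G a N x)"

lemma chirp_family_mono: "chirp_family q1 q2 d F \<Longrightarrow> d \<le> d' \<Longrightarrow> chirp_family q1 q2 d' F"
proof (induction rule: chirp_family.induct)
  case (summand \<psi> l d k)
  then show ?case by (intro chirp_family.summand) auto
next
  case (sum d F G)
  then show ?case by (intro chirp_family.sum) auto
qed

lemma chirp_family_cmult: "chirp_family q1 q2 d F \<Longrightarrow> chirp_family q1 q2 d (\<lambda>a N x. c * F a N x)"
proof (induction rule: chirp_family.induct)
  case (summand \<psi> l d k)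
  have "annular (\<lambda>x. c * \<psi> x)" using summand(1) by (rule annular_mult[OF _ smooth_const])
  from chirp_family.summand[OF this summand(2), of q1 q2 k]
  show ?case by (simp only: mult_ac)
next
  case (sum d F G)
  then show ?case by (simp only: distrib_left) (rule chirp_family.sum)
qed

lemma chirp_family_sum:
  assumes "finite A" "A \<noteq> {}" "\<And>i. i \<in> A \<Longrightarrow> chirp_family q1 q2 d (F i)"
  shows "chirp_family q1 q2 d (\<lambda>a N x. \<Sum>i\<in>A. F i a N x)"
  using assms by (induction A rule: finite_ne_induct) (auto intro: chirp_family.sum)

lemma has_derivative_chirp:
  assumes "smooth q1" "smooth q2"
  shows "(chirp q1 q2 a N has_derivative (\<lambda>b. - (of_real (pi * a) *
     (of_real (dir_deriv b q1 x) + \<i> * of_real N * of_real (dir_deriv b q2 x))) * chirp q1 q2 a N x)) (at x)"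
proof -
  have "((\<lambda>x. - (of_real (pi * a) * (of_real (q1 x) + \<i> * of_real N * of_real (q2 x)))) has_derivative
     (\<lambda>b. - (of_real (pi * a) * (of_real (dir_deriv b q1 x) + \<i> * of_real N * of_real (dir_deriv b q2 x))) :: complex)) (at x)"
    by (intro has_derivative_minus has_derivative_mult_right has_derivative_add has_derivative_of_real
        has_derivative_dir_deriv smooth_differentiable assms)
  from has_derivative_compose[OF this DERIV_exp[unfolded has_field_derivative_def]]
  show ?thesis unfolding chirp_def[abs_def] by (simp add: mult.commute)
qed

lemma chirp_family_differentiable:
  assumes "smooth q1" "smooth q2"
  shows "chirp_family q1 q2 d F \<Longrightarrow> F a N differentiable (at x)"
proof (induction rule: chirp_family.induct)
  case (summand \<psi> l d k)
  then show ?case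
    using differentiableI[OF has_derivative_chirp[OF assms]] unfolding annular_def
    by (intro differentiable_mult differentiable_const) (auto intro: smooth_differentiable)
qed (rule differentiable_add)

lemma chirp_family_dir_deriv:
  fixes q1 q2 :: "'a::euclidean_space \<Rightarrow> real"
  assumes q: "smooth q1" "smooth q2" and b: "b \<in> Basis"
  shows "chirp_family q1 q2 d F \<Longrightarrow> chirp_family q1 q2 (Suc d) (\<lambda>a N. dir_deriv b (F a N))"
proof (induction rule: chirp_family.induct)
  case (summand \<psi> l d k)
  let ?E = "chirp q1 q2"
  let ?g1 = "\<lambda>x. - complex_of_real pi * of_real (dir_deriv b q1 x)"
  let ?g2 = "\<lambda>x. - complex_of_real pi * \<i> * of_real (dir_deriv b q2 x)"
  have sm: "smooth ?g1" "smooth ?g2"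
    by (intro smooth_mult smooth_const smooth_of_real smooth_dir_deriv q b)+
  have "dir_deriv b (\<lambda>x. of_real (a ^ k * N ^ l) * (\<psi> x * ?E a N x)) x =
      (of_real (a ^ k * N ^ l) * (dir_deriv b \<psi> x * ?E a N x)
     + of_real (a ^ Suc k * N ^ l) * ((?g1 x * \<psi> x) * ?E a N x))
     + of_real (a ^ Suc k * N ^ Suc l) * ((?g2 x * \<psi> x) * ?E a N x)" for a N x
  proof -
    have d: "\<psi> differentiable (at x)" "?E a N differentiable (at x)"
      using summand(1) differentiableI[OF has_derivative_chirp[OF q]]
      unfolding annular_def by (auto intro: smooth_differentiable)
    have "dir_deriv b (\<lambda>x. of_real (a ^ k * N ^ l) * (\<psi> x * ?E a N x)) x
      = of_real (a ^ k * N ^ l) * (\<psi> x * dir_deriv b (?E a N) x + dir_deriv b \<psi> x * ?E a N x)"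
      using d by (simp add: dir_deriv_mult dir_deriv_const)
    also have "dir_deriv b (?E a N) x = - (of_real (pi * a) * (of_real (dir_deriv b q1 x) + \<i> * of_real N * of_real (dir_deriv b q2 x))) * ?E a N x"
      by (rule dir_deriv_eqI[OF has_derivative_chirp[OF q]])
    finally show ?thesis by (simp add: algebra_simps)
  qed
  then have eq: "(\<lambda>a N. dir_deriv b (\<lambda>x. of_real (a ^ k * N ^ l) * (\<psi> x * ?E a N x))) = (\<lambda>a N x.
      (of_real (a ^ k * N ^ l) * (dir_deriv b \<psi> x * ?E a N x)
     + of_real (a ^ Suc k * N ^ l) * ((?g1 x * \<psi> x) * ?E a N x))
     + of_real (a ^ Suc k * N ^ Suc l) * ((?g2 x * \<psi> x) * ?E a N x))"
    by (intro ext)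
  show ?case
    unfolding eq using summand(2)
    by (intro chirp_family.intros annular_dir_deriv annular_mult summand(1) b sm) auto
next
  case (sum d F G)
  have "(\<lambda>a N. dir_deriv b (\<lambda>x. F a N x + G a N x)) = (\<lambda>a N x. dir_deriv b (F a N) x + dir_deriv b (G a N) x)"
    by (intro ext dir_deriv_add chirp_family_differentiable[OF q sum(1)] chirp_family_differentiable[OF q sum(2)])
  then show ?case using sum chirp_family.sum by simp
qed

lemma chirp_family_bessel_laplace:
  fixes q1 q2 :: "'a::euclidean_space \<Rightarrow> real"
  assumes q: "smooth q1" "smooth q2" and F: "chirp_family q1 q2 d F"
  shows "chirp_family q1 q2 (d + 2) (\<lambda>a N. bessel_laplace (F a N))"
proof -
  have "chirp_family q1 q2 (d + 2) (\<lambda>a N. dir_deriv b (dir_deriv b (F a N)))" if "b \<in> Basis" for b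
    using chirp_family_dir_deriv[OF q that chirp_family_dir_deriv[OF q that F]] by simp
  then have "chirp_family q1 q2 (d + 2) (\<lambda>a N x. \<Sum>b\<in>Basis. dir_deriv b (dir_deriv b (F a N)) x)"
    by (intro chirp_family_sum) auto
  from chirp_family.sum[OF chirp_family_mono[OF F] chirp_family_cmult[OF this, of "- 1"]]
  show ?thesis unfolding bessel_laplace_def[abs_def] by simp
qed

lemma chirp_family_bessel_laplace_iterate:
  fixes q1 q2 :: "'a::euclidean_space \<Rightarrow> real"
  assumes q: "smooth q1" "smooth q2" and F: "chirp_family q1 q2 0 F"
  shows "chirp_family q1 q2 (2 * k) (\<lambda>a N. (bessel_laplace ^^ k) (F a N))"
proof (induction k)
  case (Suc k)
  from chirp_family_bessel_laplace[OF q this] show ?case by simp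
qed (use F in simp)

text \<open>On the annulus \<open>q1 \<ge> 1/4\<close>, so \<open>a\<^sup>k |chirp| \<le> a\<^sup>k exp(-\<pi>a/4)\<close> is bounded for \<open>a > 0\<close>.\<close>
lemma chirp_family_bound:
  fixes q1 q2 :: "'a::euclidean_space \<Rightarrow> real"
  assumes q1: "\<And>x. (norm x)\<^sup>2 \<le> q1 x"
  shows "chirp_family q1 q2 d F \<Longrightarrow>
    \<exists>C\<ge>0. \<forall>a>0. \<forall>N\<ge>1. \<forall>x. norm (F a N x) \<le> C * N ^ d \<and> (F a N x \<noteq> 0 \<longrightarrow> norm x \<le> 2)"
proof (induction rule: chirp_family.induct)
  case (summand \<psi> l d k)
  obtain B where B: "B \<ge> 0" "\<And>x. norm (\<psi> x) \<le> B" using annular_bounded[OF summand(1)] by blast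
  obtain D where D: "D \<ge> 0" "\<And>a. a \<ge> 0 \<Longrightarrow> a ^ k * exp (- (pi / 4 * a)) \<le> D"
  proof -
    have "((\<lambda>a::real. a ^ k * exp (- (pi / 4 * a))) \<longlongrightarrow> 0) at_top" by real_asymp
    from bounded_above_of_tendsto_0[OF _ this] show ?thesis
      using that by (force intro: continuous_intros)
  qed
  have "norm (of_real (a ^ k * N ^ l) * (\<psi> x * chirp q1 q2 a N x)) \<le> (B * D) * N ^ d"
    if a: "a > 0" and N: "N \<ge> 1" for a N :: real and x :: 'a
  proof (cases "\<psi> x = 0")
    case False
    then have "1/2 \<le> norm x" using summand(1) unfolding annular_def by blast
    then have "(1/2)\<^sup>2 \<le> (norm x)\<^sup>2" by (intro power_mono) auto
    then have "1/4 \<le> q1 x" using q1[of x] by (simp add: power2_eq_square)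
    then have "pi * a * (1/4) \<le> pi * a * q1 x" using a by (intro mult_left_mono) auto
    then have "norm (chirp q1 q2 a N x) \<le> exp (- (pi / 4 * a))"
      unfolding norm_chirp by simp
    then have "a ^ k * norm (chirp q1 q2 a N x) \<le> a ^ k * exp (- (pi / 4 * a))"
      using a by (intro mult_left_mono) auto
    also have "\<dots> \<le> D" using D(2) a by simp
    finally have 1: "a ^ k * norm (chirp q1 q2 a N x) \<le> D" .
    have "norm (of_real (a ^ k * N ^ l) * (\<psi> x * chirp q1 q2 a N x))
        = (norm (\<psi> x) * (a ^ k * norm (chirp q1 q2 a N x))) * N ^ l"
      using a N by (simp add: norm_mult norm_power abs_mult)
    also have "\<dots> \<le> (B * D) * N ^ d"
      using a N B D(1) 1 summand(2) by (intro mult_mono power_increasing) auto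
    finally show ?thesis .
  qed (use B D(1) N in auto)
  moreover have "norm x \<le> 2" if "of_real (a ^ k * N ^ l) * (\<psi> x * chirp q1 q2 a N x) \<noteq> 0" for a N x
    using that summand(1) unfolding annular_def by auto
  ultimately show ?case using B(1) D(1)
    by (intro exI[of _ "B * D"] conjI allI impI mult_nonneg_nonneg) blast+
next
  case (sum d F G)
  obtain C D where C: "C \<ge> 0" "\<And>a N x. a > 0 \<Longrightarrow> N \<ge> 1 \<Longrightarrow> norm (F a N x) \<le> C * N ^ d \<and> (F a N x \<noteq> 0 \<longrightarrow> norm x \<le> 2)"
    and D: "D \<ge> 0" "\<And>a N x. a > 0 \<Longrightarrow> N \<ge> 1 \<Longrightarrow> norm (G a N x) \<le> D * N ^ d \<and> (G a N x \<noteq> 0 \<longrightarrow> norm x \<le> 2)"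
    using sum(3,4) by blast
  have "norm (F a N x + G a N x) \<le> (C + D) * N ^ d \<and> (F a N x + G a N x \<noteq> 0 \<longrightarrow> norm x \<le> 2)"
    if "a > 0" "N \<ge> 1" for a N x
    using norm_triangle_ineq[of "F a N x" "G a N x"] C(2)[OF that, of x] D(2)[OF that, of x]
    by (auto simp: distrib_right)
  then show ?case using C(1) D(1) by (intro exI[of _ "C + D"]) auto
qed

lemma chirp_family_schwartz:
  fixes q1 q2 :: "'a::euclidean_space \<Rightarrow> real"
  assumes q: "smooth q1" "smooth q2" and q1: "\<And>x. (norm x)\<^sup>2 \<le> q1 x"
    and F: "chirp_family q1 q2 d F" and aN: "a > 0" "N \<ge> 1"
  shows "schwartz (F a N)"
proof (rule schwartz_coinduct[where X="\<lambda>f. \<exists>d F. chirp_family q1 q2 d F \<and> f = F a N"])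
  show "\<exists>d' F'. chirp_family q1 q2 d' F' \<and> F a N = F' a N" using F by blast
next
  fix f :: "'a \<Rightarrow> complex" and x
  assume "\<exists>d F. chirp_family q1 q2 d F \<and> f = F a N"
  then show "f differentiable (at x)" using chirp_family_differentiable[OF q] by blast
next
  fix f :: "'a \<Rightarrow> complex" and b :: 'a
  assume "\<exists>d F. chirp_family q1 q2 d F \<and> f = F a N" and b: "b \<in> Basis"
  then obtain d F where F: "chirp_family q1 q2 d F" "f = F a N" by blast
  show "\<exists>d F. chirp_family q1 q2 d F \<and> dir_deriv b f = F a N"
    using chirp_family_dir_deriv[OF q b F(1)] F(2) by (intro exI[of _ "Suc d"] exI[of _ "\<lambda>a N. dir_deriv b (F a N)"]) simp
next
  fix f :: "'a \<Rightarrow> complex"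
  assume "\<exists>d F. chirp_family q1 q2 d F \<and> f = F a N"
  then obtain d F where F: "chirp_family q1 q2 d F" "f = F a N" by blast
  obtain C where C: "C \<ge> 0" "\<And>x. norm (f x) \<le> C * N ^ d \<and> (f x \<noteq> 0 \<longrightarrow> norm x \<le> 2)"
    using chirp_family_bound[OF q1 F(1)] aN unfolding F(2) by blast
  show "rapid f"
    unfolding rapid_def
  proof
    fix k
    have "(1 + norm x) ^ k * norm (f x) \<le> 3 ^ k * (C * N ^ d)" for x
    proof (cases "f x = 0")
      case False
      then show ?thesis using C(2)[of x] by (intro mult_mono power_mono) auto
    qed (use C(1) aN in auto)
    then show "\<exists>C. \<forall>x. (1 + norm x) ^ k * norm (f x) \<le> C" by blast
  qed
qed

text \<open>Applying \<open>(1 - \<Delta>)\<^sup>j\<close> costs \<open>N\<^bsup>2j\<^esup>\<close> uniformly in \<open>a\<close>, and \<open>bessel_op_interpolation\<close> fills in the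
  fractional exponents.\<close>
lemma sobolev_norm_chirp:
  fixes q1 q2 :: "'a::euclidean_space \<Rightarrow> real"
  assumes q: "smooth q1" "smooth q2" and q1: "\<And>x. (norm x)\<^sup>2 \<le> q1 x"
    and \<psi>: "annular \<psi>" and r: "1 < r" and s: "0 < s"
  shows "\<exists>C\<ge>0. \<forall>a>0. \<forall>N\<ge>1. sobolev_norm r s (\<lambda>x. \<psi> x * chirp q1 q2 a N x) \<le> ennreal (C * N powr s)"
proof -
  define k where "k = nat \<lfloor>s / 2\<rfloor>"
  define \<theta> where "\<theta> = s / 2 - real k"
  have rk: "real k = of_int \<lfloor>s / 2\<rfloor>" using s by (simp add: k_def)
  have \<theta>: "0 \<le> \<theta>" "\<theta> < 1" unfolding \<theta>_def rk by linarith+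
  have s_eq: "s = 2 * (real k + \<theta>)" by (simp add: \<theta>_def)
  define F where "F a N x = \<psi> x * chirp q1 q2 a N x" for a N x
  have F: "chirp_family q1 q2 0 F"
    using chirp_family.summand[OF \<psi>, of 0 0 q1 q2 0] by (simp add: F_def[abs_def])
  define L where "L j a N = (bessel_laplace ^^ j) (F a N)" for j a N
  have L: "chirp_family q1 q2 (2 * j) (L j)" for j
    unfolding L_def[abs_def] by (rule chirp_family_bessel_laplace_iterate[OF q F])
  define V where "V = measure lborel (cball (0::'a) 2)"
  have L_bound: "\<exists>C\<ge>0. \<forall>a>0. \<forall>N\<ge>1. (\<forall>x. norm (L j a N x) \<le> C * N ^ (2 * j)) \<and>
      (\<integral>\<^sup>+x. norm (L j a N x) \<partial>lborel) \<le> ennreal (C * N ^ (2 * j) * V)" for j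
  proof -
    obtain C where C: "C \<ge> 0" "\<And>a N x. a > 0 \<Longrightarrow> N \<ge> 1 \<Longrightarrow> norm (L j a N x) \<le> C * N ^ (2 * j) \<and> (L j a N x \<noteq> 0 \<longrightarrow> norm x \<le> 2)"
      using chirp_family_bound[OF q1 L] by meson
    have "(\<integral>\<^sup>+x. norm (L j a N x) \<partial>lborel) \<le> ennreal (C * N ^ (2 * j) * V)" if "a > 0" "N \<ge> 1" for a N
    proof -
      have "(\<integral>\<^sup>+x. norm (L j a N x) \<partial>lborel) \<le> (\<integral>\<^sup>+x. ennreal (C * N ^ (2 * j)) * indicator (cball (0::'a) 2) x \<partial>lborel)"
      proof (rule nn_integral_mono)
        fix x :: 'a
        show "ennreal (norm (L j a N x)) \<le> ennreal (C * N ^ (2 * j)) * indicator (cball 0 2) x"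
          using C(2)[OF that, of x] by (cases "L j a N x = 0") (auto intro!: ennreal_leI)
      qed
      also have "\<dots> = ennreal (C * N ^ (2 * j)) * emeasure lborel (cball (0::'a) 2)"
        by (rule nn_integral_cmult_indicator) simp
      also have "emeasure lborel (cball (0::'a) 2) = ennreal V"
        unfolding V_def by (rule emeasure_eq_ennreal_measure) (use emeasure_lborel_cball_finite[of "0::'a" 2] in auto)
      also have "ennreal (C * N ^ (2 * j)) * ennreal V = ennreal (C * N ^ (2 * j) * V)"
        using C(1) that by (intro ennreal_mult[symmetric]) (auto simp: V_def)
      finally show ?thesis .
    qed
    then show ?thesis using C by blast
  qed
  obtain C1 where C1: "C1 \<ge> 0" "\<And>a N x. a > 0 \<Longrightarrow> N \<ge> 1 \<Longrightarrow> norm (L k a N x) \<le> C1 * N ^ (2 * k)"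
     "\<And>a N. a > 0 \<Longrightarrow> N \<ge> 1 \<Longrightarrow> (\<integral>\<^sup>+x. norm (L k a N x) \<partial>lborel) \<le> ennreal (C1 * N ^ (2 * k) * V)"
    using L_bound[of k] by blast
  obtain C2 where C2: "C2 \<ge> 0" "\<And>a N x. a > 0 \<Longrightarrow> N \<ge> 1 \<Longrightarrow> norm (L (Suc k) a N x) \<le> C2 * N ^ (2 * Suc k)"
     "\<And>a N. a > 0 \<Longrightarrow> N \<ge> 1 \<Longrightarrow> (\<integral>\<^sup>+x. norm (L (Suc k) a N x) \<partial>lborel) \<le> ennreal (C2 * N ^ (2 * Suc k) * V)"
    using L_bound[of "Suc k"] by blast
  define C where "C = (C2 / (1 - \<theta>) + 2 * C1) / Gamma (1 - \<theta>) * V powr (1 / r)"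
  have G: "0 < Gamma (1 - \<theta>)" using \<theta> by (intro Gamma_real_pos) auto
  have "sobolev_norm r s (F a N) \<le> ennreal (C * N powr s)" if aN: "a > 0" "N \<ge> 1" for a N
  proof -
    \<comment> \<open>The parabolic scale of frequency \<open>N\<close>: it balances \<open>W = C2 N\<^bsup>2k+2\<^esup>\<close> against \<open>U = C1 N\<^bsup>2k\<^esup>\<close>.\<close>
    define t0 where "t0 = N powr (- 2)"
    have N0: "0 < N" using aN by simp
    have "sobolev_norm r s (F a N) \<le> Lp_norm r (bessel_op s (F a N))"
      by (rule sobolev_norm_le_bessel_op[OF chirp_family_schwartz[OF q q1 F aN]])
    also have "\<dots> \<le> ennreal ((t0 powr (1 - \<theta>) / (1 - \<theta>) * (C2 * N ^ (2 * Suc k)) + 2 * t0 powr (- \<theta>) * (C1 * N ^ (2 * k))) / Gamma (1 - \<theta>) * V powr (1 / r))"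
      by (rule bessel_op_interpolation[OF chirp_family_schwartz[OF q q1 F aN] s_eq \<theta> r])
         (use N0 C1 C2 aN in \<open>auto simp: t0_def V_def L_def\<close>)
    also have "t0 powr (1 - \<theta>) / (1 - \<theta>) * (C2 * N ^ (2 * Suc k)) = C2 / (1 - \<theta>) * N powr s"
    proof -
      have "N ^ (2 * Suc k) = N powr real (2 * Suc k)" using N0 by (subst powr_realpow) auto
      then have "t0 powr (1 - \<theta>) * N ^ (2 * Suc k) = N powr (- 2 * (1 - \<theta>) + real (2 * Suc k))"
        by (simp only: t0_def powr_powr powr_add)
      also have "- 2 * (1 - \<theta>) + real (2 * Suc k) = s" by (simp add: s_eq algebra_simps)
      finally show ?thesis by (simp add: mult.commute mult.left_commute)
    qed
    also have "2 * t0 powr (- \<theta>) * (C1 * N ^ (2 * k)) = 2 * C1 * N powr s"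
    proof -
      have "N ^ (2 * k) = N powr real (2 * k)" using N0 by (subst powr_realpow) auto
      then have "t0 powr (- \<theta>) * N ^ (2 * k) = N powr (- 2 * (- \<theta>) + real (2 * k))"
        by (simp only: t0_def powr_powr powr_add)
      also have "- 2 * (- \<theta>) + real (2 * k) = s" by (simp add: s_eq algebra_simps)
      finally show ?thesis by (simp add: mult.commute mult.left_commute)
    qed
    also have "(C2 / (1 - \<theta>) * N powr s + 2 * C1 * N powr s) / Gamma (1 - \<theta>) * V powr (1 / r) = C * N powr s"
      unfolding C_def distrib_right[symmetric] by (simp only: times_divide_eq_left times_divide_eq_right mult_ac)
    finally show ?thesis .
  qed
  moreover have "0 \<le> C" unfolding C_def using C1(1) C2(1) \<theta> G by (intro mult_nonneg_nonneg divide_nonneg_nonneg add_nonneg_nonneg) auto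
  ultimately show ?thesis unfolding F_def by blast
qed

lemma sup_sobolev_chirp:
  fixes q1 q2 :: "'a::euclidean_space \<Rightarrow> real"
  assumes q: "smooth q1" "smooth q2" and q1: "\<And>x. (norm x)\<^sup>2 \<le> q1 x"
    and hom: "\<And>t x. q1 (t *\<^sub>R x) = t\<^sup>2 * q1 x" "\<And>t x. q2 (t *\<^sub>R x) = t\<^sup>2 * q2 x"
    and \<Psi>: "dyadic_partition \<Psi>" and r: "1 < r" and s: "0 < s"
  shows "\<exists>C\<ge>0. \<forall>N\<ge>1. sup_sobolev r s \<Psi> (chirp q1 q2 1 N) \<le> ennreal (C * N powr s)"
proof -
  have \<psi>: "annular (\<lambda>x. of_real (\<Psi> x))"
    unfolding annular_def
  proof (intro conjI allI impI)
    show "smooth (\<lambda>x. complex_of_real (\<Psi> x))"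
      using \<Psi> by (intro smooth_of_real) (simp add: dyadic_partition_def)
    fix x assume "complex_of_real (\<Psi> x) \<noteq> 0"
    then have "x \<in> closure {\<xi>. \<Psi> \<xi> \<noteq> 0}" by (intro closure_subset[THEN subsetD]) simp
    then have "x \<in> {\<xi>. 1/2 \<le> norm \<xi> \<and> norm \<xi> \<le> 2}" using \<Psi> unfolding dyadic_partition_def by blast
    then show "1/2 \<le> norm x" "norm x \<le> 2" by auto
  qed
  obtain C where C: "C \<ge> 0" "\<And>a N. a > 0 \<Longrightarrow> N \<ge> 1 \<Longrightarrow>
      sobolev_norm r s (\<lambda>x. of_real (\<Psi> x) * chirp q1 q2 a N x) \<le> ennreal (C * N powr s)"
    using sobolev_norm_chirp[OF q q1 \<psi> r s] by blast
  have "sup_sobolev r s \<Psi> (chirp q1 q2 1 N) \<le> ennreal (C * N powr s)" if "N \<ge> 1" for N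
    unfolding sup_sobolev_def
  proof (rule SUP_least)
    fix j :: int
    have "(\<lambda>\<xi>. chirp q1 q2 1 N ((2 powi j) *\<^sub>R \<xi>) * of_real (\<Psi> \<xi>)) = (\<lambda>x. of_real (\<Psi> x) * chirp q1 q2 ((2 powi j)\<^sup>2) N x)"
      by (simp add: fun_eq_iff chirp_def hom algebra_simps)
    then show "sobolev_norm r s (\<lambda>\<xi>. chirp q1 q2 1 N ((2 powi j) *\<^sub>R \<xi>) * of_real (\<Psi> \<xi>)) \<le> ennreal (C * N powr s)"
      using C(2)[of "(2 powi j)\<^sup>2" N] that by simp
  qed
  then show ?thesis using C(1) by blast
qed

section \<open>The multilinear operator on Gaussians\<close>
lemma smooth_norm_sq_linear:
  fixes L :: "'a::euclidean_space \<Rightarrow> 'b::euclidean_space"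
  assumes "bounded_linear L" shows "smooth (\<lambda>x. (norm (L x))\<^sup>2)"
proof -
  have "smooth (\<lambda>x. L x \<bullet> b)" for b
    by (rule smooth_linear) (rule bounded_linear_compose[OF bounded_linear_inner_left assms])
  then have "smooth (\<lambda>x. \<Sum>b\<in>Basis. (L x \<bullet> b) * (L x \<bullet> b))"
    by (intro smooth_sum smooth_mult)
  moreover have "(\<lambda>x. (norm (L x))\<^sup>2) = (\<lambda>x. \<Sum>b\<in>Basis. (L x \<bullet> b) * (L x \<bullet> b))"
    by (intro ext) (subst power2_norm_eq_inner, rule euclidean_inner)
  ultimately show ?thesis by simp
qed

lemma Lp_norm_gauss:
  fixes k c :: complex
  assumes q: "0 < q" and c: "0 < Re c"
  shows "Lp_norm q (\<lambda>x::'a::euclidean_space. k * gauss c x)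
    = ennreal (norm k * (q * Re c) powr (- real DIM('a) / (2 * q)))"
proof -
  have "norm (k * gauss c x) powr q = norm k powr q * exp (- (pi * (q * Re c) * (norm x)\<^sup>2))" for x :: 'a
    by (simp add: norm_mult norm_gauss powr_mult powr_def[of "exp _"] mult_ac)
  moreover have "(\<integral>\<^sup>+x. ennreal (norm (k * gauss c (x::'a)) powr q) \<partial>lebesgue)
      = (\<integral>\<^sup>+x. ennreal (norm (k * gauss c (x::'a)) powr q) \<partial>lborel)"
    by (intro nn_integral_completion) measurable
  ultimately have "(\<integral>\<^sup>+x. ennreal (norm (k * gauss c (x::'a)) powr q) \<partial>lebesgue)
      = (\<integral>\<^sup>+x. ennreal (norm k powr q) * ennreal (exp (- (pi * (q * Re c) * (norm (x::'a))\<^sup>2))) \<partial>lborel)"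
    by (simp add: ennreal_mult)
  also have "\<dots> = ennreal (norm k powr q) * ennreal ((q * Re c) powr (- real DIM('a) / 2))"
    using q c by (subst nn_integral_cmult) (auto simp: nn_integral_gauss)
  also have "\<dots> = ennreal (norm k powr q * (q * Re c) powr (- real DIM('a) / 2))"
    by (simp add: ennreal_mult)
  finally show ?thesis
    using q c by (simp add: Lp_norm_def powr_mult powr_powr)
qed

definition block_sum :: "real^'n^'m \<Rightarrow> real^'n" where
  "block_sum \<xi> = (\<Sum>i\<in>UNIV. \<xi> $ i)"

lemma inner_block_sum: "y \<bullet> block_sum \<xi> = \<xi> \<bullet> (\<chi> i. y)"
  by (simp add: block_sum_def inner_sum_right inner_vec_def[of \<xi>] inner_commute)

lemma norm_diagonal_sq: "(norm (\<chi> i::'m::finite. (y::real^'n)))\<^sup>2 = real CARD('m) * (norm y)\<^sup>2"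
  by (simp add: power2_norm_eq_inner inner_vec_def[of "\<chi> i. y"])

lemma norm_sq_blocks: "(norm (\<xi>::real^'n^'m))\<^sup>2 = (\<Sum>i\<in>UNIV. (norm (\<xi> $ i))\<^sup>2)"
  by (simp add: power2_norm_eq_inner inner_vec_def[of \<xi>])

lemma bounded_linear_block_sum: "bounded_linear block_sum"
  unfolding block_sum_def[abs_def] by (intro bounded_linear_sum bounded_linear_vec_nth)

lemma block_sum_measurable [measurable]: "block_sum \<in> borel_measurable borel"
  by (intro borel_measurable_continuous_onI linear_continuous_on bounded_linear_block_sum)

lemma gauss_mass_nonzero: "0 < Re c \<Longrightarrow> gauss_mass TYPE('a::euclidean_space) c \<noteq> 0"
  using norm_gauss_mass[of c, where 'a='a] by (metis norm_zero powr_eq_0_iff complex.sel(1) norm_eq_zero order_less_irrefl zero_complex.sel(1))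

text \<open>
  The image of the Gaussian \<open>exp(-2\<pi>|\<xi>|\<^sup>2)\<close> on \<open>mn\<close>-dimensional space under the block sum is a multiple
  of the Gaussian \<open>exp(-2\<pi>|\<eta>|\<^sup>2/m)\<close>. For integrals of Fourier transforms the
  multiplication formula reduces the claim to the equality, up to a factor, of the transforms at \<open>y\<close>
  and at the diagonal point \<open>(y, \<dots>, y)\<close>.
\<close>
lemma gauss_marginal:
  fixes F :: "real^'n \<Rightarrow> complex"
  assumes F: "integrable lborel F"
  defines "m \<equiv> real CARD('m::finite)"
  shows "gauss_mass TYPE(real^'n) (of_real (2 / m)) * (LINT \<xi>|lborel. gauss 2 (\<xi>::real^'n^'m) * fourier F (block_sum \<xi>))
     = gauss_mass TYPE(real^'n^'m) 2 * (LINT \<eta>|lborel. gauss (of_real (2 / m)) \<eta> * fourier F \<eta>)"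
proof -
  have [measurable]: "F \<in> borel_measurable borel" using F by (auto dest: borel_measurable_integrable)
  have m: "0 < m" unfolding m_def by simp
  have g2: "integrable lborel (gauss 2 :: real^'n^'m \<Rightarrow> complex)"
    by (intro schwartz_integrable schwartz_gauss) simp
  have gm: "integrable lborel (gauss (of_real (2 / m)) :: real^'n \<Rightarrow> complex)"
    using m by (intro schwartz_integrable schwartz_gauss) simp
  have inv: "1 / complex_of_real (2 / m) = of_real (m / 2)" by simp
  have "(LINT \<xi>|lborel. gauss 2 (\<xi>::real^'n^'m) * fourier F (block_sum \<xi>))
      = (LINT \<xi>|lborel. LINT y|lborel. gauss 2 (\<xi>::real^'n^'m) * (F y * cis (- 2 * pi * (y \<bullet> block_sum \<xi>))))"
    by (simp add: fourier_lborel)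
  also have "\<dots> = (LINT y|lborel. LINT \<xi>|lborel. gauss 2 (\<xi>::real^'n^'m) * (F y * cis (- 2 * pi * (y \<bullet> block_sum \<xi>))))"
    by (rule fubini_dominated[where a="\<lambda>\<xi>. norm (gauss 2 \<xi> :: complex)" and b="\<lambda>y. norm (F y)"])
       (measurable, rule integrable_norm[OF g2], rule integrable_norm[OF F], simp add: norm_mult)
  also have "\<dots> = (LINT y|lborel. F y * fourier (gauss 2 :: real^'n^'m \<Rightarrow> complex) (\<chi> i. y))"
    by (simp add: fourier_lborel inner_block_sum mult.left_commute)
  also have "\<dots> = (LINT y|lborel. gauss_mass TYPE(real^'n^'m) 2 * (F y * gauss (of_real (m / 2)) y))"
    by (simp add: fourier_gauss_mass gauss_def norm_diagonal_sq m_def mult.left_commute mult.assoc)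
  finally have 1: "(LINT \<xi>|lborel. gauss 2 (\<xi>::real^'n^'m) * fourier F (block_sum \<xi>))
      = gauss_mass TYPE(real^'n^'m) 2 * (LINT y|lborel. F y * gauss (of_real (m / 2)) y)"
    by simp
  have "(LINT \<eta>|lborel. gauss (of_real (2 / m)) \<eta> * fourier F \<eta>) = (LINT y|lborel. F y * fourier (gauss (of_real (2 / m))) y)"
    by (rule fourier_multiplication_formula[OF F gm])
  also have "\<dots> = (LINT y|lborel. gauss_mass TYPE(real^'n) (of_real (2 / m)) * (F y * gauss (of_real (m / 2)) y))"
    using m by (subst fourier_gauss_mass) (simp_all only: inv mult.left_commute, simp)
  finally have 2: "(LINT \<eta>|lborel. gauss (of_real (2 / m)) \<eta> * fourier F \<eta>)
      = gauss_mass TYPE(real^'n) (of_real (2 / m)) * (LINT y|lborel. F y * gauss (of_real (m / 2)) y)"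
    by simp
  show ?thesis unfolding 1 2 by simp
qed

lemma gauss_add: "gauss (a + b) x = gauss a x * gauss b x"
  by (simp add: gauss_def exp_add[symmetric] algebra_simps)

text \<open>Take the function in \<open>gauss_marginal\<close> to be a translated Gaussian whose Fourier transform is the
  given factor in the block sum; the remaining integral is the Fourier transform of one Gaussian.\<close>
lemma gauss_block_integral:
  fixes x :: "real^'n" and B :: complex
  assumes B: "0 < Re B"
  defines "m \<equiv> real CARD('m::finite)"
  shows "(LINT \<xi>|lborel. gauss 2 (\<xi>::real^'n^'m) * gauss B (block_sum \<xi>) * cis (2 * pi * (x \<bullet> block_sum \<xi>)))
     = gauss_mass TYPE(real^'n^'m) 2 / gauss_mass TYPE(real^'n) (of_real (2 / m))
       * gauss_mass TYPE(real^'n) (of_real (2 / m) + B) * gauss (1 / (of_real (2 / m) + B)) x"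
proof -
  have m: "0 < m" unfolding m_def by simp
  have B0: "B \<noteq> 0" using B by auto
  have Bi: "0 < Re (1 / B)" using B B0 by (simp add: Re_divide cmod_power2[symmetric] power2_eq_square[symmetric])
  have Bm: "0 < Re (of_real (2 / m) + B)" using B m by (simp add: add_pos_pos)
  \<comment> \<open>Its transform is \<open>gauss B\<close> times the character of \<open>x\<close>, up to the nonzero factor \<open>?k\<close> below.\<close>
  define F where "F y = gauss (1 / B) (x + y)" for y :: "real^'n"
  have fF: "fourier F v = gauss_mass TYPE(real^'n) (1 / B) * (gauss B v * cis (2 * pi * (x \<bullet> v)))" for v
    unfolding F_def by (subst fourier_translate, simp, subst fourier_gauss_mass[OF Bi]) (simp add: mult_ac)
  have F: "integrable lborel F"
  proof -
    have "integrable (distr lborel borel ((+) x)) (gauss (1 / B) :: real^'n \<Rightarrow> complex)"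
      using schwartz_integrable[OF schwartz_gauss[OF Bi]] by (simp only: lborel_distr_plus)
    then show ?thesis unfolding F_def[abs_def] by (subst (asm) integrable_distr_eq) auto
  qed
  let ?G = "\<lambda>\<xi>::real^'n^'m. gauss 2 \<xi> * gauss B (block_sum \<xi>) * cis (2 * pi * (x \<bullet> block_sum \<xi>))"
  let ?k = "gauss_mass TYPE(real^'n) (1 / B)"
  have k: "?k \<noteq> 0" by (rule gauss_mass_nonzero[OF Bi])
  have km: "gauss_mass TYPE(real^'n) (of_real (2 / m)) \<noteq> 0" using m by (intro gauss_mass_nonzero) simp
  have 1: "(LINT \<xi>|lborel. gauss 2 (\<xi>::real^'n^'m) * fourier F (block_sum \<xi>)) = ?k * (LINT \<xi>|lborel. ?G \<xi>)"
    unfolding fF integral_mult_right_zero[symmetric] by (simp only: mult_ac)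
  have "(LINT \<eta>|lborel. gauss (of_real (2 / m)) \<eta> * fourier F \<eta>)
      = (LINT \<eta>|lborel. ?k * (gauss (of_real (2 / m) + B) \<eta> * cis (- 2 * pi * (\<eta> \<bullet> - x))))"
    unfolding fF gauss_add by (simp add: mult_ac inner_commute)
  also have "\<dots> = ?k * fourier (gauss (of_real (2 / m) + B)) (- x)"
    by (simp add: fourier_lborel)
  also have "\<dots> = ?k * (gauss_mass TYPE(real^'n) (of_real (2 / m) + B) * gauss (1 / (of_real (2 / m) + B)) x)"
    by (simp only: fourier_gauss_mass[OF Bm]) (simp add: gauss_def)
  finally have 2: "(LINT \<eta>|lborel. gauss (of_real (2 / m)) \<eta> * fourier F \<eta>)
     = ?k * (gauss_mass TYPE(real^'n) (of_real (2 / m) + B) * gauss (1 / (of_real (2 / m) + B)) x)" .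
  have "?k * (gauss_mass TYPE(real^'n) (of_real (2 / m)) * (LINT \<xi>|lborel. ?G \<xi>))
      = ?k * (gauss_mass TYPE(real^'n^'m) 2 * (gauss_mass TYPE(real^'n) (of_real (2 / m) + B) * gauss (1 / (of_real (2 / m) + B)) x))"
    using gauss_marginal[OF F, where 'm='m] unfolding m_def[symmetric] 1 2 by (simp only: mult.left_commute)
  then have "gauss_mass TYPE(real^'n) (of_real (2 / m)) * (LINT \<xi>|lborel. ?G \<xi>)
      = gauss_mass TYPE(real^'n^'m) 2 * (gauss_mass TYPE(real^'n) (of_real (2 / m) + B) * gauss (1 / (of_real (2 / m) + B)) x)"
    using k by (simp only: mult_cancel_left) simp
  then show ?thesis using km by (simp add: field_simps)
qed

text \<open>
  The exponents of the test multiplier. The decay in the block sum completes its chirp to the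
  single Gaussian \<open>gauss (1 + iN)\<close>, to which the formula for the Fourier transform applies.
\<close>
definition quad_re :: "real^'n^'m \<Rightarrow> real" where
  "quad_re \<xi> = (norm \<xi>)\<^sup>2 + (norm (block_sum \<xi>))\<^sup>2"

definition quad_im :: "'m::finite set \<Rightarrow> real^'n^'m \<Rightarrow> real" where
  "quad_im I \<xi> = (\<Sum>i\<in>I. (norm (\<xi> $ i))\<^sup>2) + (norm (block_sum \<xi>))\<^sup>2"

lemma quad_smooth: "smooth quad_re" "smooth (quad_im I)"
  unfolding quad_re_def[abs_def] quad_im_def[abs_def]
  by (intro smooth_add smooth_sum smooth_norm_sq_linear bounded_linear_block_sum bounded_linear_ident bounded_linear_vec_nth)+

lemma block_sum_scaleR: "block_sum (t *\<^sub>R \<xi>) = t *\<^sub>R block_sum \<xi>"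
  by (simp add: block_sum_def scaleR_sum_right)

lemma quad_scaleR: "quad_re (t *\<^sub>R \<xi>) = t\<^sup>2 * quad_re \<xi>" "quad_im I (t *\<^sub>R \<xi>) = t\<^sup>2 * quad_im I \<xi>"
  by (simp_all add: quad_re_def quad_im_def block_sum_scaleR power_mult_distrib distrib_left sum_distrib_left)

text \<open>
  The parameters of the Gaussian inputs. For \<open>i \<in> I\<close> the Fourier transform has the phase opposite to
  that of the multiplier in the variable \<open>\<xi>\<^sub>i\<close>, so the multiplier focuses the input to unit width.
\<close>
definition focus :: "'m set \<Rightarrow> real \<Rightarrow> 'm \<Rightarrow> complex" where
  "focus I N i = (if i \<in> I then 1 / (1 - \<i> * of_real N) else 1)"

lemma focus_props:
  shows "1 / focus I N i = (if i \<in> I then 1 - \<i> * of_real N else 1)"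
    and "Re (focus I N i) = (if i \<in> I then 1 / (1 + N\<^sup>2) else 1)"
    and "norm (focus I N i) = (if i \<in> I then (1 + N\<^sup>2) powr (- 1 / 2) else 1)"
proof -
  have nz: "1 - \<i> * of_real N \<noteq> 0" by (simp add: complex_eq_iff)
  show "1 / focus I N i = (if i \<in> I then 1 - \<i> * of_real N else 1)" by (simp add: focus_def)
  show "Re (focus I N i) = (if i \<in> I then 1 / (1 + N\<^sup>2) else 1)"
    by (simp add: focus_def Re_divide)
  have "norm (1 - \<i> * of_real N) = sqrt (1 + N\<^sup>2)" by (simp add: cmod_def)
  also have "\<dots> = (1 + N\<^sup>2) powr (1 / 2)" by (simp add: powr_half_sqrt)
  finally show "norm (focus I N i) = (if i \<in> I then (1 + N\<^sup>2) powr (- 1 / 2) else 1)"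
    by (simp add: focus_def norm_divide powr_minus_divide)
qed

lemma multilinear_mult_chirp:
  fixes x :: "real^'n" and I :: "'m::finite set"
  defines "m \<equiv> real CARD('m)"
  shows "multilinear_mult (chirp quad_re (quad_im I) 1 N) (\<lambda>i. gauss (focus I N i)) x
    = (\<Prod>i\<in>UNIV. gauss_mass TYPE(real^'n) (focus I N i)) * (gauss_mass TYPE(real^'n^'m) 2 / gauss_mass TYPE(real^'n) (of_real (2 / m))
       * gauss_mass TYPE(real^'n) (of_real (2 / m) + (1 + \<i> * of_real N))) * gauss (1 / (of_real (2 / m) + (1 + \<i> * of_real N))) x"
proof -
  let ?P = "\<Prod>i\<in>UNIV. gauss_mass TYPE(real^'n) (focus I N i)"
  let ?B = "1 + \<i> * complex_of_real N"
  have pos: "0 < Re (focus I N i)" for i by (simp add: focus_props(2) add_pos_nonneg)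
  have B: "0 < Re ?B" by simp
  have main: "chirp quad_re (quad_im I) 1 N \<xi> * (\<Prod>i\<in>UNIV. gauss (1 / focus I N i) (\<xi> $ i)) = gauss 2 \<xi> * gauss ?B (block_sum \<xi>)"
    for \<xi> :: "real^'n^'m"
  proof -
    have "(\<Sum>i\<in>UNIV. (1 / focus I N i) * of_real ((norm (\<xi> $ i))\<^sup>2))
       = (\<Sum>i\<in>UNIV. complex_of_real ((norm (\<xi> $ i))\<^sup>2) - (if i \<in> I then \<i> * of_real N * of_real ((norm (\<xi> $ i))\<^sup>2) else 0))"
      unfolding focus_props(1) by (intro sum.cong refl) (simp add: algebra_simps)
    also have "\<dots> = of_real ((norm \<xi>)\<^sup>2) - \<i> * of_real N * of_real (\<Sum>i\<in>I. (norm (\<xi> $ i))\<^sup>2)"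
      unfolding norm_sq_blocks sum_subtractf
      by (simp add: sum.If_cases sum_distrib_left)
    finally have S: "(\<Sum>i\<in>UNIV. (1 / focus I N i) * of_real ((norm (\<xi> $ i))\<^sup>2))
       = of_real ((norm \<xi>)\<^sup>2) - \<i> * of_real N * of_real (\<Sum>i\<in>I. (norm (\<xi> $ i))\<^sup>2)" .
    have "(\<Prod>i\<in>UNIV. gauss (1 / focus I N i) (\<xi> $ i)) = exp (- (of_real pi * (\<Sum>i\<in>UNIV. (1 / focus I N i) * of_real ((norm (\<xi> $ i))\<^sup>2))))"
      unfolding gauss_def by (simp add: exp_sum[symmetric] sum_negf sum_distrib_left mult.assoc)
    then show ?thesis
      unfolding S by (simp add: chirp_def gauss_def exp_add[symmetric] quad_re_def quad_im_def algebra_simps)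
  qed
  have m_chirp: "chirp quad_re (quad_im I) 1 N \<in> borel_measurable borel"
    by (intro borel_measurable_continuous_onI continuous_at_imp_continuous_on ballI)
       (rule has_derivative_continuous[OF has_derivative_chirp[OF quad_smooth]])
  have "multilinear_mult (chirp quad_re (quad_im I) 1 N) (\<lambda>i. gauss (focus I N i)) x
     = (LINT \<xi>|lebesgue. ?P * (gauss 2 \<xi> * gauss ?B (block_sum (\<xi>::real^'n^'m)) * cis (2 * pi * (x \<bullet> block_sum \<xi>))))"
    unfolding multilinear_mult_def block_sum_def[symmetric]
  proof (intro Bochner_Integration.integral_cong refl)
    fix \<xi> :: "real^'n^'m"
    have "(\<Prod>i\<in>UNIV. fourier (gauss (focus I N i)) (\<xi> $ i)) = ?P * (\<Prod>i\<in>UNIV. gauss (1 / focus I N i) (\<xi> $ i))"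
      by (simp add: fourier_gauss_mass[OF pos] prod.distrib)
    then show "chirp quad_re (quad_im I) 1 N \<xi> * (\<Prod>i\<in>UNIV. fourier (gauss (focus I N i)) (\<xi> $ i)) * cis (2 * pi * (x \<bullet> block_sum \<xi>))
       = ?P * (gauss 2 \<xi> * gauss ?B (block_sum \<xi>) * cis (2 * pi * (x \<bullet> block_sum \<xi>)))"
      unfolding main[symmetric] by (simp only: mult_ac)
  qed
  also have "\<dots> = (LINT \<xi>|lborel. ?P * (gauss 2 \<xi> * gauss ?B (block_sum (\<xi>::real^'n^'m)) * cis (2 * pi * (x \<bullet> block_sum \<xi>))))"
    by (intro integral_completion) measurable
  also have "\<dots> = ?P * (LINT \<xi>|lborel. gauss 2 \<xi> * gauss ?B (block_sum (\<xi>::real^'n^'m)) * cis (2 * pi * (x \<bullet> block_sum \<xi>)))"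
    by (rule integral_mult_right_zero)
  finally show ?thesis
    unfolding gauss_block_integral[OF B, where 'm='m] m_def by (simp only: mult.assoc)
qed

section \<open>Comparison of growth rates\<close>
lemma powr_shift_lower:
  fixes \<gamma> N e :: real
  assumes "0 \<le> \<gamma>" "1 \<le> N"
  shows "min 1 ((\<gamma> + 1) powr e) * N powr (2 * e) \<le> (\<gamma> + N\<^sup>2) powr e"
proof (cases "0 \<le> e")
  case True
  have N2: "N powr (2 * e) = (N\<^sup>2) powr e" using assms by (simp add: powr_powr[symmetric] powr_numeral)
  have "min 1 ((\<gamma> + 1) powr e) * N powr (2 * e) \<le> 1 * N powr (2 * e)" by (intro mult_right_mono) auto
  also have "\<dots> \<le> (\<gamma> + N\<^sup>2) powr e" unfolding N2 using assms True by (auto intro!: powr_mono2)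
  finally show ?thesis .
next
  case False
  have N2: "N powr (2 * e) = (N\<^sup>2) powr e" using assms by (simp add: powr_powr[symmetric] powr_numeral)
  have "1 \<le> N\<^sup>2" using assms by (simp add: one_le_power)
  then have "\<gamma> * 1 \<le> \<gamma> * N\<^sup>2" using assms by (intro mult_left_mono)
  then have "\<gamma> + N\<^sup>2 \<le> (\<gamma> + 1) * N\<^sup>2" by (simp add: algebra_simps)
  moreover have "0 < \<gamma> + N\<^sup>2" using assms \<open>1 \<le> N\<^sup>2\<close> by linarith
  ultimately have "((\<gamma> + 1) * N\<^sup>2) powr e \<le> (\<gamma> + N\<^sup>2) powr e" using False by (intro powr_mono2') auto
  then have "(\<gamma> + 1) powr e * N powr (2 * e) \<le> (\<gamma> + N\<^sup>2) powr e"
    using assms unfolding N2 by (simp add: powr_mult)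
  moreover have "min 1 ((\<gamma> + 1) powr e) * N powr (2 * e) \<le> (\<gamma> + 1) powr e * N powr (2 * e)"
    by (intro mult_right_mono) auto
  ultimately show ?thesis by (rule order_trans[rotated])
qed

lemma divide_powr_minus: "x / y powr (- a / b) = x * y powr (a / b)" for x y a b :: real
  by (simp add: powr_minus_divide)

lemma exponent_comparison:
  fixes \<kappa> D e s :: real
  assumes "0 < \<kappa>" and le: "\<And>N. 1 \<le> N \<Longrightarrow> \<kappa> * N powr e \<le> D * N powr s"
  shows "e \<le> s"
proof (rule ccontr)
  assume "\<not> e \<le> s"
  then have "filterlim (\<lambda>N::real. N powr (e - s)) at_top at_top" by real_asymp
  then have "\<forall>\<^sub>F N in at_top. D / \<kappa> < N powr (e - s)" by (simp add: filterlim_at_top_dense)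
  moreover have "\<forall>\<^sub>F N::real in at_top. 1 \<le> N" by (rule eventually_ge_at_top)
  ultimately have "\<forall>\<^sub>F N::real in at_top. D / \<kappa> < N powr (e - s) \<and> 1 \<le> N" by (rule eventually_conj)
  then obtain N :: real where N: "D / \<kappa> < N powr (e - s)" "1 \<le> N"
    using eventually_happens[of _ at_top] by force
  then have "D < \<kappa> * N powr (e - s)" using assms(1) by (simp add: field_simps)
  then have "D * N powr s < \<kappa> * N powr (e - s) * N powr s" using N(2) by (intro mult_strict_right_mono) auto
  also have "\<dots> = \<kappa> * N powr e" by (simp add: mult.assoc powr_add[symmetric])
  finally show False using le[OF N(2)] by simp
qed

text \<open>The operator norm is an infimum over the extended half line, so it is tested against each
  admissible constant; positivity of the norms of the inputs permits division.\<close>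
lemma mult_opnorm_lower_bound:
  assumes f: "\<And>i. schwartz (f i)"
    and T: "Lp_norm p (multilinear_mult \<sigma> f) = ennreal X" and F: "\<And>i. Lp_norm (ps i) (f i) = ennreal (Y i)"
    and Y: "\<And>i. 0 < Y i" and le: "mult_opnorm ps p \<sigma> \<le> ennreal D" and D: "0 \<le> D"
  shows "X \<le> D * (\<Prod>i\<in>UNIV. Y (i::'m::finite))"
proof -
  let ?Y = "\<Prod>i\<in>UNIV. Y i"
  have Y0: "0 < ?Y" using Y by (intro prod_pos) auto
  have FY: "(\<Prod>i\<in>UNIV. Lp_norm (ps i) (f i)) = ennreal ?Y" 
    unfolding F using Y by (intro prod_ennreal) (auto intro: less_imp_le)
  have "ennreal (X / ?Y) \<le> mult_opnorm ps p \<sigma>"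
    unfolding mult_opnorm_def
  proof (rule Inf_greatest, clarify)
    fix K assume "\<forall>f. (\<forall>i. schwartz (f i)) \<longrightarrow> Lp_norm p (multilinear_mult \<sigma> f) \<le> K * (\<Prod>i\<in>UNIV. Lp_norm (ps i) (f i))"
    then have K: "ennreal X \<le> K * ennreal ?Y" using f unfolding T[symmetric] FY[symmetric] by blast
    show "ennreal (X / ?Y) \<le> K"
    proof (cases K)
      case (real k)
      then have "ennreal X \<le> ennreal (k * ?Y)" using K Y0 by (simp add: ennreal_mult)
      then have "X \<le> k * ?Y" using real Y0 by (simp add: ennreal_le_iff)
      then show ?thesis using real Y0 by (simp add: ennreal_leI pos_divide_le_eq)
    qed simp
  qed
  then have "ennreal (X / ?Y) \<le> ennreal D" using le by (rule order_trans)
  then have "X / ?Y \<le> D" using D by (simp add: ennreal_le_iff)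
  then show ?thesis using Y0 by (simp add: pos_divide_le_eq)
qed

theorem theorem3:
  fixes ps :: "'m::finite \<Rightarrow> real" and p r s :: real
    and \<Psi> :: "real^'n::finite^'m \<Rightarrow> real"
  assumes "dyadic_partition \<Psi>"
    and "\<And>i. 0 < ps i"
    and "p = inverse (\<Sum>i\<in>UNIV. 1 / ps i)"
    and "1 < r" and "0 < s"
    and "\<exists>C\<ge>0. \<forall>\<sigma> :: real^'n^'m \<Rightarrow> complex.
           \<sigma> \<in> borel_measurable lebesgue \<and> bounded (range \<sigma>) \<and> sup_sobolev r s \<Psi> \<sigma> < \<infinity> \<longrightarrow>
           mult_opnorm ps p \<sigma> \<le> ennreal C * sup_sobolev r s \<Psi> \<sigma>"
  shows "\<forall>I :: 'm set. 1 / p - 1 / 2 \<le> s / real CARD('n) + (\<Sum>i\<in>I. (1 / ps i - 1 / 2))"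
proof
  fix I :: "'m set"
  define n where "n = real CARD('n)"
  define m where "m = real CARD('m)"
  have n: "0 < n" and m: "0 < m" by (simp_all add: n_def m_def)
  have inv_p: "1 / p = (\<Sum>i\<in>UNIV. 1 / ps i)" using assms(3) by (simp add: divide_inverse)
  have "0 < (\<Sum>i\<in>UNIV. 1 / ps i)" using assms(2) by (intro sum_pos) auto
  then have p: "0 < p" using assms(3) by simp
  obtain C where C: "0 \<le> C" "\<And>\<sigma> :: real^'n^'m \<Rightarrow> complex.
      \<sigma> \<in> borel_measurable lebesgue \<Longrightarrow> bounded (range \<sigma>) \<Longrightarrow> sup_sobolev r s \<Psi> \<sigma> < \<infinity> \<Longrightarrow>
      mult_opnorm ps p \<sigma> \<le> ennreal C * sup_sobolev r s \<Psi> \<sigma>"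
    using assms(6) by blast
  let ?\<sigma> = "\<lambda>N. chirp quad_re (quad_im I) 1 N :: real^'n^'m \<Rightarrow> complex"
  have qre: "(norm \<xi>)\<^sup>2 \<le> quad_re \<xi>" for \<xi> :: "real^'n^'m" by (simp add: quad_re_def)
  obtain D where D: "0 \<le> D" "\<And>N. 1 \<le> N \<Longrightarrow> sup_sobolev r s \<Psi> (?\<sigma> N) \<le> ennreal (D * N powr s)"
    using sup_sobolev_chirp[OF quad_smooth qre quad_scaleR assms(1,4,5)] by blast
  have op: "mult_opnorm ps p (?\<sigma> N) \<le> ennreal (C * (D * N powr s))" if "1 \<le> N" for N
  proof -
    have "?\<sigma> N \<in> borel_measurable borel"
      by (intro borel_measurable_continuous_onI continuous_at_imp_continuous_on ballI)
         (rule has_derivative_continuous[OF has_derivative_chirp[OF quad_smooth]])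
    then have 1: "?\<sigma> N \<in> borel_measurable lebesgue" by (intro measurable_completion) simp
    have "norm (?\<sigma> N \<xi>) \<le> 1" for \<xi>
      by (simp add: norm_chirp quad_re_def)
    then have 2: "bounded (range (?\<sigma> N))" unfolding bounded_iff by blast
    have 3: "sup_sobolev r s \<Psi> (?\<sigma> N) < \<infinity>" using D(2)[OF that] by (rule order_le_less_trans) simp
    have "mult_opnorm ps p (?\<sigma> N) \<le> ennreal C * ennreal (D * N powr s)"
      by (rule order_trans[OF C(2)[OF 1 2 3]]) (intro mult_left_mono D(2) that, simp)
    then show ?thesis using C(1) D(1) by (simp add: ennreal_mult)
  qed
  \<comment> \<open>The output of the operator is a multiple of \<open>gauss (1 / (\<beta> + iN))\<close>.\<close>
  define \<beta> where "\<beta> = 2 / m + 1"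
  have \<beta>: "0 < \<beta>" using m by (simp add: \<beta>_def add_pos_pos)
  define K0 where "K0 = norm (gauss_mass TYPE(real^'n^'m) 2) / norm (gauss_mass TYPE(real^'n) (of_real (2 / m)))"
  have K0: "0 < K0" unfolding K0_def using gauss_mass_nonzero[of "2", where 'a="real^'n^'m"] gauss_mass_nonzero[of "of_real (2 / m)", where 'a="real^'n"] m by simp
  define Y where "Y N i = (ps i * Re (focus I N i)) powr (- n / (2 * ps i))" for N i
  define e1 where "e1 = (\<Sum>i\<in>I. n / 4 - n / (2 * ps i))"
  define e2 where "e2 = n / (2 * p) - n / 4"
  define P where "P = (\<Prod>i\<in>UNIV. ps i powr (- n / (2 * ps i)))"
  have P: "0 < P" unfolding P_def using assms(2) by (intro prod_pos) (auto simp: less_imp_neq[THEN not_sym])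
  \<comment> \<open>The norm of the output: the masses of the inputs give the first power, the norm and the mass of
    the output Gaussian together give \<open>e2\<close>.\<close>
  define X where "X N = (1 + N\<^sup>2) powr (\<Sum>i\<in>I. n / 4) * K0 * (\<beta>\<^sup>2 + N\<^sup>2) powr e2 * (p * \<beta>) powr (- n / (2 * p))" for N
  have ineq: "X N \<le> C * (D * N powr s) * (P * (1 + N\<^sup>2) powr (\<Sum>i\<in>I. n / (2 * ps i)))" if N: "1 \<le> N" for N
  proof -
    have N2: "0 < 1 + N\<^sup>2" by (simp add: add_pos_nonneg)
    have \<beta>N: "0 < \<beta>\<^sup>2 + N\<^sup>2" using \<beta> by (simp add: add_pos_nonneg)
    have pos: "0 < Re (focus I N i)" for i by (simp add: focus_props(2) add_pos_nonneg)
    define w where "w = complex_of_real (2 / m) + (1 + \<i> * of_real N)"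
    have b: "w = Complex \<beta> N" by (simp add: w_def \<beta>_def complex_eq_iff)
    have nb: "norm w = (\<beta>\<^sup>2 + N\<^sup>2) powr (1 / 2)" unfolding b by (simp add: cmod_def powr_half_sqrt)
    have Rb: "Re (1 / w) = \<beta> / (\<beta>\<^sup>2 + N\<^sup>2)" unfolding b by (simp add: Re_divide)
    have prodI: "(\<Prod>i\<in>UNIV. if i \<in> I then (1 + N\<^sup>2) powr g i else 1) = (1 + N\<^sup>2) powr (\<Sum>i\<in>I. g i)" for g :: "'m \<Rightarrow> real"
      using N2 by (simp add: prod.If_cases powr_sum)
    have Lf: "Lp_norm (ps i) (gauss (focus I N i) :: real^'n \<Rightarrow> complex) = ennreal (Y N i)" for i
      using Lp_norm_gauss[OF assms(2) pos, of i 1 i, where 'a="real^'n"] by (simp add: Y_def n_def)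
    have Y: "0 < Y N i" for i
      using assms(2)[of i] pos[of i] unfolding Y_def powr_gt_zero by (metis mult_pos_pos less_irrefl)
    have gm: "norm (gauss_mass TYPE(real^'n) (focus I N i)) = (if i \<in> I then (1 + N\<^sup>2) powr (n / 4) else 1)" for i
      using N2 by (simp add: norm_gauss_mass[OF pos] focus_props(3) n_def powr_powr)
    have gb: "norm (gauss_mass TYPE(real^'n) w) = (\<beta>\<^sup>2 + N\<^sup>2) powr (- n / 4)"
    proof -
      have "0 < Re w" using \<beta> by (simp add: b)
      then show ?thesis by (simp add: norm_gauss_mass nb powr_powr n_def)
    qed
    have "Lp_norm p (multilinear_mult (?\<sigma> N) (\<lambda>i. gauss (focus I N i)))
        = ennreal ((\<Prod>i\<in>UNIV. norm (gauss_mass TYPE(real^'n) (focus I N i))) * (K0 * norm (gauss_mass TYPE(real^'n) w)) * (p * Re (1 / w)) powr (- n / (2 * p)))"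
    proof -
      have "0 < Re (1 / w)" unfolding Rb using \<beta> \<beta>N by simp
      moreover have "multilinear_mult (?\<sigma> N) (\<lambda>i. gauss (focus I N i)) =
        (\<lambda>x. ((\<Prod>i\<in>UNIV. gauss_mass TYPE(real^'n) (focus I N i)) * (gauss_mass TYPE(real^'n^'m) 2 /
           gauss_mass TYPE(real^'n) (of_real (2 / m)) * gauss_mass TYPE(real^'n) w)) * gauss (1 / w) x)"
        by (intro ext) (simp only: multilinear_mult_chirp m_def[symmetric] w_def)
      ultimately show ?thesis
        by (simp only: Lp_norm_gauss[OF p] norm_mult norm_divide prod_norm[symmetric] K0_def n_def DIM_cart DIM_real mult_1_right)
    qed
    also have "(\<Prod>i\<in>UNIV. norm (gauss_mass TYPE(real^'n) (focus I N i))) = (1 + N\<^sup>2) powr (\<Sum>i\<in>I. n / 4)"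
      unfolding gm by (rule prodI)
    also have "(p * Re (1 / w)) powr (- n / (2 * p)) = (p * \<beta>) powr (- n / (2 * p)) * (\<beta>\<^sup>2 + N\<^sup>2) powr (n / (2 * p))"
    proof -
      have "p * Re (1 / w) = (p * \<beta>) / (\<beta>\<^sup>2 + N\<^sup>2)" unfolding Rb by simp
      moreover have "((p * \<beta>) / (\<beta>\<^sup>2 + N\<^sup>2)) powr (- n / (2 * p)) = (p * \<beta>) powr (- n / (2 * p)) / (\<beta>\<^sup>2 + N\<^sup>2) powr (- n / (2 * p))"
        by (rule powr_divide)
      ultimately have "(p * Re (1 / w)) powr (- n / (2 * p)) = (p * \<beta>) powr (- n / (2 * p)) / (\<beta>\<^sup>2 + N\<^sup>2) powr (- n / (2 * p))"
        by simp
      then show ?thesis by (simp only: divide_powr_minus)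
    qed
    also have "(1 + N\<^sup>2) powr (\<Sum>i\<in>I. n / 4) * (K0 * norm (gauss_mass TYPE(real^'n) w)) * ((p * \<beta>) powr (- n / (2 * p)) * (\<beta>\<^sup>2 + N\<^sup>2) powr (n / (2 * p))) = X N"
    proof -
      have "(\<beta>\<^sup>2 + N\<^sup>2) powr (- n / 4) * (\<beta>\<^sup>2 + N\<^sup>2) powr (n / (2 * p)) = (\<beta>\<^sup>2 + N\<^sup>2) powr e2"
        unfolding powr_add[symmetric] e2_def by simp
      then show ?thesis unfolding gb X_def by (simp add: mult_ac)
    qed
    finally have LT: "Lp_norm p (multilinear_mult (?\<sigma> N) (\<lambda>i. gauss (focus I N i))) = ennreal (X N)" .
    have "X N \<le> C * (D * N powr s) * (\<Prod>i\<in>UNIV. Y N i)"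
      by (rule mult_opnorm_lower_bound[OF schwartz_gauss[OF pos] LT Lf Y op[OF N]]) (use C(1) D(1) in simp)
    also have "(\<Prod>i\<in>UNIV. Y N i) = P * (1 + N\<^sup>2) powr (\<Sum>i\<in>I. n / (2 * ps i))"
    proof -
      have "Y N i = ps i powr (- n / (2 * ps i)) * (if i \<in> I then (1 + N\<^sup>2) powr (n / (2 * ps i)) else 1)" for i
      proof (cases "i \<in> I")
        case True
        then have "Y N i = (ps i / (1 + N\<^sup>2)) powr (- n / (2 * ps i))" by (simp add: Y_def focus_props(2))
        also have "\<dots> = ps i powr (- n / (2 * ps i)) / (1 + N\<^sup>2) powr (- n / (2 * ps i))"
          by (rule powr_divide)
        finally show ?thesis using True by (simp only: divide_powr_minus if_True)
      qed (simp add: Y_def focus_props(2))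
      then show ?thesis by (simp only: prod.distrib prodI P_def)
    qed
    finally show ?thesis .
  qed
  \<comment> \<open>The minima come from \<open>powr_shift_lower\<close>, as the signs of \<open>e1\<close> and \<open>e2\<close> are not known.\<close>
  define \<kappa> where "\<kappa> = K0 * (p * \<beta>) powr (- n / (2 * p)) * (min 1 ((1 + 1) powr e1) * min 1 ((\<beta>\<^sup>2 + 1) powr e2))"
  have "0 < \<beta>\<^sup>2 + 1" by (simp add: add_nonneg_pos)
  then have \<kappa>: "0 < \<kappa>" unfolding \<kappa>_def using K0 p \<beta> by (auto intro!: mult_pos_pos)
  have "\<kappa> * N powr (2 * e1 + 2 * e2) \<le> (C * D * P) * N powr s" if N: "1 \<le> N" for N
  proof -
    let ?w = "(1 + N\<^sup>2) powr (\<Sum>i\<in>I. n / (2 * ps i))"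
    have N2: "0 < 1 + N\<^sup>2" by (simp add: add_pos_nonneg)
    have w: "0 < ?w" using N2 by simp
    have split: "(1 + N\<^sup>2) powr (\<Sum>i\<in>I. n / 4) = (1 + N\<^sup>2) powr e1 * ?w"
      unfolding powr_add[symmetric] e1_def sum_subtractf by simp
    have "(K0 * (p * \<beta>) powr (- n / (2 * p)) * ((1 + N\<^sup>2) powr e1 * (\<beta>\<^sup>2 + N\<^sup>2) powr e2)) * ?w \<le> ((C * D * P) * N powr s) * ?w"
      using ineq[OF N] unfolding X_def split by (simp add: mult_ac)
    then have "K0 * (p * \<beta>) powr (- n / (2 * p)) * ((1 + N\<^sup>2) powr e1 * (\<beta>\<^sup>2 + N\<^sup>2) powr e2) \<le> (C * D * P) * N powr s"
      using w by (rule mult_right_le_imp_le)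
    moreover have "\<kappa> * N powr (2 * e1 + 2 * e2) = K0 * (p * \<beta>) powr (- n / (2 * p)) *
        ((min 1 ((1 + 1) powr e1) * N powr (2 * e1)) * (min 1 ((\<beta>\<^sup>2 + 1) powr e2) * N powr (2 * e2)))"
      unfolding \<kappa>_def powr_add by (simp only: mult_ac)
    moreover have "\<dots> \<le> K0 * (p * \<beta>) powr (- n / (2 * p)) * ((1 + N\<^sup>2) powr e1 * (\<beta>\<^sup>2 + N\<^sup>2) powr e2)"
      using K0 N by (intro mult_left_mono mult_mono powr_shift_lower) auto
    ultimately show ?thesis by linarith
  qed
  then have "2 * e1 + 2 * e2 \<le> s" by (rule exponent_comparison[OF \<kappa>])
  moreover have "2 * e1 + 2 * e2 = n * ((1 / p - 1 / 2) - (\<Sum>i\<in>I. (1 / ps i - 1 / 2)))"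
    by (simp add: e1_def e2_def sum_subtractf sum_distrib_left right_diff_distrib)
  ultimately have "(1 / p - 1 / 2) - (\<Sum>i\<in>I. (1 / ps i - 1 / 2)) \<le> s / n"
    using n by (simp add: pos_le_divide_eq mult.commute)
  then show "1 / p - 1 / 2 \<le> s / real CARD('n) + (\<Sum>i\<in>I. (1 / ps i - 1 / 2))"
    unfolding n_def by simp
qed

end
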